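(* Let $(\Omega,\mathcal F,\mu)$, the random distributions $\mathbb P_1,\dots,\mathbb P_K$, the empirical distributions $\widehat{\mathbb P}_1,\dots,\widehat{\mathbb P}_K$ and the cumulative distribution functions $F_k$, $k\in[K]$, be as in the context. Then for all $k\in[K]=\{1,\dots,K\}$, all $\varepsilon_k,\widehat r_k\in\mathbb{R}_+$ with $\varepsilon_k\ge\widehat r_k$ and $\mu(W_p(\widehat{\mathbb P}_1,\widehat{\mathbb P}_k)\le\widehat r_k)>0$, and all $N_1,N_k\in\mathbb N$, $$\mu\Big(\mathbb P_1\in\mathbb B^p_{\varepsilon_k}(\widehat{\mathbb P}_k)\,\Big|\,W_p(\widehat{\mathbb P}_1,\widehat{\mathbb P}_k)\le\widehat r_k\Big)\ge1-\beta_{F_k}(\varepsilon_k,\widehat r_k,N_1,N_k),$$ where $$\beta_{F_k}(\varepsilon_k,\widehat r_k,N_1,N_k)=\frac{\beta(\varepsilon_k-\widehat r_k,N_1)\cdot\Big(\int_0^{\varepsilon_k}\beta(\varepsilon_k-r_k,N_k)\,\mathrm dF_k(r_k)+1-F_k(\varepsilon_k)\Big)}{\mu\big(W_p(\widehat{\mathbb P}_1,\widehat{\mathbb P}_k)\le\widehat r_k\big)}.$$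
   Context: $\Xi\subseteq\mathbb{R}^d$ is closed and convex, $p\ge1$ with $p\ne d/2$, $W_p$ is the $p$-Wasserstein distance induced by a metric on $\Xi$, and $\mathbb B^p_r(\mathbb P)=\{\mathbb Q\in\mathcal P(\Xi): W_p(\mathbb Q,\mathbb P)\le r\}$, where $\mathcal P(\Xi)$ is the set of probability distributions on $\Xi$. The distribution $\mathbb P_1$ is the target distribution. Both the distributions $\mathbb P_k\in\mathcal P(\Xi)$, $k\in[K]$, and the samples $\widehat\xi_{k,j}\in\Xi$, $j\in[N_k]$, $k\in[K]$, are random objects on an abstract probability space $(\Omega,\mathcal F,\mu)$ such that, conditional on any fixed realizations of $\mathbb P_1,\dots,\mathbb P_K$, all samples are mutually independent under $\mu$ and the conditional distribution of $\widehat\xi_{k,j}$ is $\mathbb P_k$ for all $j\in[N_k]$ and $k\in[K]$. $\widehat{\mathbb P}_k=\frac1{N_k}\sum_{j=1}^{N_k}\delta_{\widehat\xi_{k,j}}$ is the empirical distribution of the samples from $\mathbb P_k$. There are $a>p$ and $A>0$ such that, $\mu$-almost surely, every $\mathbb P_k$ is $(a,A)$-light tailed, i.e., $\mathbb E_{\mathbb P_k}[\exp(\|\xi\|^a)]\le A$. $F_k$ is the cumulative distribution function of $W_p(\mathbb P_1,\mathbb P_k)$ under $\mu$; integrals $\int_0^{\varepsilon_k}\cdot\,\mathrm dF_k$ are over the closed interval $[0,\varepsilon_k]$. The constants $c_1,c_2>0$, depending only on $a$, $A$ and $d$, are such that the following concentration inequality holds: if $\mathbb P'\in\mathcal P(\Xi)$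 is $(a,A)$-light tailed and $\widehat{\mathbb P}'$ is the empirical distribution of $N$ independent samples from $\mathbb P'$, then $W_p(\mathbb P',\widehat{\mathbb P}')\le\varepsilon$ with probability at least $1-\beta(\varepsilon,N)$ for all $\varepsilon\in\mathbb{R}_+$ and $N\in\mathbb N$, where $$\beta(\varepsilon,N)=\begin{cases}c_1\exp(-c_2N\varepsilon^{\max\{d/p,2\}})&\text{if }\varepsilon\le1,\\ c_1\exp(-c_2N\varepsilon^{a/p})&\text{if }\varepsilon>1.\end{cases}$$ (This inequality is a known result from earlier work and is a given here.)
   Formalization: The case k = 1 is excluded: there the two empirical distributions coincide, and for r_1 = 0 the claim would bound the failure probability by β(ε_1,N_1)², which is false for general admissible constants c_1, c_2; the formal theorem covers k = 2,…,K. *)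

theory Defs
  imports "HOL-Probability.Probability"
begin

abbreviation borel_on :: "'a::topological_space set \<Rightarrow> 'a measure" where
  "borel_on X \<equiv> restrict_space borel X"

text \<open>The set of probability distributions on \<open>X\<close> is the space of \<open>prob_algebra (borel_on X)\<close>;
  its elements are measures whose underlying space is \<open>X\<close> itself.\<close>

abbreviation distributions :: "'a::topological_space set \<Rightarrow> 'a measure set" where
  "distributions X \<equiv> space (prob_algebra (borel_on X))"

definition couplings :: "'a::topological_space set \<Rightarrow> 'a measure \<Rightarrow> 'a measure \<Rightarrow> ('a \<times> 'a) measure set" where
  "couplings X P Q = {\<pi> \<in> space (prob_algebra (borel_on X \<Otimes>\<^sub>M borel_on X)).
     distr \<pi> (borel_on X) fst = P \<and> distr \<pi> (borel_on X) snd = Q}"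

definition ennreal_root :: "real \<Rightarrow> ennreal \<Rightarrow> ennreal" where
  "ennreal_root p x = (if x = \<infinity> then \<infinity> else ennreal (enn2real x powr (1 / p)))"

text \<open>The distance takes values in \<open>[0, \<infinity>]\<close> because no moment condition is imposed on
  \<open>distributions X\<close>. The ground metric \<open>dst\<close> need not be the Euclidean one.\<close>

definition wasserstein ::
  "'a::topological_space set \<Rightarrow> ('a \<Rightarrow> 'a \<Rightarrow> real) \<Rightarrow> real \<Rightarrow> 'a measure \<Rightarrow> 'a measure \<Rightarrow> ennreal" where
  "wasserstein X dst p P Q =
     ennreal_root p (INF \<pi>\<in>couplings X P Q. \<integral>\<^sup>+z. ennreal (dst (fst z) (snd z) powr p) \<partial>\<pi>)"

definition wasserstein_ball ::
  "'a::topological_space set \<Rightarrow> ('a \<Rightarrow> 'a \<Rightarrow> real) \<Rightarrow> real \<Rightarrow> real \<Rightarrow> 'a measure \<Rightarrow> 'a measure set" where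
  "wasserstein_ball X dst p r P = {Q \<in> distributions X. wasserstein X dst p Q P \<le> ennreal r}"

definition light_tailed :: "real \<Rightarrow> real \<Rightarrow> 'a::real_normed_vector measure \<Rightarrow> bool" where
  "light_tailed a A P \<longleftrightarrow> (\<integral>\<^sup>+\<xi>. ennreal (exp (norm \<xi> powr a)) \<partial>P) \<le> ennreal A"

text \<open>The image of the uniform distribution on the indices \<open>{1..n}\<close> under \<open>x\<close>, that is,
  \<open>1/n\<close> times the sum of the Dirac measures at \<open>x 1, \<dots>, x n\<close>; it is meant for \<open>n \<ge> 1\<close>.\<close>

definition empirical :: "'a::topological_space set \<Rightarrow> nat \<Rightarrow> (nat \<Rightarrow> 'a) \<Rightarrow> 'a measure" where
  "empirical X n x = distr (uniform_count_measure {1..n}) (borel_on X) x"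

lemma emeasure_empirical:
  assumes "\<And>j. j \<in> {1..n} \<Longrightarrow> x j \<in> X" "B \<in> sets (borel_on X)"
  shows "emeasure (empirical X n x) B = ennreal ((\<Sum>j\<in>{1..n}. indicator B (x j)) / real n)"
proof -
  have m: "x \<in> uniform_count_measure {1..n} \<rightarrow>\<^sub>M borel_on X"
    using assms(1) by (intro measurableI) (auto simp: space_uniform_count_measure
        sets_uniform_count_measure space_restrict_space)
  have eq: "x -` B \<inter> {1..n} = {j \<in> {1..n}. x j \<in> B}" by auto
  have s: "(\<Sum>j\<in>{1..n}. indicator B (x j) :: real) = real (card {j \<in> {1..n}. x j \<in> B})"
    by (simp add: indicator_def sum.If_cases Int_def)
  have sub: "{j \<in> {1..n}. x j \<in> B} \<subseteq> {1..n}" by blast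
  show ?thesis
    unfolding empirical_def emeasure_distr[OF m assms(2)] space_uniform_count_measure eq s
    by (subst emeasure_uniform_count_measure[OF finite_atLeastAtMost sub]) simp
qed

text \<open>Conditional probability of an event, conditional distribution and conditional mutual
  independence given a sub-\<open>\<sigma>\<close>-algebra \<open>F\<close> of \<open>M\<close>. The conditional distribution is a
  random measure \<open>\<kappa>\<close>.\<close>

definition cond_probability :: "'w measure \<Rightarrow> 'w measure \<Rightarrow> ('w \<Rightarrow> bool) \<Rightarrow> 'w \<Rightarrow> real" where
  "cond_probability M F E = real_cond_exp M F (indicator {\<omega> \<in> space M. E \<omega>})"

definition has_cond_distr ::
  "'w measure \<Rightarrow> 'w measure \<Rightarrow> 'a measure \<Rightarrow> ('w \<Rightarrow> 'a) \<Rightarrow> ('w \<Rightarrow> 'a measure) \<Rightarrow> bool" where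
  "has_cond_distr M F S Y \<kappa> \<longleftrightarrow>
     (\<forall>B\<in>sets S. AE \<omega> in M. cond_probability M F (\<lambda>\<omega>'. Y \<omega>' \<in> B) \<omega> = measure (\<kappa> \<omega>) B)"

definition cond_indep_vars ::
  "'w measure \<Rightarrow> 'w measure \<Rightarrow> 'a measure \<Rightarrow> ('i \<Rightarrow> 'w \<Rightarrow> 'a) \<Rightarrow> 'i set \<Rightarrow> bool" where
  "cond_indep_vars M F S Y I \<longleftrightarrow>
     (\<forall>J\<subseteq>I. J \<noteq> {} \<longrightarrow> finite J \<longrightarrow> (\<forall>B\<in>J \<rightarrow> sets S. AE \<omega> in M.
        cond_probability M F (\<lambda>\<omega>'. \<forall>i\<in>J. Y i \<omega>' \<in> B i) \<omega> =
        (\<Prod>i\<in>J. cond_probability M F (\<lambda>\<omega>'. Y i \<omega>' \<in> B i) \<omega>)))"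

text \<open>The \<open>\<sigma>\<close>-algebra on \<open>space M\<close> generated by the random distributions \<open>P 1, \<dots>, P K\<close>.\<close>

definition sigma_distributions ::
  "'w measure \<Rightarrow> 'a::topological_space set \<Rightarrow> nat \<Rightarrow> (nat \<Rightarrow> 'w \<Rightarrow> 'a measure) \<Rightarrow> 'w measure" where
  "sigma_distributions M X K P =
     vimage_algebra (space M) (\<lambda>\<omega>. \<lambda>k\<in>{1..K}. P k \<omega>) (\<Pi>\<^sub>M k\<in>{1..K}. prob_algebra (borel_on X))"

definition conc_beta ::
  "real \<Rightarrow> real \<Rightarrow> real \<Rightarrow> real \<Rightarrow> nat \<Rightarrow> real \<Rightarrow> nat \<Rightarrow> real" where
  "conc_beta c1 c2 a p d \<epsilon> n =
     (if \<epsilon> \<le> 1 then c1 * exp (- c2 * real n * \<epsilon> powr max (real d / p) 2)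
      else c1 * exp (- c2 * real n * \<epsilon> powr (a / p)))"

text \<open>The law of \<open>n\<close> independent samples from \<open>P\<close> is the product measure over \<open>{1..n}\<close>.\<close>

definition concentration ::
  "(real^'d) set \<Rightarrow> (real^'d \<Rightarrow> real^'d \<Rightarrow> real) \<Rightarrow> real \<Rightarrow> real \<Rightarrow> real \<Rightarrow> real \<Rightarrow> real \<Rightarrow> bool" where
  "concentration X dst p a A c1 c2 \<longleftrightarrow>
     (\<forall>P\<in>distributions X. light_tailed a A P \<longrightarrow> (\<forall>\<epsilon>\<ge>0. \<forall>n\<ge>1.
        \<P>(x in (\<Pi>\<^sub>M j\<in>{1..n}. P). wasserstein X dst p P (empirical X n x) \<le> ennreal \<epsilon>)
          \<ge> 1 - conc_beta c1 c2 a p CARD('d) \<epsilon> n))"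

text \<open>The comparison is made in the extended reals so that the function vanishes for \<open>r < 0\<close>
  (\<open>ennreal r\<close> would be \<open>0\<close> there) and an infinite value of \<open>D\<close> is never counted.\<close>

definition ennreal_cdf :: "'w measure \<Rightarrow> ('w \<Rightarrow> ennreal) \<Rightarrow> real \<Rightarrow> real" where
  "ennreal_cdf M D r = \<P>(\<omega> in M. enn2ereal (D \<omega>) \<le> ereal r)"

text \<open>The integral is the Lebesgue-Stieltjes integral over the closed interval, so an atom at
  \<open>0\<close> (or at \<open>\<epsilon>\<close>) is included. The argument \<open>b\<close> is the concentration function, and \<open>q\<close> is the
  probability of the conditioning event.\<close>

definition beta_F ::
  "(real \<Rightarrow> nat \<Rightarrow> real) \<Rightarrow> (real \<Rightarrow> real) \<Rightarrow> real \<Rightarrow> real \<Rightarrow> real \<Rightarrow> nat \<Rightarrow> nat \<Rightarrow> real" where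
  "beta_F b F q \<epsilon> r n1 nk =
     b (\<epsilon> - r) n1 * ((LINT t:{0..\<epsilon>}|interval_measure F. b (\<epsilon> - t) nk) + 1 - F \<epsilon>) / q"

end

theory Submission
  imports Defs
begin

text \<open>By the triangle inequality, the event that \<open>W(P\<^sub>1, Phat\<^sub>k) > \<epsilon>\<close> although
  \<open>W(Phat\<^sub>1, Phat\<^sub>k) \<le> r\<close> is contained in the intersection of \<open>W(P\<^sub>1, Phat\<^sub>1) > \<epsilon> - r\<close> and
  \<open>W(P\<^sub>1, Phat\<^sub>k) > \<epsilon>\<close>, which are conditionally independent given the distributions. The
  conditional probability of the first is at most \<open>\<beta>(\<epsilon> - r, N\<^sub>1)\<close>; that of the second, by the triangle
  inequality through \<open>P\<^sub>k\<close>, is at most \<open>\<beta>(\<epsilon> - D, N\<^sub>k)\<close> where \<open>D = W(P\<^sub>1, P\<^sub>k) \<le> \<epsilon>\<close>, and at most 1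
  elsewhere. Integrating over the law of \<open>D\<close> gives the bound.

  The ground metric is merely Borel measurable, so neither the triangle inequality nor the
  measurability of \<open>W(Q, Qhat)\<close> in \<open>Q\<close> and the sample \<open>z\<close> is immediate. Both follow from describing a plan
  from \<open>Q\<close> to the empirical distribution of \<open>z\<^sub>1, \<dots>, z\<^sub>n\<close> by densities \<open>f\<^sub>1, \<dots>, f\<^sub>n\<close> with respect to
  \<open>Q\<close>: gluing then needs no disintegration, and the infimum over the densities may be taken over a
  countable family depending measurably on \<open>Q\<close> and \<open>z\<close>.\<close>

section \<open>Plans to an empirical distribution\<close>

text \<open>The delicate point of the countable family is that the shares of a plan must have total
  mass exactly \<open>1 / n\<close> for each sample point. This condition depends on
  \<open>Q\<close>, and shares given by a formula in the costs will not satisfy it in general. The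
  family therefore consists of shares computed from the costs alone, whose masses are only close to
  \<open>1 / n\<close> for a given \<open>Q\<close>. Closeness suffices: redistributing a fraction
  \<open>\<theta>\<close> of the mass in a region where all costs are below \<open>M\<close>
  corrects the marginals and costs at most \<open>\<theta> * M\<close> more, and
  \<open>\<theta>\<close> is chosen after \<open>M\<close>. Costs need be neither bounded nor
  integrable; so the correction stays in that region, and beyond the grid the mass goes to the
  cheapest point.

  Measurability is needed twice: to pass from the concentration inequality to the complementary
  event, and to integrate conditional probabilities of events in which distributions and samples
  occur together.\<close>

declare One_nat_def [simp del]

section \<open>Roots, powers and a weighted convexity inequality\<close>

lemma ennreal_root_less_iff:
  assumes "0 < p" "0 < e"
  shows "ennreal_root p x < ennreal e \<longleftrightarrow> x < ennreal (e powr p)"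
proof (cases x)
  case (real y)
  have "y powr (1 / p) < e \<longleftrightarrow> y < e powr p"
  proof
    assume "y powr (1 / p) < e"
    then have "(y powr (1 / p)) powr p < e powr p"
      using assms by (intro powr_less_mono2) auto
    then show "y < e powr p" using real assms by (simp add: powr_powr)
  next
    assume "y < e powr p"
    then have "y powr (1 / p) < (e powr p) powr (1 / p)"
      using assms real by (intro powr_less_mono2) auto
    then show "y powr (1 / p) < e" using real assms by (simp add: powr_powr)
  qed
  then show ?thesis using real assms by (simp add: ennreal_root_def ennreal_less_iff)
qed (simp add: ennreal_root_def)

lemma ennreal_root_le_iff:
  assumes "0 < p" "0 \<le> e"
  shows "ennreal_root p x \<le> ennreal e \<longleftrightarrow> x \<le> ennreal (e powr p)"
proof (cases x)
  case (real y)
  have "y powr (1 / p) \<le> e \<longleftrightarrow> y \<le> e powr p"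
  proof
    assume "y powr (1 / p) \<le> e"
    then have "(y powr (1 / p)) powr p \<le> e powr p"
      using assms by (intro powr_mono2) auto
    then show "y \<le> e powr p" using real assms by (simp add: powr_powr)
  next
    assume "y \<le> e powr p"
    then have "y powr (1 / p) \<le> (e powr p) powr (1 / p)"
      using assms real by (intro powr_mono2) auto
    then show "y powr (1 / p) \<le> e" using real assms by (simp add: powr_powr)
  qed
  then show ?thesis using real assms by (simp add: ennreal_root_def)
qed (simp add: ennreal_root_def top_unique)

text \<open>Convexity of the power at the points \<open>s / l\<close> and
  \<open>t / (1 - l)\<close>, with weights \<open>l\<close> and \<open>1 - l\<close>. The weight is
  left free: if it is chosen as \<open>s / (s + t)\<close> from bounds \<open>s\<close> and
  \<open>t\<close> on the two distances, before integrating, the integrated inequality becomes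
  Minkowski's.\<close>

lemma powr_sum_le_weighted:
  fixes s t l p :: real
  assumes "p \<ge> 1" "0 \<le> s" "0 \<le> t" "0 < l" "l < 1"
  shows "(s + t) powr p \<le> l powr (1 - p) * s powr p + (1 - l) powr (1 - p) * t powr p"
proof -
  have less: "u powr p \<le> v powr (1 - p) * u powr p" if "0 \<le> u" "0 < v" "v < 1" for u v :: real
  proof -
    have "1 \<le> v powr (1 - p)"
      using that assms(1) powr_mono'[of "1 - p" 0 v] by simp
    then show ?thesis using mult_right_mono[of 1 "v powr (1 - p)" "u powr p"] by simp
  qed
  consider "s = 0" | "t = 0" | "0 < s" "0 < t" using assms by linarith
  then show ?thesis
  proof cases
    case 1 then show ?thesis using less[of t "1 - l"] assms by simp
  next
    case 2 then show ?thesis using less[of s l] assms by simp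
  next
    case 3
    have "(l *\<^sub>R (s / l) + (1 - l) *\<^sub>R (t / (1 - l))) powr p
        \<le> l * (s / l) powr p + (1 - l) * (t / (1 - l)) powr p"
      using convex_onD[OF powr_convex[OF assms(1)], of "1 - l" "s / l" "t / (1 - l)"] 3 assms
      by simp
    moreover have "l * (s / l) powr p = l powr (1 - p) * s powr p"
      using 3 assms by (simp add: powr_divide powr_diff)
    moreover have "(1 - l) * (t / (1 - l)) powr p = (1 - l) powr (1 - p) * t powr p"
      using 3 assms by (simp add: powr_divide powr_diff)
    ultimately show ?thesis using assms by simp
  qed
qed

section \<open>Shares, their costs and the couplings they induce\<close>

text \<open>The value \<open>f j x\<close> is the share of the mass at \<open>x\<close> that is sent to the \<open>j\<close>-th sample point.\<close>

definition allocs :: "'a measure \<Rightarrow> nat \<Rightarrow> (nat \<Rightarrow> 'a \<Rightarrow> real) set" where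
  "allocs Q n = {f. (\<forall>j\<in>{1..n}. f j \<in> borel_measurable Q \<and> (\<forall>x\<in>space Q. 0 \<le> f j x) \<and>
      (\<integral>\<^sup>+x. ennreal (f j x) \<partial>Q) = ennreal (1 / real n)) \<and>
      (\<forall>x\<in>space Q. (\<Sum>j\<in>{1..n}. f j x) = 1)}"

text \<open>The sample enters only through the functions \<open>c j\<close>, the costs of reaching
  its points. This lets the sample become a parameter once measurability is at stake.\<close>

definition alloc_cost ::
  "'a measure \<Rightarrow> nat \<Rightarrow> (nat \<Rightarrow> 'a \<Rightarrow> real) \<Rightarrow> (nat \<Rightarrow> 'a \<Rightarrow> real) \<Rightarrow> ennreal" where
  "alloc_cost Q n c f = (\<Sum>j\<in>{1..n}. \<integral>\<^sup>+x. ennreal (f j x * c j x) \<partial>Q)"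

lemma empirical_in_distributions:
  assumes "\<And>j. j \<in> {1..n} \<Longrightarrow> x j \<in> X" "n \<ge> 1"
  shows "empirical X n x \<in> distributions X"
proof -
  have m: "x \<in> uniform_count_measure {1..n} \<rightarrow>\<^sub>M borel_on X"
    using assms(1) by (intro measurableI) (auto simp: space_uniform_count_measure
        sets_uniform_count_measure space_restrict_space)
  have "prob_space (uniform_count_measure {1..n})"
    using assms by (intro prob_space_uniform_count_measure) auto
  then show ?thesis
    using prob_space.prob_space_distr[OF _ m] by (simp add: space_prob_algebra empirical_def)
qed

text \<open>Draw \<open>s\<close> from \<open>\<pi>\<close>, then an index \<open>j\<close> with
  probability \<open>f j (v s)\<close>, and pair \<open>u s\<close> with \<open>z j\<close>. If
  \<open>u\<close> and \<open>v\<close> are both the identity, this turns shares into a plan. If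
  they are the two projections of a plan from \<open>P\<close> to \<open>Q\<close>, it glues that
  plan to shares of \<open>Q\<close>; the kernel from the middle point to the index is
  explicit.\<close>

lemma coupling_of_alloc:
  fixes X :: "'a::topological_space set" and \<pi> :: "'s measure"
  assumes "prob_space \<pi>" and [measurable]: "u \<in> \<pi> \<rightarrow>\<^sub>M borel_on X" "v \<in> \<pi> \<rightarrow>\<^sub>M borel_on X"
    and f: "f \<in> allocs (distr \<pi> (borel_on X) v) n"
    and z: "\<And>j. j \<in> {1..n} \<Longrightarrow> z j \<in> X" and n: "n \<ge> 1"
  obtains \<kappa> where "\<kappa> \<in> couplings X (distr \<pi> (borel_on X) u) (empirical X n z)"
    "\<And>h. h \<in> borel_measurable (borel_on X \<Otimes>\<^sub>M borel_on X) \<Longrightarrow>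
      (\<integral>\<^sup>+y. h y \<partial>\<kappa>) = (\<integral>\<^sup>+s. (\<Sum>j\<in>{1..n}. ennreal (f j (v s)) * h (u s, z j)) \<partial>\<pi>)"
proof -
  interpret prob_space \<pi> by fact
  let ?S = "borel_on X" let ?C = "count_space {1..n}"
  let ?Q = "distr \<pi> ?S v"
  have fm: "\<And>j. j \<in> {1..n} \<Longrightarrow> f j \<in> borel_measurable ?S"
    and f0: "\<And>j x. j \<in> {1..n} \<Longrightarrow> x \<in> X \<Longrightarrow> 0 \<le> f j x"
    and fi: "\<And>j. j \<in> {1..n} \<Longrightarrow> (\<integral>\<^sup>+x. ennreal (f j x) \<partial>?Q) = ennreal (1 / real n)"
    and fs: "\<And>x. x \<in> X \<Longrightarrow> (\<Sum>j\<in>{1..n}. f j x) = 1"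
    using f by (auto simp: allocs_def space_restrict_space)
  have uX: "u s \<in> X" and vX: "v s \<in> X" if "s \<in> space \<pi>" for s
    using measurable_space[OF assms(2) that] measurable_space[OF assms(3) that]
    by (auto simp: space_restrict_space)
  have fm2[measurable]: "(\<lambda>w. ennreal (f (snd w) (v (fst w)))) \<in> borel_measurable (\<pi> \<Otimes>\<^sub>M ?C)"
  proof (rule measurable_compose_countable'[where I="{1..n}" and f="\<lambda>j w. ennreal (f j (v (fst w)))" and g=snd])
    show "(\<lambda>w. ennreal (f j (v (fst w)))) \<in> borel_measurable (\<pi> \<Otimes>\<^sub>M ?C)" if "j \<in> {1..n}" for j
      using fm[OF that] by measurable
  qed auto
  have zm[measurable]: "z \<in> ?C \<rightarrow>\<^sub>M ?S" using z by (auto simp: space_restrict_space)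
  have C: "sigma_finite_measure ?C" by (intro sigma_finite_measure_count_space_finite) simp
  define \<rho> where "\<rho> = density (\<pi> \<Otimes>\<^sub>M ?C) (\<lambda>w. ennreal (f (snd w) (v (fst w))))"
  define \<kappa> where "\<kappa> = distr \<rho> (?S \<Otimes>\<^sub>M ?S) (\<lambda>w. (u (fst w), z (snd w)))"
  have [measurable_cong]: "sets \<rho> = sets (\<pi> \<Otimes>\<^sub>M ?C)" by (simp add: \<rho>_def)
  have int: "(\<integral>\<^sup>+y. h y \<partial>\<kappa>) = (\<integral>\<^sup>+s. (\<Sum>j\<in>{1..n}. ennreal (f j (v s)) * h (u s, z j)) \<partial>\<pi>)"
    if [measurable]: "h \<in> borel_measurable (?S \<Otimes>\<^sub>M ?S)" for h :: "_ \<Rightarrow> ennreal"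
  proof -
    have "(\<integral>\<^sup>+y. h y \<partial>\<kappa>) = (\<integral>\<^sup>+w. ennreal (f (snd w) (v (fst w))) * h (u (fst w), z (snd w)) \<partial>(\<pi> \<Otimes>\<^sub>M ?C))"
      unfolding \<kappa>_def by (subst nn_integral_distr, measurable) (simp add: \<rho>_def nn_integral_density)
    also have "\<dots> = (\<integral>\<^sup>+s. \<integral>\<^sup>+j. ennreal (f j (v s)) * h (u s, z j) \<partial>?C \<partial>\<pi>)"
      by (subst sigma_finite_measure.nn_integral_fst[OF C, symmetric], measurable)
    finally show ?thesis by (simp add: nn_integral_count_space_finite)
  qed
  have em: "emeasure \<kappa> B = (\<integral>\<^sup>+s. (\<Sum>j\<in>{1..n}. ennreal (f j (v s)) * indicator B (u s, z j)) \<partial>\<pi>)"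
    if "B \<in> sets (?S \<Otimes>\<^sub>M ?S)" for B
    using int[of "indicator B"] that by (simp add: \<kappa>_def)
  have sets_k: "sets \<kappa> = sets (?S \<Otimes>\<^sub>M ?S)" by (simp add: \<kappa>_def)
  have fs': "(\<Sum>j\<in>{1..n}. ennreal (f j x)) = 1" if "x \<in> X" for x
    using fs[OF that] f0 that by (subst sum_ennreal) auto
  have fst_k: "distr \<kappa> ?S fst = distr \<pi> ?S u"
  proof (rule measure_eqI)
    fix B assume "B \<in> sets (distr \<kappa> ?S fst)"
    then have B[measurable]: "B \<in> sets ?S" by simp
    have sp: "fst -` B \<inter> space \<kappa> = B \<times> space ?S"
      using sets.sets_into_space[OF B] by (auto simp: sets_eq_imp_space_eq[OF sets_k] space_pair_measure)
    have "emeasure (distr \<kappa> ?S fst) B = emeasure \<kappa> (B \<times> space ?S)"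
      by (subst emeasure_distr) (auto simp: sp measurable_cong_sets[OF sets_k refl])
    also have "\<dots> = (\<integral>\<^sup>+s. (\<Sum>j\<in>{1..n}. ennreal (f j (v s)) * indicator (B \<times> space ?S) (u s, z j)) \<partial>\<pi>)"
      by (rule em) measurable
    also have "\<dots> = (\<integral>\<^sup>+s. indicator B (u s) \<partial>\<pi>)"
    proof (rule nn_integral_cong)
      fix s assume s: "s \<in> space \<pi>"
      have "(\<Sum>j\<in>{1..n}. ennreal (f j (v s)) * indicator (B \<times> space ?S) (u s, z j))
        = (\<Sum>j\<in>{1..n}. ennreal (f j (v s)) * indicator B (u s))"
        using z by (intro sum.cong) (auto simp: indicator_def space_restrict_space)
      also have "\<dots> = indicator B (u s)"
        by (simp add: sum_distrib_right[symmetric] fs'[OF vX[OF s]])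
      finally show "(\<Sum>j\<in>{1..n}. ennreal (f j (v s)) * indicator (B \<times> space ?S) (u s, z j)) = indicator B (u s)" .
    qed
    also have "\<dots> = (\<integral>\<^sup>+x. indicator B x \<partial>distr \<pi> ?S u)"
      by (rule nn_integral_distr[symmetric]) measurable
    also have "\<dots> = emeasure (distr \<pi> ?S u) B" by simp
    finally show "emeasure (distr \<kappa> ?S fst) B = emeasure (distr \<pi> ?S u) B" .
  qed simp
  \<comment> \<open>The first marginal rested on the shares summing to 1 at each point; the second
    rests on each index receiving total mass \<open>1 / n\<close>.\<close>
  have snd_k: "distr \<kappa> ?S snd = empirical X n z"
  proof (rule measure_eqI)
    show "sets (distr \<kappa> ?S snd) = sets (empirical X n z)" by (simp add: empirical_def)
    fix B assume "B \<in> sets (distr \<kappa> ?S snd)"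
    then have B[measurable]: "B \<in> sets ?S" by simp
    have sp: "snd -` B \<inter> space \<kappa> = space ?S \<times> B"
      using sets.sets_into_space[OF B] by (auto simp: sets_eq_imp_space_eq[OF sets_k] space_pair_measure)
    have "emeasure (distr \<kappa> ?S snd) B = emeasure \<kappa> (space ?S \<times> B)"
      by (subst emeasure_distr) (auto simp: sp measurable_cong_sets[OF sets_k refl])
    also have "\<dots> = (\<integral>\<^sup>+s. (\<Sum>j\<in>{1..n}. ennreal (f j (v s)) * indicator (space ?S \<times> B) (u s, z j)) \<partial>\<pi>)"
      by (rule em) measurable
    also have "\<dots> = (\<integral>\<^sup>+s. (\<Sum>j\<in>{1..n}. ennreal (f j (v s)) * indicator B (z j)) \<partial>\<pi>)"
      using uX by (intro nn_integral_cong sum.cong) (auto simp: indicator_def space_restrict_space)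
    also have "\<dots> = (\<Sum>j\<in>{1..n}. \<integral>\<^sup>+s. ennreal (f j (v s)) * indicator B (z j) \<partial>\<pi>)"
    proof (rule nn_integral_sum)
      fix j assume "j \<in> {1..n}"
      note [measurable] = fm[OF this]
      show "(\<lambda>s. ennreal (f j (v s)) * indicator B (z j)) \<in> borel_measurable \<pi>" by measurable
    qed
    also have "\<dots> = (\<Sum>j\<in>{1..n}. ennreal (1 / real n) * indicator B (z j))"
    proof (rule sum.cong[OF refl])
      fix j assume j: "j \<in> {1..n}"
      note [measurable] = fm[OF j]
      have "(\<integral>\<^sup>+s. ennreal (f j (v s)) * indicator B (z j) \<partial>\<pi>)
          = (\<integral>\<^sup>+s. ennreal (f j (v s)) \<partial>\<pi>) * indicator B (z j)"
        by (rule nn_integral_multc) measurable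
      also have "(\<integral>\<^sup>+s. ennreal (f j (v s)) \<partial>\<pi>) = ennreal (1 / real n)"
        using fi[OF j] by (subst (asm) nn_integral_distr) auto
      finally show "(\<integral>\<^sup>+s. ennreal (f j (v s)) * indicator B (z j) \<partial>\<pi>)
          = ennreal (1 / real n) * indicator B (z j)" .
    qed
    also have "\<dots> = (\<Sum>j\<in>{1..n}. ennreal (indicator B (z j) / real n))"
      by (intro sum.cong) (auto simp: indicator_def)
    also have "\<dots> = ennreal ((\<Sum>j\<in>{1..n}. indicator B (z j)) / real n)"
      by (subst sum_ennreal) (auto simp: sum_divide_distrib)
    finally show "emeasure (distr \<kappa> ?S snd) B = emeasure (empirical X n z) B"
      using emeasure_empirical[OF z B] by simp
  qed
  have "prob_space \<kappa>"
  proof (rule prob_spaceI)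
    interpret D: prob_space "distr \<pi> ?S u" by (rule prob_space_distr) measurable
    have "emeasure (distr \<kappa> ?S fst) (space ?S) = 1"
      using D.emeasure_space_1 by (simp add: fst_k)
    moreover have "emeasure (distr \<kappa> ?S fst) (space ?S) = emeasure \<kappa> (space \<kappa>)"
      by (subst emeasure_distr)
        (auto simp: measurable_cong_sets[OF sets_k refl] sets_eq_imp_space_eq[OF sets_k]
          space_pair_measure intro!: arg_cong[of _ _ "emeasure \<kappa>"])
    ultimately show "emeasure \<kappa> (space \<kappa>) = 1" by simp
  qed
  then have "\<kappa> \<in> couplings X (distr \<pi> ?S u) (empirical X n z)"
    by (simp add: couplings_def space_prob_algebra sets_k fst_k snd_k)
  from that[OF this int] show ?thesis .
qed


text \<open>Infima over plans need not be attained. A strict bound on each infimum yields a plan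
  whose cost is below that bound, and the positivity of \<open>s\<close> and \<open>t\<close> makes
  \<open>s / (s + t)\<close> an admissible weight in \<open>powr_sum_le_weighted\<close>.\<close>

lemma le_add_of_less:
  fixes x u v :: ennreal
  assumes "\<And>s t :: real. 0 < s \<Longrightarrow> 0 < t \<Longrightarrow> u < ennreal s \<Longrightarrow> v < ennreal t \<Longrightarrow> x \<le> ennreal (s + t)"
  shows "x \<le> u + v"
proof (cases u; cases v)
  fix a b :: real assume ab: "u = ennreal a" "v = ennreal b" "0 \<le> a" "0 \<le> b"
  show ?thesis
  proof (rule ennreal_le_epsilon)
    fix e :: real assume e: "0 < e"
    have "x \<le> ennreal ((a + e / 2) + (b + e / 2))"
      using ab e by (intro assms) (auto simp: ennreal_less_iff)
    also have "(a + e / 2) + (b + e / 2) = a + b + e" by simp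
    also have "ennreal (a + b + e) = u + v + ennreal e"
      using ab e by (simp only: ennreal_plus add_nonneg_nonneg less_imp_le)
    finally show "x \<le> u + v + ennreal e" .
  qed
qed auto

section \<open>Transport to an empirical distribution and the triangle inequality\<close>

definition semidiscrete_cost ::
  "'a measure \<Rightarrow> nat \<Rightarrow> (nat \<Rightarrow> 'a \<Rightarrow> real) \<Rightarrow> ennreal" where
  "semidiscrete_cost Q n c = (INF f\<in>allocs Q n. alloc_cost Q n c f)"

lemma space_of_distributions:
  assumes "Q \<in> distributions X"
  shows "space Q = X" "sets Q = sets (borel_on X)" "prob_space Q"
  using assms sets_eq_imp_space_eq[of Q "borel_on X"]
  by (auto simp: space_prob_algebra space_restrict_space)

text \<open>This is \<open>coupling_of_alloc\<close> with \<open>u\<close> and \<open>v\<close> the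
  identity on \<open>Q\<close>: shares are a special way of writing a plan.\<close>

lemma transport_le_alloc_cost:
  assumes Q: "Q \<in> distributions X" and f: "f \<in> allocs Q n" and n: "n \<ge> 1"
    and z: "\<And>j. j \<in> {1..n} \<Longrightarrow> z j \<in> X"
    and c[measurable]: "(\<lambda>w. c (fst w) (snd w)) \<in> borel_measurable (borel_on X \<Otimes>\<^sub>M borel_on X)"
  shows "(INF \<pi>\<in>couplings X Q (empirical X n z). \<integral>\<^sup>+w. ennreal (c (fst w) (snd w)) \<partial>\<pi>)
    \<le> alloc_cost Q n (\<lambda>j x. c x (z j)) f"
proof -
  note QX = space_of_distributions[OF Q]
  note [measurable_cong] = QX(2)
  have id: "(\<lambda>x. x) \<in> Q \<rightarrow>\<^sub>M borel_on X" by measurable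
  have d: "distr Q (borel_on X) (\<lambda>x. x) = Q" by (rule distr_id2) (simp add: QX)
  obtain \<kappa> where k: "\<kappa> \<in> couplings X Q (empirical X n z)"
    and ki: "\<And>h. h \<in> borel_measurable (borel_on X \<Otimes>\<^sub>M borel_on X) \<Longrightarrow>
      (\<integral>\<^sup>+y. h y \<partial>\<kappa>) = (\<integral>\<^sup>+s. (\<Sum>j\<in>{1..n}. ennreal (f j s) * h (s, z j)) \<partial>Q)"
    using coupling_of_alloc[OF QX(3) id id, of f n z] f z n unfolding d by blast
  have "(\<integral>\<^sup>+w. ennreal (c (fst w) (snd w)) \<partial>\<kappa>)
    = (\<integral>\<^sup>+s. (\<Sum>j\<in>{1..n}. ennreal (f j s) * ennreal (c s (z j))) \<partial>Q)"
    by (subst ki) auto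
  also have "\<dots> = (\<integral>\<^sup>+s. (\<Sum>j\<in>{1..n}. ennreal (f j s * c s (z j))) \<partial>Q)"
    using f by (intro nn_integral_cong sum.cong) (auto simp: allocs_def ennreal_mult')
  also have "\<dots> = alloc_cost Q n (\<lambda>j x. c x (z j)) f"
    unfolding alloc_cost_def
  proof (rule nn_integral_sum)
    fix j assume j: "j \<in> {1..n}"
    then have [measurable]: "f j \<in> borel_measurable Q" using f by (auto simp: allocs_def)
    have "(\<lambda>s. (s, z j)) \<in> Q \<rightarrow>\<^sub>M borel_on X \<Otimes>\<^sub>M borel_on X"
      using z[OF j] by (auto simp: space_restrict_space)
    from measurable_compose[OF this c] have [measurable]: "(\<lambda>s. c s (z j)) \<in> borel_measurable Q"
      by simp
    show "(\<lambda>s. ennreal (f j s * c s (z j))) \<in> borel_measurable Q" by measurable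
  qed
  finally show ?thesis using INF_lower[OF k, of "\<lambda>\<pi>. \<integral>\<^sup>+w. ennreal (c (fst w) (snd w)) \<partial>\<pi>"] by simp
qed

text \<open>Move \<open>x\<close> to \<open>y\<close> by a plan close to optimal for
  \<open>P\<close> and \<open>Q\<close>, then split the mass at \<open>y\<close> according to shares
  of \<open>Q\<close>. The pointwise triangle inequality is applied separately to each share. Since
  the shares at \<open>y\<close> sum to 1, the cost of the first move is counted once.\<close>

lemma wasserstein_triangle_alloc:
  fixes X :: "'a::topological_space set"
  assumes p: "p \<ge> 1" and dst: "Metric_space X dst"
    and m[measurable]: "(\<lambda>w. dst (fst w) (snd w)) \<in> borel_measurable (borel_on X \<Otimes>\<^sub>M borel_on X)"
    and n: "n \<ge> 1" and z: "\<And>j. j \<in> {1..n} \<Longrightarrow> z j \<in> X"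
  shows "wasserstein X dst p P (empirical X n z)
    \<le> wasserstein X dst p P Q + ennreal_root p (semidiscrete_cost Q n (\<lambda>j x. dst x (z j) powr p))"
proof (rule le_add_of_less)
  interpret Metric_space X dst by fact
  let ?S = "borel_on X" let ?SS = "?S \<Otimes>\<^sub>M ?S"
  fix s t :: real assume s: "0 < s" and t: "0 < t"
  assume "wasserstein X dst p P Q < ennreal s"
  then obtain \<pi> where pi: "\<pi> \<in> couplings X P Q"
    and pc: "(\<integral>\<^sup>+w. ennreal (dst (fst w) (snd w) powr p) \<partial>\<pi>) < ennreal (s powr p)"
    using p s by (auto simp: wasserstein_def ennreal_root_less_iff INF_less_iff)
  assume "ennreal_root p (semidiscrete_cost Q n (\<lambda>j x. dst x (z j) powr p)) < ennreal t"
  then obtain f where f: "f \<in> allocs Q n"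
    and fc: "alloc_cost Q n (\<lambda>j x. dst x (z j) powr p) f < ennreal (t powr p)"
    using p t by (auto simp: semidiscrete_cost_def ennreal_root_less_iff INF_less_iff)
  have ps: "prob_space \<pi>" and sets_pi: "sets \<pi> = sets ?SS"
    and P: "P = distr \<pi> ?S fst" and Q: "Q = distr \<pi> ?S snd"
    using pi by (auto simp: couplings_def space_prob_algebra)
  note [measurable_cong] = sets_pi
  have X2: "fst w \<in> X" "snd w \<in> X" if "w \<in> space \<pi>" for w
    using that by (auto simp: sets_eq_imp_space_eq[OF sets_pi] space_pair_measure space_restrict_space)
  have fm: "\<And>j. j \<in> {1..n} \<Longrightarrow> f j \<in> borel_measurable ?S"
    and f0: "\<And>j x. j \<in> {1..n} \<Longrightarrow> x \<in> X \<Longrightarrow> 0 \<le> f j x"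
    and fs: "\<And>x. x \<in> X \<Longrightarrow> (\<Sum>j\<in>{1..n}. f j x) = 1"
    using f by (auto simp: allocs_def space_restrict_space Q)
  have zm: "(\<lambda>x. dst x (z j)) \<in> borel_measurable ?S" if "j \<in> {1..n}" for j
  proof -
    have "(\<lambda>s. (s, z j)) \<in> ?S \<rightarrow>\<^sub>M ?SS" using z[OF that] by (auto simp: space_restrict_space)
    from measurable_compose[OF this m] show ?thesis by simp
  qed
  obtain \<kappa> where k: "\<kappa> \<in> couplings X P (empirical X n z)"
    and ki: "\<And>h. h \<in> borel_measurable ?SS \<Longrightarrow>
      (\<integral>\<^sup>+y. h y \<partial>\<kappa>) = (\<integral>\<^sup>+w. (\<Sum>j\<in>{1..n}. ennreal (f j (snd w)) * h (fst w, z j)) \<partial>\<pi>)"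
    using coupling_of_alloc[OF ps, of fst X snd f n z] f z n unfolding P Q by auto
  \<comment> \<open>Minkowski's inequality, from the convexity of the power with weights \<open>s\<close> and \<open>t\<close>\<close>
  define l where "l = s / (s + t)"
  have l: "0 < l" "l < 1" and l1: "1 - l = t / (s + t)" using s t by (auto simp: l_def field_simps)
  define A where "A = l powr (1 - p)"
  define B where "B = (1 - l) powr (1 - p)"
  have AB: "0 \<le> A" "0 \<le> B" by (auto simp: A_def B_def)
  have "(\<integral>\<^sup>+w. ennreal (dst (fst w) (snd w) powr p) \<partial>\<kappa>)
     = (\<integral>\<^sup>+w. (\<Sum>j\<in>{1..n}. ennreal (f j (snd w)) * ennreal (dst (fst w) (z j) powr p)) \<partial>\<pi>)"
    by (subst ki) auto
  also have "\<dots> \<le> (\<integral>\<^sup>+w. ennreal A * ennreal (dst (fst w) (snd w) powr p)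
      + (\<Sum>j\<in>{1..n}. ennreal B * ennreal (f j (snd w) * dst (snd w) (z j) powr p)) \<partial>\<pi>)"
  proof (rule nn_integral_mono)
    fix w assume w: "w \<in> space \<pi>"
    let ?x = "fst w" and ?y = "snd w"
    note xy = X2[OF w]
    have le: "dst ?x (z j) powr p \<le> A * dst ?x ?y powr p + B * dst ?y (z j) powr p"
      if "j \<in> {1..n}" for j
    proof -
      have "dst ?x (z j) powr p \<le> (dst ?x ?y + dst ?y (z j)) powr p"
        using triangle[OF xy z[OF that]] p by (intro powr_mono2) auto
      also have "\<dots> \<le> A * dst ?x ?y powr p + B * dst ?y (z j) powr p"
        unfolding A_def B_def using p l by (intro powr_sum_le_weighted) auto
      finally show ?thesis .
    qed
    have "(\<Sum>j\<in>{1..n}. ennreal (f j ?y) * ennreal (dst ?x (z j) powr p))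
      = ennreal (\<Sum>j\<in>{1..n}. f j ?y * dst ?x (z j) powr p)"
      using f0 xy by (subst sum_ennreal[symmetric]) (auto simp: ennreal_mult)
    also have "\<dots> \<le> ennreal (\<Sum>j\<in>{1..n}. f j ?y * (A * dst ?x ?y powr p + B * dst ?y (z j) powr p))"
      using f0 xy le by (intro ennreal_leI sum_mono mult_left_mono) auto
    also have "(\<Sum>j\<in>{1..n}. f j ?y * (A * dst ?x ?y powr p + B * dst ?y (z j) powr p))
      = A * dst ?x ?y powr p + (\<Sum>j\<in>{1..n}. B * (f j ?y * dst ?y (z j) powr p))"
    proof -
      have "(\<Sum>j\<in>{1..n}. f j ?y * (A * dst ?x ?y powr p)) = A * dst ?x ?y powr p"
        using fs[OF xy(2)] by (simp add: sum_distrib_right[symmetric])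
      then show ?thesis by (simp add: distrib_left sum.distrib mult.left_commute)
    qed
    also have "ennreal \<dots> = ennreal A * ennreal (dst ?x ?y powr p)
      + (\<Sum>j\<in>{1..n}. ennreal B * ennreal (f j ?y * dst ?y (z j) powr p))"
    proof -
      have "ennreal (\<Sum>j\<in>{1..n}. B * (f j ?y * dst ?y (z j) powr p))
        = (\<Sum>j\<in>{1..n}. ennreal B * ennreal (f j ?y * dst ?y (z j) powr p))"
        using AB f0 xy by (subst sum_ennreal[symmetric]) (auto intro!: sum.cong ennreal_mult)
      moreover have "0 \<le> (\<Sum>j\<in>{1..n}. B * (f j ?y * dst ?y (z j) powr p))"
        using AB f0 xy by (intro sum_nonneg mult_nonneg_nonneg) auto
      ultimately show ?thesis using AB by (simp only: ennreal_plus ennreal_mult mult_nonneg_nonneg powr_ge_zero)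
    qed
    finally show "(\<Sum>j\<in>{1..n}. ennreal (f j ?y) * ennreal (dst ?x (z j) powr p)) \<le> \<dots>" .
  qed
  also have "\<dots> = ennreal A * (\<integral>\<^sup>+w. ennreal (dst (fst w) (snd w) powr p) \<partial>\<pi>)
      + (\<Sum>j\<in>{1..n}. ennreal B * (\<integral>\<^sup>+w. ennreal (f j (snd w) * dst (snd w) (z j) powr p) \<partial>\<pi>))"
  proof -
    have mj[measurable]: "(\<lambda>w. ennreal (f j (snd w) * dst (snd w) (z j) powr p)) \<in> borel_measurable \<pi>"
      if "j \<in> {1..n}" for j
      using measurable_compose[OF _ fm[OF that], of snd \<pi>] measurable_compose[OF _ zm[OF that], of snd \<pi>]
      by measurable
    have "(\<integral>\<^sup>+w. (\<Sum>j\<in>{1..n}. ennreal B * ennreal (f j (snd w) * dst (snd w) (z j) powr p)) \<partial>\<pi>)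
      = (\<Sum>j\<in>{1..n}. ennreal B * (\<integral>\<^sup>+w. ennreal (f j (snd w) * dst (snd w) (z j) powr p) \<partial>\<pi>))"
      using mj by (subst nn_integral_sum) (auto intro!: sum.cong nn_integral_cmult)
    moreover have "(\<integral>\<^sup>+w. ennreal A * ennreal (dst (fst w) (snd w) powr p) \<partial>\<pi>)
      = ennreal A * (\<integral>\<^sup>+w. ennreal (dst (fst w) (snd w) powr p) \<partial>\<pi>)"
      by (intro nn_integral_cmult) measurable
    ultimately show ?thesis
      using mj by (subst nn_integral_add) (auto intro!: borel_measurable_sum)
  qed
  also have "(\<Sum>j\<in>{1..n}. ennreal B * (\<integral>\<^sup>+w. ennreal (f j (snd w) * dst (snd w) (z j) powr p) \<partial>\<pi>))
      = ennreal B * alloc_cost Q n (\<lambda>j x. dst x (z j) powr p) f"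
    unfolding alloc_cost_def sum_distrib_left
  proof (rule sum.cong[OF refl])
    fix j assume j: "j \<in> {1..n}"
    note [measurable] = fm[OF j] zm[OF j]
    show "ennreal B * (\<integral>\<^sup>+w. ennreal (f j (snd w) * dst (snd w) (z j) powr p) \<partial>\<pi>)
      = ennreal B * (\<integral>\<^sup>+x. ennreal (f j x * dst x (z j) powr p) \<partial>Q)"
      unfolding Q by (subst nn_integral_distr) auto
  qed
  also have "ennreal A * (\<integral>\<^sup>+w. ennreal (dst (fst w) (snd w) powr p) \<partial>\<pi>)
      + ennreal B * alloc_cost Q n (\<lambda>j x. dst x (z j) powr p) f
      \<le> ennreal A * ennreal (s powr p) + ennreal B * ennreal (t powr p)"
    using pc fc by (intro add_mono mult_left_mono) auto
  also have "\<dots> = ennreal (A * s powr p + B * t powr p)"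
    using AB by (simp only: ennreal_plus ennreal_mult mult_nonneg_nonneg powr_ge_zero)
  also have "A * s powr p + B * t powr p = (s + t) powr p"
  proof -
    have "A * s powr p = l * (s + t) powr p"
      using s t by (simp add: A_def l_def powr_divide powr_diff)
    moreover have "B * t powr p = (1 - l) * (s + t) powr p"
      unfolding B_def l1 using s t by (simp add: powr_divide powr_diff)
    ultimately show ?thesis by (simp add: algebra_simps)
  qed
  finally have "(\<integral>\<^sup>+w. ennreal (dst (fst w) (snd w) powr p) \<partial>\<kappa>) \<le> ennreal ((s + t) powr p)" .
  then have "(INF \<pi>\<in>couplings X P (empirical X n z). \<integral>\<^sup>+w. ennreal (dst (fst w) (snd w) powr p) \<partial>\<pi>)
      \<le> ennreal ((s + t) powr p)"
    using k by (rule INF_lower2[rotated])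
  then show "wasserstein X dst p P (empirical X n z) \<le> ennreal (s + t)"
    unfolding wasserstein_def using p s t by (subst ennreal_root_le_iff) auto
qed

text \<open>The converse direction: cut the plan according to the sample point at which it ends. The
  starting points of each piece have a law dominated by \<open>Q\<close>, and its Radon-Nikodym
  density is the share of that sample point. Cutting requires singletons to be measurable, which the
  T1 property provides.\<close>

lemma semidiscrete_cost_le_coupling:
  fixes X :: "'a::t1_space set"
  assumes pi: "\<pi> \<in> couplings X Q (empirical X n z)" and n: "n \<ge> 1"
    and z: "\<And>j. j \<in> {1..n} \<Longrightarrow> z j \<in> X"
    and c0: "\<And>x y. 0 \<le> c x y"
    and c[measurable]: "(\<lambda>w. c (fst w) (snd w)) \<in> borel_measurable (borel_on X \<Otimes>\<^sub>M borel_on X)"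
  shows "semidiscrete_cost Q n (\<lambda>j x. c x (z j)) \<le> (\<integral>\<^sup>+w. ennreal (c (fst w) (snd w)) \<partial>\<pi>)"
proof -
  let ?S = "borel_on X" let ?SS = "?S \<Otimes>\<^sub>M ?S" let ?E = "empirical X n z"
  have ps: "prob_space \<pi>" and sets_pi: "sets \<pi> = sets ?SS"
    and Q: "distr \<pi> ?S fst = Q" and E: "distr \<pi> ?S snd = ?E"
    using pi by (auto simp: couplings_def space_prob_algebra)
  note [measurable_cong] = sets_pi
  interpret prob_space \<pi> by fact
  interpret Q: prob_space Q unfolding Q[symmetric] by (rule prob_space_distr) measurable
  have sQ[measurable_cong]: "sets Q = sets ?S" and spQ: "space Q = X"
    by (simp_all add: Q[symmetric] space_restrict_space)
  have X2: "fst w \<in> X" "snd w \<in> X" if "w \<in> space \<pi>" for w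
    using that by (auto simp: sets_eq_imp_space_eq[OF sets_pi] space_pair_measure space_restrict_space)
  have sing: "{z j} \<in> sets ?S" if "j \<in> {1..n}" for j
    using z[OF that] by (auto simp: sets_restrict_space image_iff intro!: bexI[of _ "{z j}"])
  \<comment> \<open>A point that occurs \<open>m j\<close> times in the sample divides its mass equally among these indices.\<close>
  define m where "m j = card {i \<in> {1..n}. z i = z j}" for j
  have m0: "0 < m j" if "j \<in> {1..n}" for j
    using that by (auto simp: m_def card_gt_0_iff)
  define h where "h j y = indicator {z j} y * ennreal (1 / real (m j))" for j y
  have hm[measurable]: "h j \<in> borel_measurable ?S" if "j \<in> {1..n}" for j
    unfolding h_def[abs_def] using sing[OF that] by measurable
  have hm2[measurable]: "(\<lambda>w. h j (snd w)) \<in> borel_measurable \<pi>" if "j \<in> {1..n}" for j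
    using measurable_compose[OF _ hm[OF that], of snd \<pi>] by measurable
  have hE: "(\<integral>\<^sup>+w. h j (snd w) \<partial>\<pi>) = ennreal (1 / real n)" if j: "j \<in> {1..n}" for j
  proof -
    have "(\<integral>\<^sup>+w. h j (snd w) \<partial>\<pi>) = (\<integral>\<^sup>+y. h j y \<partial>?E)"
      unfolding E[symmetric] using hm[OF j] by (subst nn_integral_distr) auto
    also have "\<dots> = emeasure ?E {z j} * ennreal (1 / real (m j))"
      unfolding h_def using sing[OF j]
      by (subst nn_integral_multc) (auto simp: empirical_def)
    also have "emeasure ?E {z j} = ennreal (real (m j) / real n)"
    proof -
      have "(\<Sum>i\<in>{1..n}. indicator {z j} (z i)) = real (m j)"
        by (simp add: m_def indicator_def sum.If_cases Int_def)
      then show ?thesis using emeasure_empirical[OF z sing[OF j], of n id] by simp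
    qed
    also have "\<dots> * ennreal (1 / real (m j)) = ennreal (1 / real n)"
      using m0[OF j] by (simp add: ennreal_mult[symmetric])
    finally show ?thesis .
  qed
  have h1: "(\<Sum>j\<in>{1..n}. h j y) = 1" if y: "y \<in> z ` {1..n}" for y
  proof -
    obtain i where i: "i \<in> {1..n}" "y = z i" using y by blast
    have "(\<Sum>j\<in>{1..n}. h j y) = (\<Sum>j\<in>{1..n}. if z j = z i then ennreal (1 / real (m i)) else 0)"
      using i by (intro sum.cong) (auto simp: h_def m_def)
    also have "\<dots> = (\<Sum>j\<in>{j \<in> {1..n}. z j = z i}. ennreal (1 / real (m i)))"
      by (intro sum.mono_neutral_cong_right) auto
    also have "\<dots> = of_nat (m i) * ennreal (1 / real (m i))"
      by (simp add: m_def)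
    also have "\<dots> = ennreal (real (m i) * (1 / real (m i)))"
      by (simp only: ennreal_of_nat_eq_real_of_nat ennreal_mult of_nat_0_le_iff divide_nonneg_nonneg zero_le_one)
    finally show ?thesis using m0[OF i(1)] by simp
  qed
  have "z ` {1..n} \<in> sets ?S"
  proof -
    have "(\<Union>j\<in>{1..n}. {z j}) \<in> sets ?S" using sing by (intro sets.finite_UN) auto
    also have "(\<Union>j\<in>{1..n}. {z j}) = z ` {1..n}" by blast
    finally show ?thesis .
  qed
  then have N: "X - z ` {1..n} \<in> sets ?S"
    using sets.compl_sets[of "z ` {1..n}" ?S] by (simp add: space_restrict_space)
  \<comment> \<open>The second marginal charges only the sample points, so the weights
    \<open>h j\<close> sum to 1 at almost every end point.\<close>
  have "emeasure ?E (X - z ` {1..n}) = 0"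
    using z N by (subst emeasure_empirical) (auto simp: indicator_def)
  then have "AE y in ?E. y \<notin> X - z ` {1..n}"
    using N by (intro AE_not_in) (auto simp: null_sets_def empirical_def)
  then have "AE w in \<pi>. snd w \<notin> X - z ` {1..n}"
    unfolding E[symmetric] by (rule AE_distrD[rotated]) measurable
  then have AEh: "AE w in \<pi>. (\<Sum>j\<in>{1..n}. h j (snd w)) = 1"
    using X2 h1 by (auto elim!: eventually_mono)
  define \<nu> where "\<nu> j = distr (density \<pi> (\<lambda>w. h j (snd w))) ?S fst" for j
  have nn: "(\<integral>\<^sup>+x. g x \<partial>\<nu> j) = (\<integral>\<^sup>+w. h j (snd w) * g (fst w) \<partial>\<pi>)"
    if [measurable]: "g \<in> borel_measurable ?S" and j: "j \<in> {1..n}" for g j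
    unfolding \<nu>_def using hm2[OF j]
    by (subst nn_integral_distr, measurable) (subst nn_integral_density, auto)
  have em: "emeasure (\<nu> j) B = (\<integral>\<^sup>+w. h j (snd w) * indicator B (fst w) \<partial>\<pi>)"
    if "B \<in> sets ?S" "j \<in> {1..n}" for B j
    using nn[of "indicator B" j] that by (simp add: \<nu>_def)
  have emQ: "emeasure Q B = (\<integral>\<^sup>+w. indicator B (fst w) \<partial>\<pi>)" if [measurable]: "B \<in> sets ?S" for B
  proof -
    have "emeasure Q B = (\<integral>\<^sup>+x. indicator B x \<partial>Q)" by (subst nn_integral_indicator) auto
    also have "\<dots> = (\<integral>\<^sup>+w. indicator B (fst w) \<partial>\<pi>)"
      unfolding Q[symmetric] by (rule nn_integral_distr) measurable
    finally show ?thesis .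
  qed
  have ac: "absolutely_continuous Q (\<nu> j)" if j: "j \<in> {1..n}" for j
    unfolding absolutely_continuous_def
  proof
    fix B assume "B \<in> null_sets Q"
    then have B[measurable]: "B \<in> sets ?S" and B0: "emeasure Q B = 0" by (auto simp: sQ)
    have "AE w in \<pi>. indicator B (fst w) = (0::ennreal)"
      using B0 unfolding emQ[OF B] by (subst (asm) nn_integral_0_iff_AE) auto
    then have "emeasure (\<nu> j) B = (\<integral>\<^sup>+w. 0 \<partial>\<pi>)"
      unfolding em[OF B j] by (intro nn_integral_cong_AE) (auto elim!: eventually_mono)
    then show "B \<in> null_sets (\<nu> j)" by (auto simp: \<nu>_def)
  qed
  have "\<exists>g\<in>borel_measurable Q. density Q g = \<nu> j" if "j \<in> {1..n}" for j
    by (rule Q.Radon_Nikodym[OF ac[OF that]]) (simp add: \<nu>_def sQ)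
  then obtain g where gm': "\<And>j. j \<in> {1..n} \<Longrightarrow> g j \<in> borel_measurable Q"
    and gd: "\<And>j. j \<in> {1..n} \<Longrightarrow> density Q (g j) = \<nu> j"
    by metis
  have gm[measurable]: "g j \<in> borel_measurable ?S" if "j \<in> {1..n}" for j
    using gm'[OF that] by (simp add: measurable_cong_sets[OF sQ refl])
  have gsm[measurable]: "(\<lambda>x. \<Sum>j\<in>{1..n}. g j x) \<in> borel_measurable ?S"
    using gm by (intro borel_measurable_sum) auto
  have gi: "(\<integral>\<^sup>+x. g j x * k x \<partial>Q) = (\<integral>\<^sup>+w. h j (snd w) * k (fst w) \<partial>\<pi>)"
    if [measurable]: "k \<in> borel_measurable ?S" and j: "j \<in> {1..n}" for j k
    using nn[OF that] gm'[OF j] gd[OF j, symmetric] by (simp add: nn_integral_density)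
  \<comment> \<open>The pieces \<open>\<nu> j\<close> add up to the first marginal \<open>Q\<close>,
    so uniqueness of densities makes their densities sum to 1 almost everywhere.\<close>
  have "density Q (\<lambda>x. \<Sum>j\<in>{1..n}. g j x) = density Q (\<lambda>_. 1)"
  proof (rule measure_eqI)
    fix B assume "B \<in> sets (density Q (\<lambda>x. \<Sum>j\<in>{1..n}. g j x))"
    then have [measurable]: "B \<in> sets ?S" by (simp add: sQ)
    have "emeasure (density Q (\<lambda>x. \<Sum>j\<in>{1..n}. g j x)) B
      = (\<integral>\<^sup>+x. (\<Sum>j\<in>{1..n}. g j x * indicator B x) \<partial>Q)"
      by (subst emeasure_density) (auto simp: sum_distrib_right)
    also have "\<dots> = (\<Sum>j\<in>{1..n}. \<integral>\<^sup>+x. g j x * indicator B x \<partial>Q)"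
      using gm' by (intro nn_integral_sum borel_measurable_times) measurable
    also have "\<dots> = (\<Sum>j\<in>{1..n}. \<integral>\<^sup>+w. h j (snd w) * indicator B (fst w) \<partial>\<pi>)"
      by (intro sum.cong refl gi) measurable
    also have "\<dots> = (\<integral>\<^sup>+w. (\<Sum>j\<in>{1..n}. h j (snd w) * indicator B (fst w)) \<partial>\<pi>)"
      using hm2 by (intro nn_integral_sum[symmetric] borel_measurable_times) measurable
    also have "\<dots> = (\<integral>\<^sup>+w. indicator B (fst w) \<partial>\<pi>)"
      using AEh by (intro nn_integral_cong_AE) (auto elim!: eventually_mono simp: sum_distrib_right[symmetric])
    also have "\<dots> = emeasure (density Q (\<lambda>_. 1)) B" by (simp add: emQ density_1)
    finally show "emeasure (density Q (\<lambda>x. \<Sum>j\<in>{1..n}. g j x)) B = emeasure (density Q (\<lambda>_. 1)) B" .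
  qed simp
  then have AEg: "AE x in Q. (\<Sum>j\<in>{1..n}. g j x) = 1"
    by (intro Q.density_unique) (auto simp: measurable_cong_sets[OF sQ refl])
  \<comment> \<open>The exceptional null set, where the densities do not sum to 1, is overwritten.\<close>
  define f where "f j x = (if (\<Sum>i\<in>{1..n}. g i x) = 1 then enn2real (g j x) else 1 / real n)" for j x
  have fg: "ennreal (f j x) = g j x" if "(\<Sum>i\<in>{1..n}. g i x) = 1" "j \<in> {1..n}" for j x
  proof -
    have "g j x \<le> (\<Sum>i\<in>{1..n}. g i x)" using that(2) by (intro member_le_sum) auto
    then show ?thesis using that(1) by (simp add: f_def) (metis ennreal_enn2real ennreal_one_less_top le_less_trans)
  qed
  have fm: "f j \<in> borel_measurable ?S" if j: "j \<in> {1..n}" for j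
    unfolding f_def[abs_def] using gm[OF j] by measurable
  have cost: "(\<integral>\<^sup>+x. ennreal (f j x) * k x \<partial>Q) = (\<integral>\<^sup>+w. h j (snd w) * k (fst w) \<partial>\<pi>)"
    if k: "k \<in> borel_measurable ?S" and j: "j \<in> {1..n}" for j k
  proof -
    have "(\<integral>\<^sup>+x. ennreal (f j x) * k x \<partial>Q) = (\<integral>\<^sup>+x. g j x * k x \<partial>Q)"
      using AEg by (intro nn_integral_cong_AE) (auto elim!: eventually_mono simp: fg[OF _ j])
    then show ?thesis using gi[OF that] by simp
  qed
  have fpos: "0 \<le> f j x" for j x by (simp add: f_def)
  have fa: "f \<in> allocs Q n"
    unfolding allocs_def
  proof (intro CollectI conjI ballI)
    fix j assume j: "j \<in> {1..n}"
    show "f j \<in> borel_measurable Q" using fm[OF j] by (simp add: measurable_cong_sets[OF sQ refl])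
    show "0 \<le> f j x" for x by (rule fpos)
    show "(\<integral>\<^sup>+x. ennreal (f j x) \<partial>Q) = ennreal (1 / real n)"
      using cost[of "\<lambda>_. 1" j] hE[OF j] j by simp
  next
    fix x
    show "(\<Sum>j\<in>{1..n}. f j x) = 1"
    proof (cases "(\<Sum>i\<in>{1..n}. g i x) = 1")
      case True
      have "ennreal (\<Sum>j\<in>{1..n}. f j x) = (\<Sum>j\<in>{1..n}. g j x)"
      proof -
        have "ennreal (\<Sum>j\<in>{1..n}. f j x) = (\<Sum>j\<in>{1..n}. ennreal (f j x))"
          using fpos by (rule sum_ennreal[symmetric])
        also have "\<dots> = (\<Sum>j\<in>{1..n}. g j x)" using fg[OF True] by (rule sum.cong[OF refl])
        finally show ?thesis .
      qed
      then show ?thesis using True by (simp only: ennreal_eq_1)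
    next
      case False
      then show ?thesis using n by (simp add: f_def)
    qed
  qed
  have zm[measurable]: "(\<lambda>x. c x (z j)) \<in> borel_measurable ?S" if "j \<in> {1..n}" for j
  proof -
    have "(\<lambda>s. (s, z j)) \<in> ?S \<rightarrow>\<^sub>M ?SS" using z[OF that] by (auto simp: space_restrict_space)
    from measurable_compose[OF this c] show ?thesis by simp
  qed
  have "alloc_cost Q n (\<lambda>j x. c x (z j)) f = (\<Sum>j\<in>{1..n}. \<integral>\<^sup>+x. ennreal (f j x) * ennreal (c x (z j)) \<partial>Q)"
    unfolding alloc_cost_def using c0 by (simp add: ennreal_mult'')
  also have "\<dots> = (\<Sum>j\<in>{1..n}. \<integral>\<^sup>+w. h j (snd w) * ennreal (c (fst w) (z j)) \<partial>\<pi>)"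
    using zm by (intro sum.cong refl cost) measurable
  \<comment> \<open>The weight \<open>h j (snd w)\<close> vanishes unless
    \<open>snd w = z j\<close>.\<close>
  also have "\<dots> = (\<Sum>j\<in>{1..n}. \<integral>\<^sup>+w. h j (snd w) * ennreal (c (fst w) (snd w)) \<partial>\<pi>)"
    by (intro sum.cong nn_integral_cong refl) (simp add: h_def indicator_def)
  also have "\<dots> = (\<integral>\<^sup>+w. (\<Sum>j\<in>{1..n}. h j (snd w) * ennreal (c (fst w) (snd w))) \<partial>\<pi>)"
    using hm2 by (intro nn_integral_sum[symmetric] borel_measurable_times) measurable
  also have "\<dots> = (\<integral>\<^sup>+w. ennreal (c (fst w) (snd w)) \<partial>\<pi>)"
    using AEh by (intro nn_integral_cong_AE) (auto elim!: eventually_mono simp: sum_distrib_right[symmetric])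
  finally show ?thesis using fa unfolding semidiscrete_cost_def by (intro INF_lower2[OF fa]) simp
qed

text \<open>The gain is that an infimum over measures on the product becomes an infimum over
  functions on \<open>X\<close>, which can be thinned out to a countable one.\<close>

lemma wasserstein_empirical:
  fixes X :: "'a::t1_space set"
  assumes Q: "Q \<in> distributions X" and n: "n \<ge> 1"
    and z: "\<And>j. j \<in> {1..n} \<Longrightarrow> z j \<in> X"
    and m[measurable]: "(\<lambda>w. dst (fst w) (snd w)) \<in> borel_measurable (borel_on X \<Otimes>\<^sub>M borel_on X)"
  shows "wasserstein X dst p Q (empirical X n z)
    = ennreal_root p (semidiscrete_cost Q n (\<lambda>j x. dst x (z j) powr p))"
proof -
  have m2: "(\<lambda>w. dst (fst w) (snd w) powr p) \<in> borel_measurable (borel_on X \<Otimes>\<^sub>M borel_on X)"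
    by measurable
  have "(INF \<pi>\<in>couplings X Q (empirical X n z). \<integral>\<^sup>+w. ennreal (dst (fst w) (snd w) powr p) \<partial>\<pi>)
      = semidiscrete_cost Q n (\<lambda>j x. dst x (z j) powr p)"
  proof (rule antisym)
    show "(INF \<pi>\<in>couplings X Q (empirical X n z). \<integral>\<^sup>+w. ennreal (dst (fst w) (snd w) powr p) \<partial>\<pi>)
      \<le> semidiscrete_cost Q n (\<lambda>j x. dst x (z j) powr p)"
      unfolding semidiscrete_cost_def
      using transport_le_alloc_cost[where c="\<lambda>x y. dst x y powr p", OF Q _ n z m2]
      by (intro INF_greatest) auto
    show "semidiscrete_cost Q n (\<lambda>j x. dst x (z j) powr p)
      \<le> (INF \<pi>\<in>couplings X Q (empirical X n z). \<integral>\<^sup>+w. ennreal (dst (fst w) (snd w) powr p) \<partial>\<pi>)"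
      using semidiscrete_cost_le_coupling[where c="\<lambda>x y. dst x y powr p", OF _ n z _ m2]
      by (intro INF_greatest) auto
  qed
  then show ?thesis by (simp add: wasserstein_def)
qed

lemma wasserstein_triangle_empirical:
  fixes X :: "'a::t1_space set"
  assumes "p \<ge> 1" "Metric_space X dst" "Q \<in> distributions X" "n \<ge> 1"
    and "\<And>j. j \<in> {1..n} \<Longrightarrow> z j \<in> X"
    and "(\<lambda>w. dst (fst w) (snd w)) \<in> borel_measurable (borel_on X \<Otimes>\<^sub>M borel_on X)"
  shows "wasserstein X dst p P (empirical X n z)
    \<le> wasserstein X dst p P Q + wasserstein X dst p Q (empirical X n z)"
  using wasserstein_triangle_alloc[of p X dst n z P Q] wasserstein_empirical[of Q X n z dst p] assms
  by simp

section \<open>A countable family of plans\<close>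

text \<open>Shares whose marginals are almost uniform are mixed, on a set of bounded costs, with
  constants \<open>h j\<close> that make the marginals exactly uniform.\<close>

lemma semidiscrete_cost_le_repair:
  fixes g c :: "nat \<Rightarrow> 'a \<Rightarrow> real" and M \<theta> :: real
  assumes "prob_space Q" and n: "n \<ge> 1"
    and c[measurable]: "\<And>j. j \<in> {1..n} \<Longrightarrow> c j \<in> borel_measurable Q"
    and c0: "\<And>j x. 0 \<le> c j x"
    and g[measurable]: "\<And>j. j \<in> {1..n} \<Longrightarrow> g j \<in> borel_measurable Q"
    and g0: "\<And>j x. j \<in> {1..n} \<Longrightarrow> 0 \<le> g j x"
    and g1: "\<And>x. (\<Sum>j\<in>{1..n}. g j x) = 1"
    and M: "0 \<le> M" and \<theta>: "0 < \<theta>" "\<theta> \<le> 1"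
    and R: "R = {x \<in> space Q. \<forall>j\<in>{1..n}. c j x < M}"
    and pos: "\<And>j. j \<in> {1..n} \<Longrightarrow> 0 < (\<integral>x. g j x * indicator R x \<partial>Q)"
    and close: "\<And>j. j \<in> {1..n} \<Longrightarrow> \<bar>1 / real n - (\<integral>x. g j x \<partial>Q)\<bar> \<le> \<theta> * (\<integral>x. g j x * indicator R x \<partial>Q)"
  shows "semidiscrete_cost Q n c \<le> alloc_cost Q n c g + ennreal (\<theta> * M)"
proof -
  interpret prob_space Q by fact
  have Rm[measurable]: "R \<in> sets Q" unfolding R by measurable
  have gle: "g j x \<le> 1" if "j \<in> {1..n}" for j x
    using member_le_sum[of j "{1..n}" "\<lambda>j. g j x"] g0 g1[of x] that by auto
  have gint: "integrable Q (g j)" if "j \<in> {1..n}" for j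
    using that g0 gle by (intro integrable_const_bound[where B=1]) auto
  have gRint: "integrable Q (\<lambda>x. g j x * indicator R x)" if "j \<in> {1..n}" for j
    using that gint Rm by (intro integrable_real_mult_indicator) auto
  have Rint: "integrable Q (indicat_real R)" by (rule integrable_const_bound[where B=1]) auto
  define v where "v j = (\<integral>x. g j x \<partial>Q)" for j
  define w where "w j = (\<integral>x. g j x * indicator R x \<partial>Q)" for j
  define q where "q = measure Q R"
  have sv: "(\<Sum>j\<in>{1..n}. v j) = 1"
    unfolding v_def using gint by (subst Bochner_Integration.integral_sum[symmetric]) (auto simp: g1 prob_space)
  have sw: "(\<Sum>j\<in>{1..n}. w j) = q"
    unfolding w_def using gRint
    by (subst Bochner_Integration.integral_sum[symmetric]) (auto simp: g1 q_def sum_distrib_right[symmetric])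
  have q0: "0 < q" unfolding sw[symmetric] using n pos by (intro sum_pos) (auto simp: w_def)
  \<comment> \<open>The number \<open>h j\<close> solves
    \<open>v j + \<theta> * (h j * q - w j) = 1 / n\<close>, the equation for a corrected marginal.
    The assumption \<open>close\<close> makes it nonnegative, and the \<open>h j\<close> sum to 1
    because the errors \<open>1 / n - v j\<close> cancel in the sum.\<close>
  define h where "h j = (1 / real n - v j) / (\<theta> * q) + w j / q" for j
  have h0: "0 \<le> h j" if "j \<in> {1..n}" for j
  proof -
    have "0 \<le> (1 / real n - v j) + \<theta> * w j" using close[OF that] by (auto simp: v_def w_def)
    then have "0 \<le> ((1 / real n - v j) + \<theta> * w j) / (\<theta> * q)" using \<theta> q0 by simp
    also have "\<dots> = h j" using \<theta> q0 by (simp add: h_def field_simps)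
    finally show ?thesis .
  qed
  have h1: "(\<Sum>j\<in>{1..n}. h j) = 1"
  proof -
    have "(\<Sum>j\<in>{1..n}. h j) = (\<Sum>j\<in>{1..n}. 1 / real n - v j) / (\<theta> * q) + (\<Sum>j\<in>{1..n}. w j) / q"
      by (simp add: h_def sum.distrib sum_divide_distrib)
    also have "(\<Sum>j\<in>{1..n}. 1 / real n - v j) = 0" using n by (simp add: sum_subtractf sv)
    finally show ?thesis using q0 by (simp add: sw)
  qed
  \<comment> \<open>On \<open>R\<close> this is
    \<open>(1 - \<theta>) * g j x + \<theta> * h j\<close>; off \<open>R\<close>, where costs may be
    large, nothing changes. Mass redistributed by the \<open>h j\<close> pays at most
    \<open>M\<close> per unit, whence the extra term \<open>\<theta> * M\<close>.\<close>
  define f where "f j x = g j x + indicator R x * (\<theta> * (h j - g j x))" for j x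
  have f0: "0 \<le> f j x" if "j \<in> {1..n}" for j x
  proof -
    have "0 \<le> (1 - \<theta>) * g j x + \<theta> * h j" using \<theta> g0 h0 that by simp
    then show ?thesis using g0[OF that] by (auto simp: f_def indicator_def algebra_simps)
  qed
  have fint: "(\<integral>\<^sup>+x. ennreal (f j x) \<partial>Q) = ennreal (1 / real n)" if j: "j \<in> {1..n}" for j
  proof -
    have fa: "f j x = g j x + (\<theta> * h j) * indicator R x - \<theta> * (g j x * indicator R x)" for x
      by (simp add: f_def algebra_simps)
    have i: "integrable Q (f j)"
      unfolding fa using gint[OF j] gRint[OF j] by (intro Bochner_Integration.integrable_diff
        Bochner_Integration.integrable_add) (auto intro: Rint)
    have "(\<integral>x. f j x \<partial>Q) = v j + (\<theta> * h j) * q - \<theta> * w j"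
      unfolding fa v_def w_def q_def using gint[OF j] gRint[OF j] Rint
      by (subst Bochner_Integration.integral_diff)
        (auto intro!: Bochner_Integration.integrable_add simp: Bochner_Integration.integral_add)
    also have "\<dots> = 1 / real n" using \<theta> q0 by (simp add: h_def field_simps)
    finally show ?thesis using i f0[OF j] by (simp add: nn_integral_eq_integral)
  qed
  have fm[measurable]: "f j \<in> borel_measurable Q" if "j \<in> {1..n}" for j
    unfolding f_def[abs_def] using g[OF that] by measurable
  have "f \<in> allocs Q n"
    unfolding allocs_def using fm f0 fint
    by (auto simp: f_def sum.distrib g1 sum_distrib_left[symmetric] sum_subtractf h1)
  then have "semidiscrete_cost Q n c \<le> alloc_cost Q n c f"
    unfolding semidiscrete_cost_def by (rule INF_lower)
  also have "\<dots> \<le> (\<Sum>j\<in>{1..n}. (\<integral>\<^sup>+x. ennreal (g j x * c j x) \<partial>Q) + ennreal (\<theta> * h j * M))"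
    unfolding alloc_cost_def
  proof (rule sum_mono)
    fix j assume j: "j \<in> {1..n}"
    note [measurable] = c[OF j] g[OF j]
    have "(\<integral>\<^sup>+x. ennreal (f j x * c j x) \<partial>Q) \<le> (\<integral>\<^sup>+x. ennreal (g j x * c j x) + ennreal (\<theta> * h j * M) \<partial>Q)"
    proof (rule nn_integral_mono)
      fix x assume "x \<in> space Q"
      have "f j x * c j x \<le> g j x * c j x + \<theta> * h j * M"
      proof (cases "x \<in> R")
        case True
        then have cM: "c j x \<le> M" using j by (auto simp: R intro: less_imp_le)
        have "f j x * c j x = g j x * c j x - \<theta> * g j x * c j x + \<theta> * h j * c j x"
          using True by (simp add: f_def algebra_simps)
        also have "\<dots> \<le> g j x * c j x + \<theta> * h j * M"
          using \<theta> g0[OF j, of x] c0[of j x] h0[OF j] cM by (intro add_mono mult_left_mono) auto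
        finally show ?thesis .
      next
        case False
        then show ?thesis using \<theta> h0[OF j] M by (simp add: f_def)
      qed
      then have "ennreal (f j x * c j x) \<le> ennreal (g j x * c j x + \<theta> * h j * M)" by (rule ennreal_leI)
      also have "\<dots> = ennreal (g j x * c j x) + ennreal (\<theta> * h j * M)"
        using g0[OF j] c0 \<theta> h0[OF j] M by (intro ennreal_plus) auto
      finally show "ennreal (f j x * c j x) \<le> ennreal (g j x * c j x) + ennreal (\<theta> * h j * M)" .
    qed
    also have "\<dots> = (\<integral>\<^sup>+x. ennreal (g j x * c j x) \<partial>Q) + ennreal (\<theta> * h j * M)"
      by (subst nn_integral_add) (auto simp: emeasure_space_1)
    finally show "(\<integral>\<^sup>+x. ennreal (f j x * c j x) \<partial>Q)
      \<le> (\<integral>\<^sup>+x. ennreal (g j x * c j x) \<partial>Q) + ennreal (\<theta> * h j * M)" .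
  qed
  also have "\<dots> = alloc_cost Q n c g + ennreal (\<Sum>j\<in>{1..n}. \<theta> * h j * M)"
    using \<theta> h0 M by (subst sum_ennreal[symmetric]) (auto simp: alloc_cost_def sum.distrib)
  also have "(\<Sum>j\<in>{1..n}. \<theta> * h j * M) = \<theta> * M"
    by (simp add: sum_distrib_right[symmetric] sum_distrib_left[symmetric] h1)
  finally show ?thesis .
qed

text \<open>Take the integers \<open>\<lfloor>N * t j\<rfloor> + 1\<close>, where the summand 1
  keeps every entry positive. Their sum lies between \<open>N\<close> and \<open>N + card J\<close>,
  so each quotient misses \<open>t j\<close> by at most \<open>card J / N\<close>. Positive entries
  ensure that a table never divides by zero.\<close>

lemma simplex_rational_approx:
  fixes t :: "'i \<Rightarrow> real"
  assumes "finite J" "J \<noteq> {}" and t0: "\<And>j. j \<in> J \<Longrightarrow> 0 \<le> t j" and t1: "sum t J = 1" and e: "0 < e"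
  obtains w :: "'i \<Rightarrow> nat" where "\<And>j. j \<in> J \<Longrightarrow> 1 \<le> w j"
    "\<And>j. j \<in> J \<Longrightarrow> \<bar>real (w j) / (\<Sum>i\<in>J. real (w i)) - t j\<bar> \<le> e"
proof -
  define n where "n = real (card J)"
  have n: "1 \<le> n" using assms(1,2) by (simp add: n_def Suc_le_eq card_gt_0_iff One_nat_def)
  obtain N :: nat where N: "n / e < real N" using reals_Archimedean2 by blast
  define w where "w j = nat \<lfloor>real N * t j\<rfloor> + 1" for j
  define S where "S = (\<Sum>i\<in>J. real (w i))"
  have w: "real N * t j \<le> real (w j)" "real (w j) \<le> real N * t j + 1" if "j \<in> J" for j
    using t0[OF that] by (auto simp: w_def)
  have "(\<Sum>i\<in>J. real N * t i) \<le> S" unfolding S_def by (intro sum_mono w)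
  then have S1: "real N \<le> S" by (simp add: sum_distrib_left[symmetric] t1)
  have "S \<le> (\<Sum>i\<in>J. real N * t i + 1)" unfolding S_def by (intro sum_mono w)
  then have S2: "S \<le> real N + n" by (simp add: sum.distrib sum_distrib_left[symmetric] t1 n_def)
  have N0: "0 < real N" using N n e by (meson divide_pos_pos less_le_trans less_trans zero_less_one)
  have "\<bar>real (w j) / S - t j\<bar> \<le> e" if j: "j \<in> J" for j
  proof -
    have tj: "t j \<le> 1" using member_le_sum[OF j, of t] t0 t1 assms(1) by auto
    have "real (w j) - t j * S \<le> n"
    proof -
      have "t j * real N \<le> t j * S" using S1 t0[OF j] by (intro mult_left_mono)
      then show ?thesis using w(2)[OF j] n by (simp add: mult.commute)
    qed
    moreover have "- n \<le> real (w j) - t j * S"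
    proof -
      have "t j * S \<le> t j * (real N + n)" using S2 t0[OF j] by (intro mult_left_mono)
      also have "\<dots> \<le> real N * t j + n" using mult_right_mono[OF tj, of n] n by (simp add: algebra_simps)
      finally show ?thesis using w(1)[OF j] by simp
    qed
    ultimately have "\<bar>real (w j) - t j * S\<bar> \<le> n" by simp
    moreover have "\<bar>real (w j) / S - t j\<bar> = \<bar>real (w j) - t j * S\<bar> / S"
      using S1 N0 by (simp add: field_simps)
    ultimately have "\<bar>real (w j) / S - t j\<bar> \<le> n / S" using S1 N0 by (simp add: divide_right_mono)
    also have "\<dots> \<le> n / real N" using S1 N0 n by (intro divide_left_mono) auto
    also have "\<dots> \<le> e" using N N0 e by (simp add: field_simps)
    finally show ?thesis .
  qed
  then show ?thesis by (intro that[of w]) (auto simp: w_def S_def)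
qed

section \<open>Shares read off a table on the grid of costs\<close>

text \<open>Where all costs are below \<open>L\<close>, the vector of costs is rounded down to the grid of mesh \<open>1 / L\<close>,
  and the shares are read off a table of positive integers indexed by the grid points; elsewhere
  all mass goes to the cheapest sample point. The tables are finite objects, hence countable.\<close>

definition cells :: "nat \<Rightarrow> nat \<Rightarrow> (nat \<Rightarrow> nat) set" where
  "cells n L = {1..n} \<rightarrow>\<^sub>E {..<L * L}"

definition in_cell :: "nat \<Rightarrow> (nat \<Rightarrow> 'a \<Rightarrow> real) \<Rightarrow> nat \<Rightarrow> (nat \<Rightarrow> nat) \<Rightarrow> 'a \<Rightarrow> bool" where
  "in_cell n c L \<kappa> x \<longleftrightarrow> (\<forall>j\<in>{1..n}. real (\<kappa> j) \<le> real L * c j x \<and> real L * c j x < real (\<kappa> j) + 1)"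

definition costs_below :: "nat \<Rightarrow> (nat \<Rightarrow> 'a \<Rightarrow> real) \<Rightarrow> nat \<Rightarrow> 'a \<Rightarrow> bool" where
  "costs_below n c L x \<longleftrightarrow> (\<forall>j\<in>{1..n}. c j x < real L)"

text \<open>Ties are broken in favour of the smallest index, so that exactly one index is selected
  at each point and the selection is given by finitely many comparisons.\<close>

definition first_minimum :: "nat \<Rightarrow> (nat \<Rightarrow> 'a \<Rightarrow> real) \<Rightarrow> nat \<Rightarrow> 'a \<Rightarrow> bool" where
  "first_minimum n c j x \<longleftrightarrow> (\<forall>i\<in>{1..n}. c j x \<le> c i x \<and> (i < j \<longrightarrow> c j x < c i x))"

definition table_weight :: "nat \<Rightarrow> ((nat \<Rightarrow> nat) \<Rightarrow> nat \<Rightarrow> nat) \<Rightarrow> (nat \<Rightarrow> nat) \<Rightarrow> nat \<Rightarrow> real" where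
  "table_weight n w \<kappa> j = real (w \<kappa> j) / (\<Sum>i\<in>{1..n}. real (w \<kappa> i))"

definition tables :: "nat \<Rightarrow> nat \<Rightarrow> ((nat \<Rightarrow> nat) \<Rightarrow> nat \<Rightarrow> nat) set" where
  "tables n L = cells n L \<rightarrow>\<^sub>E ({1..n} \<rightarrow>\<^sub>E {1..})"

text \<open>No measure occurs here: one table gives shares for all distributions at once, as an
  explicit expression in the costs. The price is that the marginals come out uniform only
  approximately, hence the later repair.\<close>

definition table_alloc :: "nat \<Rightarrow> (nat \<Rightarrow> 'a \<Rightarrow> real) \<Rightarrow> nat \<Rightarrow> ((nat \<Rightarrow> nat) \<Rightarrow> nat \<Rightarrow> nat) \<Rightarrow> nat \<Rightarrow> 'a \<Rightarrow> real" where
  "table_alloc n c L w j x = (if costs_below n c L x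
     then \<Sum>\<kappa>\<in>cells n L. indicator {y. in_cell n c L \<kappa> y} x * table_weight n w \<kappa> j
     else indicator {y. first_minimum n c j y} x)"

lemma finite_cells [simp]: "finite (cells n L)"
  by (simp add: cells_def finite_PiE)

lemma countable_tables [simp]: "countable (tables n L)"
  unfolding tables_def by (intro countable_PiE countableI_type) (auto intro: countable_PiE)

lemma ex_cell:
  assumes c0: "\<And>j x. 0 \<le> c j x" and "costs_below n c L x" and "1 \<le> L"
  obtains \<kappa> where "\<kappa> \<in> cells n L" "in_cell n c L \<kappa> x"
proof
  define \<kappa> where "\<kappa> = (\<lambda>j\<in>{1..n}. nat \<lfloor>real L * c j x\<rfloor>)"
  have "real L * c j x < real (L * L)" if "j \<in> {1..n}" for j
    using assms that by (auto simp: costs_below_def)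
  then have "\<lfloor>real L * c j x\<rfloor> < int (L * L)" if "j \<in> {1..n}" for j
    using that by (metis floor_less_iff of_int_of_nat_eq)
  then show "\<kappa> \<in> cells n L"
    using c0 assms(3) by (auto simp: cells_def \<kappa>_def nat_less_iff)
  show "in_cell n c L \<kappa> x"
    using c0 by (auto simp: in_cell_def \<kappa>_def)
qed

lemma in_cell_unique:
  assumes "\<kappa> \<in> cells n L" "\<kappa>' \<in> cells n L" "in_cell n c L \<kappa> x" "in_cell n c L \<kappa>' x"
  shows "\<kappa> = \<kappa>'"
proof (rule PiE_ext[OF assms(1,2)[unfolded cells_def]])
  fix j assume "j \<in> {1..n}"
  then have "real (\<kappa> j) \<le> real L * c j x" "real L * c j x < real (\<kappa> j) + 1"
    "real (\<kappa>' j) \<le> real L * c j x" "real L * c j x < real (\<kappa>' j) + 1"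
    using assms(3,4) unfolding in_cell_def by blast+
  then show "\<kappa> j = \<kappa>' j" by linarith
qed

text \<open>A natural number \<open>M\<close> is a multiple of the mesh \<open>1 / L\<close>, so
  each cell lies entirely on one side of the bound. This is the reason for taking the bounds on the
  costs to be integers.\<close>

lemma in_cell_costs_below_iff:
  assumes "in_cell n c L \<kappa> x" "1 \<le> L"
  shows "costs_below n c M x \<longleftrightarrow> (\<forall>j\<in>{1..n}. \<kappa> j < L * M)"
proof -
  have "c j x < real M \<longleftrightarrow> \<kappa> j < L * M" if "j \<in> {1..n}" for j
  proof -
    have "c j x < real M \<longleftrightarrow> real L * c j x < real (L * M)" using assms(2) by simp
    also have "\<dots> \<longleftrightarrow> \<kappa> j < L * M"
    proof
      assume "real L * c j x < real (L * M)"
      then show "\<kappa> j < L * M" using assms(1) that unfolding in_cell_def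
        by (meson le_less_trans of_nat_less_iff)
    next
      assume "\<kappa> j < L * M"
      then have "real (\<kappa> j) + 1 \<le> real (L * M)" by linarith
      then show "real L * c j x < real (L * M)" using assms(1) that unfolding in_cell_def
        by (meson less_le_trans)
    qed
    finally show ?thesis .
  qed
  then show ?thesis by (auto simp: costs_below_def)
qed

lemma cell_costs_below:
  assumes "\<kappa> \<in> cells n L" "in_cell n c L \<kappa> x" "1 \<le> L"
  shows "costs_below n c L x"
  using assms by (auto simp: in_cell_costs_below_iff cells_def)

lemma table_alloc_in_cell:
  assumes "\<kappa> \<in> cells n L" "in_cell n c L \<kappa> x" "1 \<le> L"
  shows "table_alloc n c L w j x = table_weight n w \<kappa> j"
proof -
  have "(\<Sum>\<kappa>'\<in>cells n L. indicator {y. in_cell n c L \<kappa>' y} x * table_weight n w \<kappa>' j)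
    = (\<Sum>\<kappa>'\<in>cells n L. if \<kappa>' = \<kappa> then table_weight n w \<kappa> j else 0)"
  proof (rule sum.cong[OF refl])
    fix \<kappa>' assume "\<kappa>' \<in> cells n L"
    then have "in_cell n c L \<kappa>' x \<longleftrightarrow> \<kappa>' = \<kappa>"
      using in_cell_unique[OF _ assms(1) _ assms(2)] assms(2) by blast
    then show "indicator {y. in_cell n c L \<kappa>' y} x * table_weight n w \<kappa>' j
      = (if \<kappa>' = \<kappa> then table_weight n w \<kappa> j else 0)"
      by (simp add: indicator_def)
  qed
  then show ?thesis
    using assms(1) cell_costs_below[OF assms] by (simp add: table_alloc_def)
qed

lemma first_minimum_ex1:
  fixes c :: "nat \<Rightarrow> 'a \<Rightarrow> real"
  assumes "1 \<le> n"
  shows "\<exists>j\<in>{1..n}. \<forall>i\<in>{1..n}. first_minimum n c i x \<longleftrightarrow> i = j"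
proof -
  define m where "m = Min ((\<lambda>i. c i x) ` {1..n})"
  have mle: "m \<le> c i x" if "i \<in> {1..n}" for i using that by (auto simp: m_def)
  have "m \<in> (\<lambda>i. c i x) ` {1..n}" unfolding m_def using assms by (intro Min_in) auto
  then obtain i where i: "i \<in> {1..n} \<and> c i x = m" by auto
  define j where "j = (LEAST i. i \<in> {1..n} \<and> c i x = m)"
  have j: "j \<in> {1..n}" "c j x = m" using LeastI[where P="\<lambda>i. i \<in> {1..n} \<and> c i x = m", OF i] by (auto simp: j_def)
  have jl: "j \<le> k" if "k \<in> {1..n}" "c k x = m" for k
    unfolding j_def using that by (intro Least_le) auto
  show ?thesis
  proof (intro bexI[OF _ j(1)] ballI)
    fix k assume k: "k \<in> {1..n}"
    show "first_minimum n c k x \<longleftrightarrow> k = j"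
    proof
      assume f: "first_minimum n c k x"
      then have "c k x = m" using j mle[OF k] unfolding first_minimum_def by (metis order_antisym)
      then have "j \<le> k" using jl[OF k] by simp
      moreover have "\<not> j < k" using f j \<open>c k x = m\<close> unfolding first_minimum_def by (metis less_irrefl)
      ultimately show "k = j" by simp
    next
      assume "k = j"
      then show "first_minimum n c k x"
        using j mle jl unfolding first_minimum_def by (metis leD less_eq_real_def)
    qed
  qed
qed

lemma table_weight_simplex:
  assumes "w \<in> tables n L" "\<kappa> \<in> cells n L" "1 \<le> n"
  shows "0 \<le> table_weight n w \<kappa> j" "(\<Sum>j\<in>{1..n}. table_weight n w \<kappa> j) = 1"
proof -
  have "1 \<le> w \<kappa> j" if "j \<in> {1..n}" for j
    using assms that by (auto simp: tables_def PiE_iff)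
  then have "0 < (\<Sum>i\<in>{1..n}. real (w \<kappa> i))"
    using assms(3) by (intro sum_pos) force+
  then show "0 \<le> table_weight n w \<kappa> j" "(\<Sum>j\<in>{1..n}. table_weight n w \<kappa> j) = 1"
    by (auto simp: table_weight_def sum_divide_distrib[symmetric])
qed

lemma table_alloc_simplex:
  assumes c0: "\<And>j x. 0 \<le> c j x" and w: "w \<in> tables n L" and n: "1 \<le> n"
  shows "0 \<le> table_alloc n c L w j x" "(\<Sum>j\<in>{1..n}. table_alloc n c L w j x) = 1"
proof -
  show "0 \<le> table_alloc n c L w j x"
    using table_weight_simplex(1)[OF w _ n] by (auto simp: table_alloc_def intro!: sum_nonneg)
  show "(\<Sum>j\<in>{1..n}. table_alloc n c L w j x) = 1"
  proof (cases "costs_below n c L x")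
    case True
    \<comment> \<open>Costs are nonnegative, so a point with costs below \<open>L\<close> excludes
      the degenerate grid \<open>L = 0\<close>.\<close>
    then have "c 1 x < real L" using n by (auto simp: costs_below_def)
    then have L: "1 \<le> L" using c0[of 1 x] by (cases L) auto
    obtain \<kappa> where k: "\<kappa> \<in> cells n L" "in_cell n c L \<kappa> x" using ex_cell[of c n L x] c0 True L by blast
    show ?thesis using table_weight_simplex(2)[OF w k(1) n] by (simp add: table_alloc_in_cell[OF k L])
  next
    case False
    obtain j where j: "j \<in> {1..n}" "\<And>i. i \<in> {1..n} \<Longrightarrow> first_minimum n c i x \<longleftrightarrow> i = j"
      using first_minimum_ex1[OF n, of c x] by blast
    have "(\<Sum>i\<in>{1..n}. table_alloc n c L w i x) = (\<Sum>i\<in>{1..n}. if i = j then 1 else 0)"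
      using False j(2) by (intro sum.cong) (auto simp: table_alloc_def)
    then show ?thesis using j(1) by simp
  qed
qed

lemma measurable_in_cell:
  assumes [measurable]: "\<And>j. j \<in> {1..n} \<Longrightarrow> c j \<in> borel_measurable N"
  shows "Measurable.pred N (in_cell n c L \<kappa>)"
  unfolding in_cell_def[abs_def] by measurable

lemma measurable_costs_below:
  assumes [measurable]: "\<And>j. j \<in> {1..n} \<Longrightarrow> c j \<in> borel_measurable N"
  shows "Measurable.pred N (costs_below n c L)"
  unfolding costs_below_def[abs_def] by measurable

lemma borel_measurable_indicator_Collect:
  assumes [measurable]: "Measurable.pred N P"
  shows "(indicator {x. P x} :: _ \<Rightarrow> real) \<in> borel_measurable N"
  by (rule borel_measurable_indicator'[where f="\<lambda>x. x"]) (simp add: assms[unfolded pred_def])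

lemma measurable_table_alloc:
  assumes c[measurable]: "\<And>j. j \<in> {1..n} \<Longrightarrow> c j \<in> borel_measurable N" and j: "j \<in> {1..n}"
  shows "table_alloc n c L w j \<in> borel_measurable N"
proof -
  note [measurable] = c[OF j]
  have "Measurable.pred N (first_minimum n c j)"
    unfolding first_minimum_def[abs_def] by measurable
  then show ?thesis
    unfolding table_alloc_def[abs_def] using measurable_costs_below[of n c N L] c
    by (intro measurable_If borel_measurable_sum borel_measurable_times borel_measurable_const
        borel_measurable_indicator_Collect measurable_in_cell) (auto simp: pred_def)
qed

section \<open>Approximation of given shares by a table\<close>

lemma allocsD:
  assumes "f \<in> allocs Q n"
  shows "\<And>j. j \<in> {1..n} \<Longrightarrow> f j \<in> borel_measurable Q"
    and "\<And>j x. j \<in> {1..n} \<Longrightarrow> x \<in> space Q \<Longrightarrow> 0 \<le> f j x"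
    and "\<And>x. x \<in> space Q \<Longrightarrow> (\<Sum>j\<in>{1..n}. f j x) = 1"
    and "\<And>j x. j \<in> {1..n} \<Longrightarrow> x \<in> space Q \<Longrightarrow> f j x \<le> 1"
    and "\<And>j. j \<in> {1..n} \<Longrightarrow> (\<integral>x. f j x \<partial>Q) = 1 / real n"
proof -
  show m: "f j \<in> borel_measurable Q" and nn: "x \<in> space Q \<Longrightarrow> 0 \<le> f j x" if "j \<in> {1..n}" for j x
    using assms that by (auto simp: allocs_def)
  show s: "(\<Sum>j\<in>{1..n}. f j x) = 1" if "x \<in> space Q" for x
    using assms that by (auto simp: allocs_def)
  show "f j x \<le> 1" if "j \<in> {1..n}" "x \<in> space Q" for j x
    using member_le_sum[of j "{1..n}" "\<lambda>j. f j x"] nn s[of x] that by auto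
  show "(\<integral>x. f j x \<partial>Q) = 1 / real n" if "j \<in> {1..n}" for j
    using assms that m[OF that] nn[OF that]
    by (subst integral_eq_nn_integral) (auto simp: allocs_def)
qed

text \<open>The cells partition the points with all costs below \<open>L\<close>, so at most one
  summand is nonzero. It is used for the constant 1, for the rounded costs and for the indicator of
  a smaller bound on the costs.\<close>

lemma sum_indicator_cells:
  assumes c0: "\<And>j x. 0 \<le> c j x" and "1 \<le> L"
  shows "(\<Sum>\<kappa>\<in>cells n L. indicator {y. in_cell n c L \<kappa> y} x * h \<kappa>)
    = (if costs_below n c L x then h (THE \<kappa>. \<kappa> \<in> cells n L \<and> in_cell n c L \<kappa> x) else (0::real))"
proof (cases "costs_below n c L x")
  case True
  obtain \<kappa> where k: "\<kappa> \<in> cells n L" "in_cell n c L \<kappa> x"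
    using ex_cell[of c n L x] c0 True assms(2) by blast
  have u: "\<kappa>' = \<kappa>" if "\<kappa>' \<in> cells n L \<and> in_cell n c L \<kappa>' x" for \<kappa>'
    using in_cell_unique[OF _ k(1) _ k(2)] that by blast
  have "(THE \<kappa>. \<kappa> \<in> cells n L \<and> in_cell n c L \<kappa> x) = \<kappa>"
    by (rule the_equality) (use k in blast, rule u)
  moreover have "(\<Sum>\<kappa>\<in>cells n L. indicator {y. in_cell n c L \<kappa> y} x * h \<kappa>)
    = (\<Sum>\<kappa>'\<in>cells n L. if \<kappa>' = \<kappa> then h \<kappa> else 0)"
  proof (rule sum.cong[OF refl])
    fix \<kappa>' assume "\<kappa>' \<in> cells n L"
    then have "in_cell n c L \<kappa>' x \<longleftrightarrow> \<kappa>' = \<kappa>" using u k by blast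
    then show "indicator {y. in_cell n c L \<kappa>' y} x * h \<kappa>' = (if \<kappa>' = \<kappa> then h \<kappa> else 0)"
      by (simp add: indicator_def)
  qed
  ultimately show ?thesis using True k by simp
next
  case False
  then have "\<not> in_cell n c L \<kappa> x" if "\<kappa> \<in> cells n L" for \<kappa>
    using cell_costs_below[of \<kappa> n L c x] that assms(2) by blast
  then show ?thesis using False by (auto intro!: sum.neutral)
qed

lemma the_cell:
  assumes c0: "\<And>j x. 0 \<le> c j x" and "1 \<le> L" and "costs_below n c L x"
  shows "(THE \<kappa>. \<kappa> \<in> cells n L \<and> in_cell n c L \<kappa> x) \<in> cells n L"
    "in_cell n c L (THE \<kappa>. \<kappa> \<in> cells n L \<and> in_cell n c L \<kappa> x) x"
proof -
  obtain \<kappa> where k: "\<kappa> \<in> cells n L \<and> in_cell n c L \<kappa> x"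
    using ex_cell[of c n L x] c0 assms(2,3) by blast
  have "(THE \<kappa>. \<kappa> \<in> cells n L \<and> in_cell n c L \<kappa> x) \<in> cells n L
    \<and> in_cell n c L (THE \<kappa>. \<kappa> \<in> cells n L \<and> in_cell n c L \<kappa> x) x"
  proof (rule theI[where P="\<lambda>\<kappa>. \<kappa> \<in> cells n L \<and> in_cell n c L \<kappa> x", OF k])
    fix \<kappa>' assume "\<kappa>' \<in> cells n L \<and> in_cell n c L \<kappa>' x"
    then show "\<kappa>' = \<kappa>" using in_cell_unique[of \<kappa>' n L \<kappa> c x] k by blast
  qed
  then show "(THE \<kappa>. \<kappa> \<in> cells n L \<and> in_cell n c L \<kappa> x) \<in> cells n L"
    "in_cell n c L (THE \<kappa>. \<kappa> \<in> cells n L \<and> in_cell n c L \<kappa> x) x" by auto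
qed

lemma (in prob_space) integrable_times_unit:
  fixes f g :: "'a \<Rightarrow> real"
  assumes "f \<in> borel_measurable M" "g \<in> borel_measurable M"
    and "\<And>x. x \<in> space M \<Longrightarrow> \<bar>f x\<bar> \<le> B" "\<And>x. x \<in> space M \<Longrightarrow> \<bar>g x\<bar> \<le> C"
  shows "integrable M (\<lambda>x. f x * g x)"
proof (rule integrable_const_bound[where B="B * C"])
  show "AE x in M. norm (f x * g x) \<le> B * C"
  proof (rule AE_I2)
    fix x assume x: "x \<in> space M"
    have "\<bar>f x\<bar> * \<bar>g x\<bar> \<le> B * C"
      using assms(3)[OF x] assms(4)[OF x] by (intro mult_mono) auto
    then show "norm (f x * g x) \<le> B * C" by (simp add: abs_mult)
  qed
qed (use assms in measurable)

text \<open>The table is a rational approximation of the conditional means of \<open>f\<close> given the cell.\<close>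

lemma ex_table:
  assumes "prob_space Q" and n: "1 \<le> n" and f: "f \<in> allocs Q n" and e: "0 < \<eta>"
    and c: "\<And>j. j \<in> {1..n} \<Longrightarrow> c j \<in> borel_measurable Q"
  obtains w where "w \<in> tables n L"
    "\<And>\<kappa> j. \<kappa> \<in> cells n L \<Longrightarrow> j \<in> {1..n} \<Longrightarrow>
      \<bar>table_weight n w \<kappa> j * (\<integral>x. indicator {y. in_cell n c L \<kappa> y} x \<partial>Q)
        - (\<integral>x. f j x * indicator {y. in_cell n c L \<kappa> y} x \<partial>Q)\<bar>
      \<le> \<eta> * (\<integral>x. indicator {y. in_cell n c L \<kappa> y} x \<partial>Q)"
proof -
  interpret prob_space Q by fact
  note fD = allocsD[OF f]
  let ?D = "\<lambda>\<kappa>. {y. in_cell n c L \<kappa> y}"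
  have Dm[measurable]: "(indicator (?D \<kappa>) :: _ \<Rightarrow> real) \<in> borel_measurable Q" for \<kappa>
    by (rule borel_measurable_indicator_Collect[OF measurable_in_cell[OF c]])
  define q :: "(nat \<Rightarrow> nat) \<Rightarrow> real" where "q \<kappa> = (\<integral>x. indicator (?D \<kappa>) x \<partial>Q)" for \<kappa>
  define F where "F \<kappa> j = (\<integral>x. f j x * indicator (?D \<kappa>) x \<partial>Q)" for \<kappa> j
  have Dint: "integrable Q (indicator (?D \<kappa>) :: _ \<Rightarrow> real)" for \<kappa>
    by (rule integrable_const_bound[where B=1]) (auto simp: indicator_def)
  have fint: "integrable Q (\<lambda>x. f j x * indicator (?D \<kappa>) x)" if "j \<in> {1..n}" for \<kappa> j
    using fD(1,2,4)[OF that]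
    by (intro integrable_times_unit[where B=1 and C=1] Dm) (auto simp: indicator_def)
  have F0: "0 \<le> F \<kappa> j" if "j \<in> {1..n}" for \<kappa> j
    unfolding F_def using fD(2)[OF that] by (intro Bochner_Integration.integral_nonneg_AE AE_I2) auto
  have Fs: "(\<Sum>j\<in>{1..n}. F \<kappa> j) = q \<kappa>" for \<kappa>
  proof -
    have "(\<Sum>j\<in>{1..n}. F \<kappa> j) = (\<integral>x. (\<Sum>j\<in>{1..n}. f j x * indicator (?D \<kappa>) x) \<partial>Q)"
      unfolding F_def using fint by (intro Bochner_Integration.integral_sum[symmetric])
    also have "\<dots> = q \<kappa>"
      unfolding q_def using fD(3)
      by (intro Bochner_Integration.integral_cong refl) (simp add: sum_distrib_right[symmetric])
    finally show ?thesis .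
  qed
  have q0: "0 \<le> q \<kappa>" for \<kappa> unfolding q_def by (intro Bochner_Integration.integral_nonneg_AE AE_I2) auto
  have "\<exists>u. (\<forall>j\<in>{1..n}. 1 \<le> u j) \<and>
      (\<forall>j\<in>{1..n}. \<bar>real (u j) / (\<Sum>i\<in>{1..n}. real (u i)) * q \<kappa> - F \<kappa> j\<bar> \<le> \<eta> * q \<kappa>)" for \<kappa>
  proof (cases "q \<kappa> = 0")
    \<comment> \<open>On a null cell all the integrals \<open>F \<kappa> j\<close> vanish, and
      arbitrary positive weights serve.\<close>
    case True
    then have "F \<kappa> j = 0" if "j \<in> {1..n}" for j
      using member_le_sum[of j "{1..n}" "F \<kappa>"] F0 Fs[of \<kappa>] that by (simp add: order_antisym)
    then show ?thesis using True by (intro exI[of _ "\<lambda>_. 1"]) auto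
  next
    case False
    then have q: "0 < q \<kappa>" using q0[of \<kappa>] by simp
    obtain u :: "nat \<Rightarrow> nat" where u: "\<And>j. j \<in> {1..n} \<Longrightarrow> 1 \<le> u j"
      "\<And>j. j \<in> {1..n} \<Longrightarrow> \<bar>real (u j) / (\<Sum>i\<in>{1..n}. real (u i)) - F \<kappa> j / q \<kappa>\<bar> \<le> \<eta>"
    proof (rule simplex_rational_approx[of "{1..n}" "\<lambda>j. F \<kappa> j / q \<kappa>" \<eta>])
      show "(\<Sum>j\<in>{1..n}. F \<kappa> j / q \<kappa>) = 1"
        using q by (simp add: sum_divide_distrib[symmetric] Fs)
    qed (use n e q F0 in auto)
    have "\<bar>real (u j) / (\<Sum>i\<in>{1..n}. real (u i)) * q \<kappa> - F \<kappa> j\<bar> \<le> \<eta> * q \<kappa>" if "j \<in> {1..n}" for j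
    proof -
      have "\<bar>real (u j) / (\<Sum>i\<in>{1..n}. real (u i)) * q \<kappa> - F \<kappa> j\<bar>
        = \<bar>(real (u j) / (\<Sum>i\<in>{1..n}. real (u i)) - F \<kappa> j / q \<kappa>) * q \<kappa>\<bar>"
        using q by (simp add: left_diff_distrib)
      also have "\<dots> = \<bar>real (u j) / (\<Sum>i\<in>{1..n}. real (u i)) - F \<kappa> j / q \<kappa>\<bar> * q \<kappa>"
        using q by (simp add: abs_mult)
      finally show ?thesis using u(2)[OF that] q by (simp add: mult_right_mono)
    qed
    then show ?thesis using u(1) by blast
  qed
  then obtain u where u: "\<And>\<kappa> j. j \<in> {1..n} \<Longrightarrow> 1 \<le> u \<kappa> j"
    "\<And>\<kappa> j. j \<in> {1..n} \<Longrightarrow> \<bar>real (u \<kappa> j) / (\<Sum>i\<in>{1..n}. real (u \<kappa> i)) * q \<kappa> - F \<kappa> j\<bar> \<le> \<eta> * q \<kappa>"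
    by metis
  define w where "w = (\<lambda>\<kappa>\<in>cells n L. \<lambda>j\<in>{1..n}. u \<kappa> j)"
  have tw: "table_weight n w \<kappa> j = real (u \<kappa> j) / (\<Sum>i\<in>{1..n}. real (u \<kappa> i))"
    if "\<kappa> \<in> cells n L" "j \<in> {1..n}" for \<kappa> j
    using that by (simp add: table_weight_def w_def)
  show ?thesis
  proof (rule that[of w])
    show "w \<in> tables n L" using u(1) by (auto simp: w_def tables_def)
    show "\<bar>table_weight n w \<kappa> j * (\<integral>x. indicator (?D \<kappa>) x \<partial>Q) - (\<integral>x. f j x * indicator (?D \<kappa>) x \<partial>Q)\<bar>
      \<le> \<eta> * (\<integral>x. indicator (?D \<kappa>) x \<partial>Q)" if "\<kappa> \<in> cells n L" "j \<in> {1..n}" for \<kappa> j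
      using u(2)[OF that(2), of \<kappa>] unfolding tw[OF that] q_def F_def .
  qed
qed

text \<open>Functions that are constant on cells see the shares only through their integrals over
  the cells. On each cell the error is at most \<open>B * \<eta>\<close> times its mass, and the
  masses add up to at most 1, so the number of cells does not enter the bound.\<close>

lemma table_alloc_integral_close:
  fixes h :: "(nat \<Rightarrow> nat) \<Rightarrow> real"
  assumes "prob_space Q" and n: "1 \<le> n" and f: "f \<in> allocs Q n"
    and c: "\<And>j. j \<in> {1..n} \<Longrightarrow> c j \<in> borel_measurable Q" and c0: "\<And>j x. 0 \<le> c j x"
    and L: "1 \<le> L" and w: "w \<in> tables n L" and e: "0 \<le> \<eta>"
    and close: "\<And>\<kappa>. \<kappa> \<in> cells n L \<Longrightarrow>
      \<bar>table_weight n w \<kappa> j * (\<integral>x. indicator {y. in_cell n c L \<kappa> y} x \<partial>Q)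
        - (\<integral>x. f j x * indicator {y. in_cell n c L \<kappa> y} x \<partial>Q)\<bar>
      \<le> \<eta> * (\<integral>x. indicator {y. in_cell n c L \<kappa> y} x \<partial>Q)"
    and j: "j \<in> {1..n}" and h: "\<And>\<kappa>. \<kappa> \<in> cells n L \<Longrightarrow> 0 \<le> h \<kappa> \<and> h \<kappa> \<le> B" and B: "0 \<le> B"
  shows "\<bar>(\<integral>x. table_alloc n c L w j x * (\<Sum>\<kappa>\<in>cells n L. indicator {y. in_cell n c L \<kappa> y} x * h \<kappa>) \<partial>Q)
    - (\<integral>x. f j x * (\<Sum>\<kappa>\<in>cells n L. indicator {y. in_cell n c L \<kappa> y} x * h \<kappa>) \<partial>Q)\<bar> \<le> \<eta> * B"
proof -
  interpret prob_space Q by fact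
  note fD = allocsD[OF f]
  let ?D = "\<lambda>\<kappa>. {y. in_cell n c L \<kappa> y}" and ?g = "table_alloc n c L w j"
  have Dm[measurable]: "(indicator (?D \<kappa>) :: _ \<Rightarrow> real) \<in> borel_measurable Q" for \<kappa>
    by (rule borel_measurable_indicator_Collect[OF measurable_in_cell[OF c]])
  define q :: "(nat \<Rightarrow> nat) \<Rightarrow> real" where "q \<kappa> = (\<integral>x. indicator (?D \<kappa>) x \<partial>Q)" for \<kappa>
  define F where "F \<kappa> = (\<integral>x. f j x * indicator (?D \<kappa>) x \<partial>Q)" for \<kappa>
  have Dint: "integrable Q (indicator (?D \<kappa>) :: _ \<Rightarrow> real)" for \<kappa>
    by (rule integrable_const_bound[where B=1]) (auto simp: indicator_def)
  have fint: "integrable Q (\<lambda>x. f j x * indicator (?D \<kappa>) x)" for \<kappa>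
    using fD(1,2,4)[OF j]
    by (intro integrable_times_unit[where B=1 and C=1] Dm) (auto simp: indicator_def)
  have q0: "0 \<le> q \<kappa>" for \<kappa> unfolding q_def by (intro Bochner_Integration.integral_nonneg_AE AE_I2) auto
  have "(\<Sum>\<kappa>\<in>cells n L. q \<kappa>) = (\<integral>x. (\<Sum>\<kappa>\<in>cells n L. indicator (?D \<kappa>) x * 1) \<partial>Q)"
    unfolding q_def using Dint by (subst Bochner_Integration.integral_sum) auto
  also have "\<dots> = (\<integral>x. indicator {x. costs_below n c L x} x \<partial>Q)"
    by (intro Bochner_Integration.integral_cong refl)
      (subst sum_indicator_cells[where h="\<lambda>_. 1", OF c0 L], simp add: indicator_def)
  also have "\<dots> \<le> (\<integral>x. 1 \<partial>Q)"
    by (intro integral_mono integrable_const_bound[where B=1]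
        borel_measurable_indicator_Collect measurable_costs_below c) (auto simp: indicator_def)
  finally have qs: "(\<Sum>\<kappa>\<in>cells n L. q \<kappa>) \<le> 1" by (simp add: prob_space)
  have "(\<integral>x. ?g x * (\<Sum>\<kappa>\<in>cells n L. indicator (?D \<kappa>) x * h \<kappa>) \<partial>Q)
    = (\<integral>x. (\<Sum>\<kappa>\<in>cells n L. (table_weight n w \<kappa> j * h \<kappa>) * indicator (?D \<kappa>) x) \<partial>Q)"
    by (intro Bochner_Integration.integral_cong refl)
      (auto simp: sum_distrib_left indicator_def table_alloc_in_cell[OF _ _ L] intro!: sum.cong)
  also have "\<dots> = (\<Sum>\<kappa>\<in>cells n L. (table_weight n w \<kappa> j * h \<kappa>) * q \<kappa>)"
    unfolding q_def using Dint by (subst Bochner_Integration.integral_sum) auto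
  finally have 1: "(\<integral>x. ?g x * (\<Sum>\<kappa>\<in>cells n L. indicator (?D \<kappa>) x * h \<kappa>) \<partial>Q)
    = (\<Sum>\<kappa>\<in>cells n L. (table_weight n w \<kappa> j * h \<kappa>) * q \<kappa>)" .
  have "(\<integral>x. f j x * (\<Sum>\<kappa>\<in>cells n L. indicator (?D \<kappa>) x * h \<kappa>) \<partial>Q)
    = (\<integral>x. (\<Sum>\<kappa>\<in>cells n L. h \<kappa> * (f j x * indicator (?D \<kappa>) x)) \<partial>Q)"
    by (intro Bochner_Integration.integral_cong refl)
      (subst sum_distrib_left, intro sum.cong refl, simp only: mult_ac)
  also have "\<dots> = (\<Sum>\<kappa>\<in>cells n L. h \<kappa> * F \<kappa>)"
    unfolding F_def using fint by (subst Bochner_Integration.integral_sum) auto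
  finally have 2: "(\<integral>x. f j x * (\<Sum>\<kappa>\<in>cells n L. indicator (?D \<kappa>) x * h \<kappa>) \<partial>Q)
    = (\<Sum>\<kappa>\<in>cells n L. h \<kappa> * F \<kappa>)" .
  have "\<bar>(\<Sum>\<kappa>\<in>cells n L. (table_weight n w \<kappa> j * h \<kappa>) * q \<kappa>) - (\<Sum>\<kappa>\<in>cells n L. h \<kappa> * F \<kappa>)\<bar>
    = \<bar>\<Sum>\<kappa>\<in>cells n L. h \<kappa> * (table_weight n w \<kappa> j * q \<kappa> - F \<kappa>)\<bar>"
    by (simp add: sum_subtractf[symmetric] algebra_simps)
  also have "\<dots> \<le> (\<Sum>\<kappa>\<in>cells n L. \<bar>h \<kappa> * (table_weight n w \<kappa> j * q \<kappa> - F \<kappa>)\<bar>)" by (rule sum_abs)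
  also have "\<dots> \<le> (\<Sum>\<kappa>\<in>cells n L. B * (\<eta> * q \<kappa>))"
  proof (rule sum_mono)
    fix \<kappa> assume k: "\<kappa> \<in> cells n L"
    show "\<bar>h \<kappa> * (table_weight n w \<kappa> j * q \<kappa> - F \<kappa>)\<bar> \<le> B * (\<eta> * q \<kappa>)"
      using close[OF k] h[OF k] B unfolding abs_mult q_def[symmetric] F_def[symmetric]
      by (intro mult_mono) auto
  qed
  also have "\<dots> = B * \<eta> * (\<Sum>\<kappa>\<in>cells n L. q \<kappa>)" by (simp add: sum_distrib_left mult.assoc)
  also have "\<dots> \<le> B * \<eta> * 1" using qs B e by (intro mult_left_mono) auto
  finally show ?thesis unfolding 1 2 by (simp add: mult.commute)
qed

lemma alloc_cost_eq:
  assumes f: "\<And>j. j \<in> {1..n} \<Longrightarrow> f j \<in> borel_measurable Q"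
    and f0: "\<And>j x. j \<in> {1..n} \<Longrightarrow> x \<in> space Q \<Longrightarrow> 0 \<le> f j x"
    and c: "\<And>j. j \<in> {1..n} \<Longrightarrow> c j \<in> borel_measurable Q" and c0: "\<And>j x. 0 \<le> c j x"
  shows "alloc_cost Q n c f = (\<integral>\<^sup>+x. ennreal (\<Sum>j\<in>{1..n}. f j x * c j x) \<partial>Q)"
proof -
  have "(\<integral>\<^sup>+x. ennreal (\<Sum>j\<in>{1..n}. f j x * c j x) \<partial>Q)
    = (\<integral>\<^sup>+x. (\<Sum>j\<in>{1..n}. ennreal (f j x * c j x)) \<partial>Q)"
    using f0 c0 by (intro nn_integral_cong sum_ennreal[symmetric]) auto
  also have "\<dots> = alloc_cost Q n c f"
    unfolding alloc_cost_def
  proof (rule nn_integral_sum)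
    fix j assume j: "j \<in> {1..n}"
    note [measurable] = f[OF j] c[OF j]
    show "(\<lambda>x. ennreal (f j x * c j x)) \<in> borel_measurable Q" by measurable
  qed
  finally show ?thesis by simp
qed

text \<open>Rounding the costs down accounts for \<open>1 / L\<close>. Testing the table against the
  rounded costs, which are at most \<open>L\<close>, accounts for \<open>\<eta> * L\<close> per
  index. Where some cost reaches \<open>L\<close> nothing is lost, even for costs that are not
  integrable: the cheapest sample point is at least as good as any shares.\<close>

lemma table_alloc_cost_le:
  assumes "prob_space Q" and n: "1 \<le> n" and f: "f \<in> allocs Q n"
    and c: "\<And>j. j \<in> {1..n} \<Longrightarrow> c j \<in> borel_measurable Q" and c0: "\<And>j x. 0 \<le> c j x"
    and L: "1 \<le> L" and w: "w \<in> tables n L" and e: "0 \<le> \<eta>"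
    and close: "\<And>\<kappa> j. \<kappa> \<in> cells n L \<Longrightarrow> j \<in> {1..n} \<Longrightarrow>
      \<bar>table_weight n w \<kappa> j * (\<integral>x. indicator {y. in_cell n c L \<kappa> y} x \<partial>Q)
        - (\<integral>x. f j x * indicator {y. in_cell n c L \<kappa> y} x \<partial>Q)\<bar>
      \<le> \<eta> * (\<integral>x. indicator {y. in_cell n c L \<kappa> y} x \<partial>Q)"
  shows "alloc_cost Q n c (table_alloc n c L w)
    \<le> alloc_cost Q n c f + ennreal (real n * (\<eta> * real L) + 1 / real L)"
proof -
  interpret prob_space Q by fact
  note fD = allocsD[OF f]
  let ?D = "\<lambda>\<kappa>. {y. in_cell n c L \<kappa> y}" and ?g = "table_alloc n c L w"
  let ?N = "\<lambda>x. indicator {y. \<not> costs_below n c L y} x :: real"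
  have Dm[measurable]: "(indicator (?D \<kappa>) :: _ \<Rightarrow> real) \<in> borel_measurable Q" for \<kappa>
    by (rule borel_measurable_indicator_Collect[OF measurable_in_cell[OF c]])
  have Nm: "?N \<in> borel_measurable Q"
    using measurable_costs_below[of n c Q L] c by (intro borel_measurable_indicator_Collect) simp
  \<comment> \<open>the rounded costs\<close>
  define H where "H j x = (\<Sum>\<kappa>\<in>cells n L. indicator (?D \<kappa>) x * (real (\<kappa> j) / real L))" for j x
  have Heq: "H j x = (if costs_below n c L x
      then real ((THE \<kappa>. \<kappa> \<in> cells n L \<and> in_cell n c L \<kappa> x) j) / real L else 0)" for j x
    unfolding H_def by (rule sum_indicator_cells[OF c0 L])
  have Hm: "H j \<in> borel_measurable Q" for j
    unfolding H_def[abs_def] by (intro borel_measurable_sum borel_measurable_times Dm) auto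
  have cellb: "real (\<kappa> j) / real L \<le> real L" if "\<kappa> \<in> cells n L" "j \<in> {1..n}" for \<kappa> j
  proof -
    have "\<kappa> j < L * L" using that by (auto simp: cells_def)
    then have "real (\<kappa> j) \<le> real L * real L" by (metis less_imp_le of_nat_le_iff of_nat_mult)
    then show ?thesis using L by (simp add: divide_le_eq)
  qed
  have H0: "0 \<le> H j x" for j x by (simp add: Heq)
  have HL: "H j x \<le> real L" if "j \<in> {1..n}" for j x
    using cellb[OF the_cell(1)[where c=c, OF c0 L] that] by (simp add: Heq)
  have Hc: "H j x \<le> c j x" "c j x \<le> H j x + 1 / real L" if "costs_below n c L x" "j \<in> {1..n}" for j x
    using the_cell(2)[where c=c, OF c0 L that(1)] that L c0[of j x]
    by (auto simp: Heq in_cell_def divide_le_eq add_divide_distrib[symmetric] le_divide_eq mult.commute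
        intro: less_imp_le)
  have H2: "H j x = 0" if "\<not> costs_below n c L x" for j x using that by (simp add: Heq)
  note gs = table_alloc_simplex[of c w n L, OF c0 w n]
  have g1: "?g j x \<le> 1" if "j \<in> {1..n}" for j x
    using member_le_sum[of j "{1..n}" "\<lambda>j. ?g j x"] gs(1) gs(2)[of x] that by auto
  have gm: "?g j \<in> borel_measurable Q" if "j \<in> {1..n}" for j
    by (rule measurable_table_alloc[OF c that])
  have pt1: "(\<Sum>j\<in>{1..n}. ?g j x * c j x)
      \<le> (\<Sum>j\<in>{1..n}. ?g j x * H j x) + 1 / real L + ?N x * (\<Sum>j\<in>{1..n}. f j x * c j x)"
    if x: "x \<in> space Q" for x
  proof (cases "costs_below n c L x")
    case True
    have "(\<Sum>j\<in>{1..n}. ?g j x * c j x) \<le> (\<Sum>j\<in>{1..n}. ?g j x * (H j x + 1 / real L))"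
      using Hc(2)[OF True] gs(1) by (intro sum_mono mult_left_mono) auto
    also have "\<dots> = (\<Sum>j\<in>{1..n}. ?g j x * H j x) + (\<Sum>j\<in>{1..n}. ?g j x) * (1 / real L)"
      unfolding distrib_left sum.distrib sum_distrib_right ..
    finally show ?thesis using True gs(2)[of x] by simp
  next
    case False
    obtain k where k: "k \<in> {1..n}" "\<And>i. i \<in> {1..n} \<Longrightarrow> first_minimum n c i x \<longleftrightarrow> i = k"
      using first_minimum_ex1[OF n, of c x] by blast
    have ck: "c k x \<le> c j x" if "j \<in> {1..n}" for j
      using k(2)[OF k(1)] that by (auto simp: first_minimum_def)
    have "(\<Sum>j\<in>{1..n}. ?g j x * c j x) = (\<Sum>j\<in>{1..n}. if j = k then c k x else 0)"
      using False k(2) by (intro sum.cong refl) (simp add: table_alloc_def indicator_def)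
    also have "\<dots> = (\<Sum>j\<in>{1..n}. f j x) * c k x" using k(1) fD(3)[OF x] by simp
    also have "\<dots> \<le> (\<Sum>j\<in>{1..n}. f j x * c j x)"
      unfolding sum_distrib_right using ck fD(2)[OF _ x] by (intro sum_mono mult_left_mono) auto
    finally show ?thesis using False H2[OF False] by (simp add: add_increasing)
  qed
  have pt2: "(\<Sum>j\<in>{1..n}. f j x * H j x) + ?N x * (\<Sum>j\<in>{1..n}. f j x * c j x) \<le> (\<Sum>j\<in>{1..n}. f j x * c j x)"
    if x: "x \<in> space Q" for x
  proof (cases "costs_below n c L x")
    case True
    then show ?thesis using Hc(1)[OF True] fD(2)[OF _ x] by (auto intro!: sum_mono mult_left_mono)
  next
    case False
    then show ?thesis using H2[OF False] by simp
  qed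
  have gHi: "integrable Q (\<lambda>x. ?g j x * H j x)" if "j \<in> {1..n}" for j
    using gm[OF that] Hm gs(1) g1[OF that] H0 HL[OF that]
    by (intro integrable_times_unit[where B=1 and C="real L"]) auto
  have fHi: "integrable Q (\<lambda>x. f j x * H j x)" if "j \<in> {1..n}" for j
    using fD(1,2,4)[OF that] Hm H0 HL[OF that]
    by (intro integrable_times_unit[where B=1 and C="real L"]) auto
  have FHi: "integrable Q (\<lambda>x. \<Sum>j\<in>{1..n}. f j x * H j x)"
    using fHi by (intro Bochner_Integration.integrable_sum)
  have GHi: "integrable Q (\<lambda>x. \<Sum>j\<in>{1..n}. ?g j x * H j x)"
    using gHi by (intro Bochner_Integration.integrable_sum)
  have GHF: "(\<integral>x. (\<Sum>j\<in>{1..n}. ?g j x * H j x) \<partial>Q)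
    \<le> (\<integral>x. (\<Sum>j\<in>{1..n}. f j x * H j x) \<partial>Q) + real n * (\<eta> * real L)"
  proof -
    have "(\<integral>x. ?g j x * H j x \<partial>Q) \<le> (\<integral>x. f j x * H j x \<partial>Q) + \<eta> * real L" if j: "j \<in> {1..n}" for j
      using table_alloc_integral_close[OF assms(1) n f c c0 L w e close[OF _ j] j,
          of "\<lambda>\<kappa>. real (\<kappa> j) / real L" "real L"] cellb[OF _ j]
      unfolding H_def[symmetric] by auto
    then have "(\<Sum>j\<in>{1..n}. \<integral>x. ?g j x * H j x \<partial>Q) \<le> (\<Sum>j\<in>{1..n}. (\<integral>x. f j x * H j x \<partial>Q) + \<eta> * real L)"
      by (rule sum_mono)
    also have "\<dots> = (\<Sum>j\<in>{1..n}. \<integral>x. f j x * H j x \<partial>Q) + real n * (\<eta> * real L)"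
      by (simp add: sum.distrib)
    finally show ?thesis using gHi fHi by (simp add: Bochner_Integration.integral_sum)
  qed
  \<comment> \<open>This part of the cost of \<open>f\<close> may be infinite, so it is carried
    along as a nonnegative integral; only the bounded rounded costs are compared by real
    integrals.\<close>
  define X where "X = (\<integral>\<^sup>+x. ennreal (?N x * (\<Sum>j\<in>{1..n}. f j x * c j x)) \<partial>Q)"
  have sm: "(\<lambda>x. \<Sum>j\<in>{1..n}. f j x * c j x) \<in> borel_measurable Q"
    using fD(1) c by (intro borel_measurable_sum borel_measurable_times) auto
  have Xm[measurable]: "(\<lambda>x. ennreal (?N x * (\<Sum>j\<in>{1..n}. f j x * c j x))) \<in> borel_measurable Q"
    using borel_measurable_times[OF Nm sm] by measurable
  have s0: "0 \<le> (\<Sum>j\<in>{1..n}. f j x * c j x)" if "x \<in> space Q" for x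
    using fD(2)[OF _ that] c0 by (intro sum_nonneg mult_nonneg_nonneg) auto
  have gH0: "0 \<le> (\<Sum>j\<in>{1..n}. ?g j x * H j x)" for x
    using gs(1) H0 by (intro sum_nonneg mult_nonneg_nonneg) auto
  have fH0: "0 \<le> (\<Sum>j\<in>{1..n}. f j x * H j x)" if "x \<in> space Q" for x
    using fD(2)[OF _ that] H0 by (intro sum_nonneg mult_nonneg_nonneg) auto
  define R where "R = real n * (\<eta> * real L) + 1 / real L"
  have R0: "0 \<le> R" using e by (simp add: R_def)
  have "alloc_cost Q n c ?g = (\<integral>\<^sup>+x. ennreal (\<Sum>j\<in>{1..n}. ?g j x * c j x) \<partial>Q)"
    using gm gs(1) c c0 by (intro alloc_cost_eq) auto
  also have "\<dots> \<le> (\<integral>\<^sup>+x. ennreal ((\<Sum>j\<in>{1..n}. ?g j x * H j x) + 1 / real L)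
      + ennreal (?N x * (\<Sum>j\<in>{1..n}. f j x * c j x)) \<partial>Q)"
  proof (rule nn_integral_mono)
    fix x assume x: "x \<in> space Q"
    show "ennreal (\<Sum>j\<in>{1..n}. ?g j x * c j x) \<le> ennreal ((\<Sum>j\<in>{1..n}. ?g j x * H j x) + 1 / real L)
      + ennreal (?N x * (\<Sum>j\<in>{1..n}. f j x * c j x))"
      using ennreal_leI[OF pt1[OF x]] gH0[of x] s0[OF x]
      by (subst (asm) ennreal_plus) (auto intro: add_nonneg_nonneg)
  qed
  also have "\<dots> = (\<integral>\<^sup>+x. ennreal ((\<Sum>j\<in>{1..n}. ?g j x * H j x) + 1 / real L) \<partial>Q) + X"
    unfolding X_def
    by (intro nn_integral_add Xm measurable_compose[OF _ measurable_ennreal] borel_measurable_add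
        borel_measurable_integrable[OF GHi] borel_measurable_const)
  also have "(\<integral>\<^sup>+x. ennreal ((\<Sum>j\<in>{1..n}. ?g j x * H j x) + 1 / real L) \<partial>Q)
    = ennreal ((\<integral>x. (\<Sum>j\<in>{1..n}. ?g j x * H j x) \<partial>Q) + 1 / real L)"
    using GHi gH0 by (subst nn_integral_eq_integral) (auto simp: prob_space)
  also have "\<dots> \<le> ennreal ((\<integral>x. (\<Sum>j\<in>{1..n}. f j x * H j x) \<partial>Q) + R)"
    using GHF by (intro ennreal_leI) (simp add: R_def)
  also have "\<dots> = ennreal (\<integral>x. (\<Sum>j\<in>{1..n}. f j x * H j x) \<partial>Q) + ennreal R"
    using R0 fH0 by (intro ennreal_plus Bochner_Integration.integral_nonneg_AE AE_I2)
  also have "ennreal (\<integral>x. (\<Sum>j\<in>{1..n}. f j x * H j x) \<partial>Q) = (\<integral>\<^sup>+x. ennreal (\<Sum>j\<in>{1..n}. f j x * H j x) \<partial>Q)"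
    using FHi fH0 by (intro nn_integral_eq_integral[symmetric] AE_I2)
  also have "(\<integral>\<^sup>+x. ennreal (\<Sum>j\<in>{1..n}. f j x * H j x) \<partial>Q) + ennreal R + X
    = (\<integral>\<^sup>+x. ennreal (\<Sum>j\<in>{1..n}. f j x * H j x)
        + ennreal (?N x * (\<Sum>j\<in>{1..n}. f j x * c j x)) \<partial>Q) + ennreal R"
    unfolding X_def
    by (subst nn_integral_add[OF measurable_compose[OF borel_measurable_integrable[OF FHi] measurable_ennreal] Xm])
      (simp only: add_ac)
  also have "(\<integral>\<^sup>+x. ennreal (\<Sum>j\<in>{1..n}. f j x * H j x)
        + ennreal (?N x * (\<Sum>j\<in>{1..n}. f j x * c j x)) \<partial>Q)
    \<le> (\<integral>\<^sup>+x. ennreal (\<Sum>j\<in>{1..n}. f j x * c j x) \<partial>Q)"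
  proof (rule nn_integral_mono)
    fix x assume x: "x \<in> space Q"
    show "ennreal (\<Sum>j\<in>{1..n}. f j x * H j x) + ennreal (?N x * (\<Sum>j\<in>{1..n}. f j x * c j x))
      \<le> ennreal (\<Sum>j\<in>{1..n}. f j x * c j x)"
      using ennreal_leI[OF pt2[OF x]] fH0[OF x] s0[OF x] by (subst (asm) ennreal_plus) auto
  qed
  also have "(\<integral>\<^sup>+x. ennreal (\<Sum>j\<in>{1..n}. f j x * c j x) \<partial>Q) = alloc_cost Q n c f"
    using fD(1,2) c c0 by (intro alloc_cost_eq[symmetric]) auto
  finally show ?thesis by (simp add: R_def add_right_mono)
qed

section \<open>The cost as an infimum over a countable family\<close>

text \<open>The hypotheses of semidiscrete_cost_le_repair on the marginals of \<open>g\<close>.\<close>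

definition repairable ::
  "'a measure \<Rightarrow> nat \<Rightarrow> (nat \<Rightarrow> 'a \<Rightarrow> real) \<Rightarrow> nat \<Rightarrow> real \<Rightarrow> (nat \<Rightarrow> 'a \<Rightarrow> real) \<Rightarrow> bool" where
  "repairable Q n c M \<theta> g \<longleftrightarrow> (\<forall>j\<in>{1..n}.
     0 < (\<integral>x. g j x * indicator {y. costs_below n c M y} x \<partial>Q) \<and>
     \<bar>1 / real n - (\<integral>x. g j x \<partial>Q)\<bar> \<le> \<theta> * (\<integral>x. g j x * indicator {y. costs_below n c M y} x \<partial>Q))"

lemma tendsto_integral_costs_below:
  fixes f :: "'a \<Rightarrow> real"
  assumes c: "\<And>j. j \<in> {1..n} \<Longrightarrow> c j \<in> borel_measurable Q" and f: "integrable Q f"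
  shows "(\<lambda>L. \<integral>x. f x * indicator {y. costs_below n c L y} x \<partial>Q) \<longlonglongrightarrow> (\<integral>x. f x \<partial>Q)"
proof (rule integral_dominated_convergence[where w="\<lambda>x. norm (f x)"])
  show "f \<in> borel_measurable Q" "integrable Q (\<lambda>x. norm (f x))" using f by auto
  show "(\<lambda>x. f x * indicator {y. costs_below n c L y} x) \<in> borel_measurable Q" for L
    using f measurable_costs_below[of n c Q L] c
    by (intro borel_measurable_times borel_measurable_indicator_Collect) auto
  show "AE x in Q. norm (f x * indicator {y. costs_below n c L y} x) \<le> norm (f x)" for L
    by (auto simp: indicator_def)
  show "AE x in Q. (\<lambda>L. f x * indicator {y. costs_below n c L y} x) \<longlonglongrightarrow> f x"
  proof (rule AE_I2)
    fix x
    have "\<forall>\<^sub>F L in sequentially. c j x < real L" for j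
      using eventually_ge_at_top[of "nat \<lceil>c j x\<rceil> + 1"] by eventually_elim linarith
    then have "\<forall>\<^sub>F L in sequentially. costs_below n c L x"
      unfolding costs_below_def by (intro eventually_ball_finite) auto
    then have "\<forall>\<^sub>F L in sequentially. f x * indicator {y. costs_below n c L y} x = f x"
      by eventually_elim simp
    then show "(\<lambda>L. f x * indicator {y. costs_below n c L y} x) \<longlonglongrightarrow> f x"
      by (rule tendsto_eventually)
  qed
qed

text \<open>The order of the choices matters. First \<open>M\<close> is fixed so that every share of
  \<open>f\<close> keeps most of its mass where the costs are below \<open>M\<close>; then
  \<open>\<theta> = 1 / Suc i\<close> so that the repair costs at most \<open>e / 2\<close>; then
  \<open>L\<close> so large that the mass beyond the grid is small compared with
  \<open>\<theta>\<close>; and last \<open>\<eta>\<close>, which must beat both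
  \<open>\<theta>\<close> and \<open>L\<close>.\<close>

lemma semidiscrete_cost_approx_table:
  assumes "prob_space Q" and n: "1 \<le> n" and f: "f \<in> allocs Q n"
    and c: "\<And>j. j \<in> {1..n} \<Longrightarrow> c j \<in> borel_measurable Q" and c0: "\<And>j x. 0 \<le> c j x"
    and e: "0 < e"
  shows "\<exists>M i L. \<exists>w\<in>tables n L. repairable Q n c M (1 / real (Suc i)) (table_alloc n c L w) \<and>
    alloc_cost Q n c (table_alloc n c L w) + ennreal (1 / real (Suc i) * real M)
      \<le> alloc_cost Q n c f + ennreal e"
proof -
  interpret prob_space Q by fact
  note fD = allocsD[OF f]
  let ?I = "\<lambda>M x. indicator {y. costs_below n c M y} x :: real"
  have Im: "?I M \<in> borel_measurable Q" for M
    using measurable_costs_below[of n c Q M] c by (intro borel_measurable_indicator_Collect) simp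
  have fint: "integrable Q (f j)" if "j \<in> {1..n}" for j
    using fD(1,2,4)[OF that] by (intro integrable_const_bound[where B=1]) auto
  \<comment> \<open>The limit is \<open>1 / n\<close>. Asking for three quarters of it leaves room
    for an error \<open>\<eta>\<close> of at most \<open>1 / (4 * n)\<close>, after which more than
    \<open>1 / (2 * n)\<close> remains for the table.\<close>
  have "\<forall>\<^sub>F M in sequentially. 3 / (4 * real n) < (\<integral>x. f j x * ?I M x \<partial>Q)" if j: "j \<in> {1..n}" for j
  proof -
    have "(\<lambda>M. \<integral>x. f j x * ?I M x \<partial>Q) \<longlonglongrightarrow> 1 / real n"
      using tendsto_integral_costs_below[OF c fint[OF j]] fD(5)[OF j] by simp
    then show ?thesis using n by (intro order_tendstoD(1)[of _ "1 / real n"]) (auto simp: field_simps)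
  qed
  then have "\<forall>\<^sub>F M in sequentially. \<forall>j\<in>{1..n}. 3 / (4 * real n) < (\<integral>x. f j x * ?I M x \<partial>Q)"
    by (intro eventually_ball_finite) auto
  then obtain M where M: "\<And>j. j \<in> {1..n} \<Longrightarrow> 3 / (4 * real n) < (\<integral>x. f j x * ?I M x \<partial>Q)"
    unfolding eventually_sequentially by blast
  obtain i :: nat where i: "2 * real M / e < real (Suc i)"
    using reals_Archimedean2[of "2 * real M / e"] by (metis less_Suc_eq of_nat_less_iff less_trans)
  define \<theta> where "\<theta> = 1 / real (Suc i)"
  have th: "0 < \<theta>" "\<theta> \<le> 1" by (auto simp: \<theta>_def)
  have thM: "\<theta> * real M \<le> e / 2"
    using i e unfolding \<theta>_def by (simp add: field_simps)
  have "(\<lambda>L. \<integral>x. 1 * ?I L x \<partial>Q) \<longlonglongrightarrow> (\<integral>x. 1 \<partial>Q)"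
    by (rule tendsto_integral_costs_below[OF c]) auto
  then have "(\<lambda>L. \<integral>x. ?I L x \<partial>Q) \<longlonglongrightarrow> 1" by (simp add: prob_space)
  then have ev1: "\<forall>\<^sub>F L in sequentially. 1 - \<theta> / (4 * real n) < (\<integral>x. ?I L x \<partial>Q)"
    using th n by (intro order_tendstoD(1)[of _ 1]) auto
  have ev2: "\<forall>\<^sub>F L in sequentially. 4 / e < real L"
    using eventually_ge_at_top[of "nat \<lceil>4 / e\<rceil> + 1"] by eventually_elim linarith
  have "\<forall>\<^sub>F L in sequentially. 1 - \<theta> / (4 * real n) < (\<integral>x. ?I L x \<partial>Q) \<and> 4 / e < real L \<and> M \<le> L \<and> 1 \<le> L"
    using ev1 ev2 eventually_ge_at_top[of M] eventually_ge_at_top[of 1] by eventually_elim auto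
  then obtain L where rho: "1 - \<theta> / (4 * real n) < (\<integral>x. ?I L x \<partial>Q)" and Le: "4 / e < real L"
    and MleL: "M \<le> L" and L: "1 \<le> L"
    unfolding eventually_sequentially by blast
  \<comment> \<open>The first entry controls the marginals; the second makes the cost error
    \<open>n * \<eta> * L\<close> at most \<open>e / 4\<close>.\<close>
  define \<eta> where "\<eta> = min (\<theta> / (4 * real n)) (e / (4 * real n * real L))"
  have eta: "0 < \<eta>" using th n e L by (simp add: \<eta>_def)
  have eta1: "\<eta> \<le> \<theta> / (4 * real n)" by (simp add: \<eta>_def)
  have eta2: "real n * (\<eta> * real L) \<le> e / 4"
  proof -
    have "\<eta> \<le> e / (4 * real n * real L)" by (simp add: \<eta>_def)
    then have "\<eta> * (4 * real n * real L) \<le> e" using n L by (subst (asm) pos_le_divide_eq) auto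
    then show ?thesis by (simp add: mult_ac)
  qed
  obtain w where w: "w \<in> tables n L" and close: "\<And>\<kappa> j. \<kappa> \<in> cells n L \<Longrightarrow> j \<in> {1..n} \<Longrightarrow>
      \<bar>table_weight n w \<kappa> j * (\<integral>x. indicator {y. in_cell n c L \<kappa> y} x \<partial>Q)
        - (\<integral>x. f j x * indicator {y. in_cell n c L \<kappa> y} x \<partial>Q)\<bar>
      \<le> \<eta> * (\<integral>x. indicator {y. in_cell n c L \<kappa> y} x \<partial>Q)"
    using ex_table[where L=L and c=c, OF assms(1) n f eta c] by blast
  let ?g = "table_alloc n c L w"
  note gs = table_alloc_simplex[of c w n L, OF c0 w n]
  have g1: "?g j x \<le> 1" if "j \<in> {1..n}" for j x
    using member_le_sum[of j "{1..n}" "\<lambda>j. ?g j x"] gs(1) gs(2)[of x] that by auto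
  have gm: "?g j \<in> borel_measurable Q" if "j \<in> {1..n}" for j
    by (rule measurable_table_alloc[OF c that])
  have below: "\<bar>(\<integral>x. ?g j x * ?I m x \<partial>Q) - (\<integral>x. f j x * ?I m x \<partial>Q)\<bar> \<le> \<eta>"
    if j: "j \<in> {1..n}" and m: "m \<le> L" for j m
  proof -
    \<comment> \<open>For \<open>m \<le> L\<close> the condition is decided by the cell, so its
      indicator is a step function to which \<open>table_alloc_integral_close\<close>
      applies.\<close>
    have eq: "(\<Sum>\<kappa>\<in>cells n L. indicator {y. in_cell n c L \<kappa> y} x * of_bool (\<forall>i\<in>{1..n}. \<kappa> i < L * m)) = ?I m x" for x
    proof -
      have mono: "costs_below n c m x \<Longrightarrow> costs_below n c L x"
        using m unfolding costs_below_def by (meson less_le_trans of_nat_le_iff)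
      have "(\<Sum>\<kappa>\<in>cells n L. indicator {y. in_cell n c L \<kappa> y} x * of_bool (\<forall>i\<in>{1..n}. \<kappa> i < L * m))
        = (if costs_below n c L x then of_bool (\<forall>i\<in>{1..n}.
            (THE \<kappa>. \<kappa> \<in> cells n L \<and> in_cell n c L \<kappa> x) i < L * m) else (0::real))"
        by (rule sum_indicator_cells[OF c0 L])
      also have "\<dots> = ?I m x"
        using in_cell_costs_below_iff[OF the_cell(2)[where c=c, OF c0 L] L, of n x m] mono
        by (auto simp: indicator_def)
      finally show ?thesis .
    qed
    show ?thesis
      using table_alloc_integral_close[where c=c and h="\<lambda>\<kappa>. of_bool (\<forall>i\<in>{1..n}. \<kappa> i < L * m)" and B=1,
          OF assms(1) n f c c0 L w less_imp_le[OF eta] close[OF _ j] j]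
      unfolding eq by simp
  qed
  have rest: "\<bar>(\<integral>x. h x \<partial>Q) - (\<integral>x. h x * ?I L x \<partial>Q)\<bar> \<le> \<theta> / (4 * real n)
      \<and> (\<integral>x. h x * ?I L x \<partial>Q) \<le> (\<integral>x. h x \<partial>Q)"
    if h: "h \<in> borel_measurable Q" "\<And>x. x \<in> space Q \<Longrightarrow> 0 \<le> h x \<and> h x \<le> 1" for h
  proof -
    have hi: "integrable Q h" using h by (intro integrable_const_bound[where B=1]) auto
    have hIi: "integrable Q (\<lambda>x. h x * ?I L x)"
      using h by (intro integrable_times_unit[where B=1 and C=1] Im) (auto simp: indicator_def)
    have Ii: "integrable Q (?I L)" using Im by (intro integrable_const_bound[where B=1]) (auto simp: indicator_def)
    have "(\<integral>x. h x \<partial>Q) - (\<integral>x. h x * ?I L x \<partial>Q) = (\<integral>x. h x - h x * ?I L x \<partial>Q)"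
      using hi hIi by simp
    also have "\<dots> \<le> (\<integral>x. 1 - ?I L x \<partial>Q)"
      using h(2) hi hIi Ii by (intro integral_mono Bochner_Integration.integrable_diff) (auto simp: indicator_def)
    also have "\<dots> = 1 - (\<integral>x. ?I L x \<partial>Q)"
      using Ii by (subst Bochner_Integration.integral_diff) (auto simp: prob_space)
    also have "\<dots> \<le> \<theta> / (4 * real n)" using rho by simp
    finally have u: "(\<integral>x. h x \<partial>Q) - (\<integral>x. h x * ?I L x \<partial>Q) \<le> \<theta> / (4 * real n)" .
    have "(\<integral>x. h x * ?I L x \<partial>Q) \<le> (\<integral>x. h x \<partial>Q)"
      using h(2) hi hIi by (intro integral_mono) (auto simp: indicator_def)
    then show ?thesis using u by simp
  qed
  have "repairable Q n c M \<theta> ?g"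
    unfolding repairable_def
  proof (intro ballI conjI)
    fix j assume j: "j \<in> {1..n}"
    have "\<theta> / (4 * real n) \<le> 1 / (4 * real n)" using th n by (simp add: divide_right_mono)
    then have "3 / (4 * real n) - 1 / (4 * real n) < (\<integral>x. ?g j x * ?I M x \<partial>Q)"
      using M[OF j] below[OF j MleL] eta1 by linarith
    moreover have "3 / (4 * real n) - 1 / (4 * real n) = 1 / (2 * real n)" using n by (simp add: field_simps)
    ultimately have wj: "1 / (2 * real n) < (\<integral>x. ?g j x * ?I M x \<partial>Q)" by simp
    moreover have "0 < 1 / (2 * real n)" using n by simp
    ultimately show "0 < (\<integral>x. ?g j x * ?I M x \<partial>Q)" by linarith
    have r1: "\<bar>(\<integral>x. ?g j x \<partial>Q) - (\<integral>x. ?g j x * ?I L x \<partial>Q)\<bar> \<le> \<theta> / (4 * real n)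
      \<and> (\<integral>x. ?g j x * ?I L x \<partial>Q) \<le> (\<integral>x. ?g j x \<partial>Q)"
      using gs(1) g1[OF j] by (intro rest gm[OF j]) auto
    have r2: "\<bar>1 / real n - (\<integral>x. f j x * ?I L x \<partial>Q)\<bar> \<le> \<theta> / (4 * real n)
      \<and> (\<integral>x. f j x * ?I L x \<partial>Q) \<le> 1 / real n"
      using rest[OF fD(1)[OF j]] fD(2,4)[OF j] unfolding fD(5)[OF j] by blast
    \<comment> \<open>Three errors of size at most \<open>\<theta> / (4 * n)\<close> occur, but the
      two from cutting off at \<open>L\<close> enter with opposite signs, so that only two can
      accumulate.\<close>
    have "\<bar>1 / real n - (\<integral>x. ?g j x \<partial>Q)\<bar> \<le> 2 * (\<theta> / (4 * real n))"
      using below[OF j order_refl] r1 r2 eta1 by linarith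
    also have "\<dots> = \<theta> * (1 / (2 * real n))" by simp
    also have "\<dots> \<le> \<theta> * (\<integral>x. ?g j x * ?I M x \<partial>Q)" using wj th by (intro mult_left_mono) auto
    finally show "\<bar>1 / real n - (\<integral>x. ?g j x \<partial>Q)\<bar> \<le> \<theta> * (\<integral>x. ?g j x * ?I M x \<partial>Q)" .
  qed
  moreover have "alloc_cost Q n c ?g + ennreal (\<theta> * real M) \<le> alloc_cost Q n c f + ennreal e"
  proof -
    have "1 / real L \<le> e / 4" using Le L e by (simp add: field_simps)
    then have b: "real n * (\<eta> * real L) + 1 / real L \<le> e / 2" using eta2 by simp
    have "alloc_cost Q n c ?g + ennreal (\<theta> * real M)
      \<le> (alloc_cost Q n c f + ennreal (real n * (\<eta> * real L) + 1 / real L)) + ennreal (\<theta> * real M)"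
      by (intro add_right_mono table_alloc_cost_le[OF assms(1) n f c c0 L w less_imp_le[OF eta] close])
    also have "\<dots> \<le> (alloc_cost Q n c f + ennreal (e / 2)) + ennreal (e / 2)"
      using b thM by (intro add_mono add_left_mono ennreal_leI order_refl)
    also have "\<dots> = alloc_cost Q n c f + ennreal e"
      using e by (simp add: add.assoc flip: ennreal_plus)
    finally show ?thesis .
  qed
  ultimately show ?thesis using w unfolding \<theta>_def by blast
qed

text \<open>Tables that cannot be repaired are given the value infinity instead of being removed, so
  the index set is countable and depends neither on \<open>Q\<close> nor on the costs. The value of
  a repairable table bounds the cost from above because it includes the price of the repair; the
  approximation lemma shows that these values come arbitrarily close.\<close>

lemma semidiscrete_cost_eq_INF_tables:
  assumes "prob_space Q" and n: "1 \<le> n"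
    and c: "\<And>j. j \<in> {1..n} \<Longrightarrow> c j \<in> borel_measurable Q" and c0: "\<And>j x. 0 \<le> c j x"
  shows "semidiscrete_cost Q n c = (INF M. INF i. INF L. INF w\<in>tables n L.
    if repairable Q n c M (1 / real (Suc i)) (table_alloc n c L w)
    then alloc_cost Q n c (table_alloc n c L w) + ennreal (1 / real (Suc i) * real M) else \<infinity>)"
    (is "_ = (INF M. INF i. INF L. INF w\<in>tables n L. ?v M i L w)")
proof (rule antisym)
  have "semidiscrete_cost Q n c \<le> ?v M i L w" if w: "w \<in> tables n L" for M i L w
  proof (cases "repairable Q n c M (1 / real (Suc i)) (table_alloc n c L w)")
    case True
    let ?g = "table_alloc n c L w"
    define R where "R = {x \<in> space Q. \<forall>j\<in>{1..n}. c j x < real M}"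
    note gs = table_alloc_simplex[of c w n L, OF c0 w n]
    have eq: "(\<integral>x. ?g j x * indicator {y. costs_below n c M y} x \<partial>Q) = (\<integral>x. ?g j x * indicator R x \<partial>Q)" for j
      by (intro Bochner_Integration.integral_cong refl) (auto simp: R_def costs_below_def indicator_def)
    have "semidiscrete_cost Q n c \<le> alloc_cost Q n c ?g + ennreal (1 / real (Suc i) * real M)"
      using True unfolding repairable_def eq
      by (intro semidiscrete_cost_le_repair[where R=R] assms(1) n c c0 gs measurable_table_alloc R_def) auto
    then show ?thesis using True by simp
  qed simp
  then show "semidiscrete_cost Q n c \<le> (INF M. INF i. INF L. INF w\<in>tables n L. ?v M i L w)"
    by (intro INF_greatest)
  show "(INF M. INF i. INF L. INF w\<in>tables n L. ?v M i L w) \<le> semidiscrete_cost Q n c"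
    unfolding semidiscrete_cost_def
  proof (rule INF_greatest)
    fix f assume f: "f \<in> allocs Q n"
    show "(INF M. INF i. INF L. INF w\<in>tables n L. ?v M i L w) \<le> alloc_cost Q n c f"
    proof (rule ennreal_le_epsilon)
      fix e :: real assume e: "0 < e"
      obtain M i L w where w: "w \<in> tables n L"
        and r: "repairable Q n c M (1 / real (Suc i)) (table_alloc n c L w)"
        and le: "alloc_cost Q n c (table_alloc n c L w) + ennreal (1 / real (Suc i) * real M)
          \<le> alloc_cost Q n c f + ennreal e"
        using semidiscrete_cost_approx_table[where c=c, OF assms(1) n f c c0 e] by blast
      have "(INF M. INF i. INF L. INF w\<in>tables n L. ?v M i L w) \<le> ?v M i L w"
        by (rule INF_lower2[OF UNIV_I], rule INF_lower2[OF UNIV_I], rule INF_lower2[OF UNIV_I],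
            rule INF_lower[OF w])
      also have "\<dots> \<le> alloc_cost Q n c f + ennreal e" using r le by simp
      finally show "(INF M. INF i. INF L. INF w\<in>tables n L. ?v M i L w) \<le> alloc_cost Q n c f + ennreal e" .
    qed
  qed
qed

section \<open>Joint measurability\<close>

text \<open>Shares computed from the costs at a fixed parameter are sections of the shares computed
  from the joint costs, so that measurability can be established once on the product.\<close>

lemma table_alloc_apply:
  "table_alloc n (\<lambda>j x. c j (s, x)) L w j x = table_alloc n c L w j (s, x)"
  by (simp add: table_alloc_def costs_below_def in_cell_def first_minimum_def indicator_def)

lemma costs_below_apply:
  "costs_below n (\<lambda>j x. c j (s, x)) L x \<longleftrightarrow> costs_below n c L (s, x)"
  by (simp add: costs_below_def)

text \<open>For a fixed table, the marginals and the cost are integrals of jointly measurable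
  functions against the kernel \<open>K\<close>, hence measurable in the parameter. The test for
  repairability is then a measurable condition, and a countable infimum preserves
  measurability.\<close>

lemma measurable_semidiscrete_cost:
  fixes c :: "nat \<Rightarrow> 's \<times> 'a \<Rightarrow> real"
  assumes K: "K \<in> \<Omega> \<rightarrow>\<^sub>M prob_algebra S" and n: "1 \<le> n"
    and c: "\<And>j. j \<in> {1..n} \<Longrightarrow> c j \<in> borel_measurable (\<Omega> \<Otimes>\<^sub>M S)"
    and c0: "\<And>j y. 0 \<le> c j y"
  shows "(\<lambda>\<omega>. semidiscrete_cost (K \<omega>) n (\<lambda>j x. c j (\<omega>, x))) \<in> borel_measurable \<Omega>"
proof -
  have Ks: "K \<in> \<Omega> \<rightarrow>\<^sub>M subprob_algebra S" by (rule measurable_prob_algebraD[OF K])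
  have KS: "sets (K \<omega>) = sets S" "prob_space (K \<omega>)" if "\<omega> \<in> space \<Omega>" for \<omega>
    using measurable_space[OF K that] by (auto simp: space_prob_algebra)
  have sec: "(\<lambda>x. h (\<omega>, x)) \<in> borel_measurable (K \<omega>)"
    if "h \<in> borel_measurable (\<Omega> \<Otimes>\<^sub>M S)" "\<omega> \<in> space \<Omega>" for h :: "'s \<times> 'a \<Rightarrow> real" and \<omega>
    using measurable_compose[OF measurable_Pair1'[OF that(2)] that(1)]
    by (simp add: measurable_cong_sets[OF KS(1)[OF that(2)] refl])
  have nn: "(\<lambda>\<omega>. \<integral>\<^sup>+x. ennreal (h (\<omega>, x)) \<partial>K \<omega>) \<in> borel_measurable \<Omega>"
    if [measurable]: "h \<in> borel_measurable (\<Omega> \<Otimes>\<^sub>M S)" for h :: "'s \<times> 'a \<Rightarrow> real"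
    by (rule nn_integral_measurable_subprob_algebra2[OF _ Ks]) measurable
  have int: "(\<lambda>\<omega>. \<integral>x. h (\<omega>, x) \<partial>K \<omega>) \<in> borel_measurable \<Omega>"
    if h: "h \<in> borel_measurable (\<Omega> \<Otimes>\<^sub>M S)" "\<And>y. 0 \<le> h y" for h :: "'s \<times> 'a \<Rightarrow> real"
  proof -
    have "(\<lambda>\<omega>. \<integral>x. h (\<omega>, x) \<partial>K \<omega>) \<in> borel_measurable \<Omega> \<longleftrightarrow>
        (\<lambda>\<omega>. enn2real (\<integral>\<^sup>+x. ennreal (h (\<omega>, x)) \<partial>K \<omega>)) \<in> borel_measurable \<Omega>"
      by (rule measurable_cong, rule integral_eq_nn_integral[OF sec[OF h(1)]]) (auto intro: h(2))
    then show ?thesis using nn[OF h(1)] by simp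
  qed
  have meas: "(\<lambda>\<omega>. if repairable (K \<omega>) n (\<lambda>j x. c j (\<omega>, x)) M (1 / real (Suc i)) (table_alloc n (\<lambda>j x. c j (\<omega>, x)) L w)
      then alloc_cost (K \<omega>) n (\<lambda>j x. c j (\<omega>, x)) (table_alloc n (\<lambda>j x. c j (\<omega>, x)) L w)
        + ennreal (1 / real (Suc i) * real M) else \<infinity>) \<in> borel_measurable \<Omega>"
    if w: "w \<in> tables n L" for M i L w
  proof -
    let ?g = "table_alloc n c L w"
    have gm: "?g j \<in> borel_measurable (\<Omega> \<Otimes>\<^sub>M S)" if "j \<in> {1..n}" for j
      by (rule measurable_table_alloc[OF c that])
    have g0: "0 \<le> ?g j y" for j y by (rule table_alloc_simplex(1)[OF c0 w n])
    have Im: "(indicator {y. costs_below n c M y} :: _ \<Rightarrow> real) \<in> borel_measurable (\<Omega> \<Otimes>\<^sub>M S)"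
      by (rule borel_measurable_indicator_Collect[OF measurable_costs_below[OF c]])
    have i1: "(\<lambda>\<omega>. \<integral>x. ?g j (\<omega>, x) \<partial>K \<omega>) \<in> borel_measurable \<Omega>" if "j \<in> {1..n}" for j
      by (rule int[OF gm[OF that] g0])
    have i2: "(\<lambda>\<omega>. \<integral>x. ?g j (\<omega>, x) * indicator {y. costs_below n c M y} (\<omega>, x) \<partial>K \<omega>) \<in> borel_measurable \<Omega>"
      if "j \<in> {1..n}" for j
      using g0 by (intro int[of "\<lambda>y. ?g j y * indicator {y. costs_below n c M y} y"]
          borel_measurable_times gm[OF that] Im) auto
    have eq: "indicator {y. costs_below n (\<lambda>j x. c j (\<omega>, x)) M y} x
      = (indicator {y. costs_below n c M y} (\<omega>, x) :: real)" for \<omega> x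
      by (simp add: indicator_def costs_below_apply)
    have "Measurable.pred \<Omega> (\<lambda>\<omega>. repairable (K \<omega>) n (\<lambda>j x. c j (\<omega>, x)) M (1 / real (Suc i))
        (table_alloc n (\<lambda>j x. c j (\<omega>, x)) L w))"
      unfolding repairable_def table_alloc_apply eq
    proof (rule pred_intros_finite(3)[OF finite_atLeastAtMost])
      fix j assume j: "j \<in> {1..n}"
      note [measurable] = i1[OF j] i2[OF j]
      show "Measurable.pred \<Omega> (\<lambda>\<omega>.
          0 < (\<integral>x. ?g j (\<omega>, x) * indicator {y. costs_below n c M y} (\<omega>, x) \<partial>K \<omega>) \<and>
          \<bar>1 / real n - (\<integral>x. ?g j (\<omega>, x) \<partial>K \<omega>)\<bar>
            \<le> 1 / real (Suc i) * (\<integral>x. ?g j (\<omega>, x) * indicator {y. costs_below n c M y} (\<omega>, x) \<partial>K \<omega>))"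
        by measurable
    qed
    moreover have "(\<lambda>\<omega>. alloc_cost (K \<omega>) n (\<lambda>j x. c j (\<omega>, x)) (table_alloc n (\<lambda>j x. c j (\<omega>, x)) L w))
        \<in> borel_measurable \<Omega>"
      unfolding alloc_cost_def table_alloc_apply
    proof (rule borel_measurable_sum)
      fix j assume j: "j \<in> {1..n}"
      show "(\<lambda>\<omega>. \<integral>\<^sup>+x. ennreal (?g j (\<omega>, x) * c j (\<omega>, x)) \<partial>K \<omega>) \<in> borel_measurable \<Omega>"
        by (rule nn[OF borel_measurable_times[OF gm[OF j] c[OF j]]])
    qed
    ultimately show ?thesis by (intro measurable_If borel_measurable_add) (auto simp: pred_def)
  qed
  have "(\<lambda>\<omega>. semidiscrete_cost (K \<omega>) n (\<lambda>j x. c j (\<omega>, x))) \<in> borel_measurable \<Omega> \<longleftrightarrow>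
    (\<lambda>\<omega>. INF M. INF i. INF L. INF w\<in>tables n L.
      if repairable (K \<omega>) n (\<lambda>j x. c j (\<omega>, x)) M (1 / real (Suc i)) (table_alloc n (\<lambda>j x. c j (\<omega>, x)) L w)
      then alloc_cost (K \<omega>) n (\<lambda>j x. c j (\<omega>, x)) (table_alloc n (\<lambda>j x. c j (\<omega>, x)) L w)
        + ennreal (1 / real (Suc i) * real M) else \<infinity>) \<in> borel_measurable \<Omega>"
    by (rule measurable_cong, rule semidiscrete_cost_eq_INF_tables[OF KS(2) n]) (simp_all add: c0 sec[OF c])
  also have "\<dots>"
    by (intro borel_measurable_INF countable_tables meas) auto
  finally show ?thesis .
qed

text \<open>The distribution and the sample are both functions of one parameter. This covers the
  probability space itself, the product of \<open>G\<close> with the spaces of samples, and a space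
  of samples alone with a constant distribution.\<close>

lemma measurable_wasserstein_empirical:
  fixes X :: "'a::t1_space set"
  assumes K: "K \<in> \<Omega> \<rightarrow>\<^sub>M prob_algebra (borel_on X)" and n: "1 \<le> n"
    and z: "\<And>j. j \<in> {1..n} \<Longrightarrow> z j \<in> \<Omega> \<rightarrow>\<^sub>M borel_on X"
    and d: "(\<lambda>w. dst (fst w) (snd w)) \<in> borel_measurable (borel_on X \<Otimes>\<^sub>M borel_on X)"
  shows "(\<lambda>\<omega>. wasserstein X dst p (K \<omega>) (empirical X n (\<lambda>j. z j \<omega>))) \<in> borel_measurable \<Omega>"
proof -
  have zX: "z j \<omega> \<in> X" if "j \<in> {1..n}" "\<omega> \<in> space \<Omega>" for j \<omega>
    using measurable_space[OF z[OF that(1)] that(2)] by (simp add: space_restrict_space)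
  have c: "(\<lambda>y. dst (snd y) (z j (fst y)) powr p) \<in> borel_measurable (\<Omega> \<Otimes>\<^sub>M borel_on X)" if "j \<in> {1..n}" for j
  proof -
    note [measurable] = z[OF that]
    have "(\<lambda>y. (snd y, z j (fst y))) \<in> \<Omega> \<Otimes>\<^sub>M borel_on X \<rightarrow>\<^sub>M borel_on X \<Otimes>\<^sub>M borel_on X" by measurable
    from measurable_compose[OF this d] have [measurable]:
      "(\<lambda>y. dst (snd y) (z j (fst y))) \<in> borel_measurable (\<Omega> \<Otimes>\<^sub>M borel_on X)" by simp
    show ?thesis by measurable
  qed
  have [measurable]: "ennreal_root p \<in> borel_measurable borel"
    unfolding ennreal_root_def[abs_def] by measurable
  have [measurable]: "(\<lambda>\<omega>. semidiscrete_cost (K \<omega>) n (\<lambda>j x. dst x (z j \<omega>) powr p)) \<in> borel_measurable \<Omega>"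
    using measurable_semidiscrete_cost[OF K n c] by simp
  have "(\<lambda>\<omega>. wasserstein X dst p (K \<omega>) (empirical X n (\<lambda>j. z j \<omega>))) \<in> borel_measurable \<Omega> \<longleftrightarrow>
    (\<lambda>\<omega>. ennreal_root p (semidiscrete_cost (K \<omega>) n (\<lambda>j x. dst x (z j \<omega>) powr p))) \<in> borel_measurable \<Omega>"
    using measurable_space[OF K] zX n d
    by (intro measurable_cong wasserstein_empirical) auto
  also have "\<dots>" by measurable
  finally show ?thesis .
qed

section \<open>The conditional law of the samples\<close>

lemma sets_PiM_finite_rectangles:
  assumes "finite I"
  shows "sets (PiM I M) = sigma_sets (space (PiM I M)) {PiE I E | E. E \<in> (\<Pi> i\<in>I. sets (M i))}"
  by (simp only: sets_PiM space_PiM prod_algebra_eq_finite[OF assms])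

lemma emeasure_PiM_power:
  assumes "prob_space P" "finite I" "\<And>i. i \<in> I \<Longrightarrow> C i \<in> sets P"
  shows "emeasure (\<Pi>\<^sub>M i\<in>I. P) (PiE I C) = (\<Prod>i\<in>I. emeasure P (C i))"
proof -
  interpret prob_space P by fact
  interpret product_sigma_finite "\<lambda>_. P" by unfold_locales
  show ?thesis using assms by (intro emeasure_PiM)
qed

text \<open>On a box the product measure is a finite product of values of the kernel, hence
  measurable in the parameter; boxes form a generating pi-system.\<close>

lemma measurable_PiM_power:
  assumes K: "K \<in> M \<rightarrow>\<^sub>M prob_algebra S" and I: "finite I"
  shows "(\<lambda>\<omega>. \<Pi>\<^sub>M i\<in>I. K \<omega>) \<in> M \<rightarrow>\<^sub>M prob_algebra (\<Pi>\<^sub>M i\<in>I. S)"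
proof (rule measurable_prob_algebra_generated[OF sets_PiM_finite_rectangles[OF I]])
  have KS: "sets (K \<omega>) = sets S" "prob_space (K \<omega>)" if "\<omega> \<in> space M" for \<omega>
    using measurable_space[OF K that] by (auto simp: space_prob_algebra)
  show "Int_stable {PiE I E | E. E \<in> (\<Pi> i\<in>I. sets S)}"
    using Int_stable_PiE[of I I "\<lambda>_. S"] by (simp add: Pi_iff)
  show "{PiE I E | E. E \<in> (\<Pi> i\<in>I. sets S)} \<subseteq> Pow (space (\<Pi>\<^sub>M i\<in>I. S))"
    using sets.sets_into_space by (fastforce simp: space_PiM PiE_iff Pi_iff)
  show "prob_space (\<Pi>\<^sub>M i\<in>I. K \<omega>)" if "\<omega> \<in> space M" for \<omega>
    by (intro prob_space_PiM KS that)
  show "sets (\<Pi>\<^sub>M i\<in>I. K \<omega>) = sets (\<Pi>\<^sub>M i\<in>I. S)" if "\<omega> \<in> space M" for \<omega>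
    by (intro sets_PiM_cong KS that refl)
  fix A assume "A \<in> {PiE I E | E. E \<in> (\<Pi> i\<in>I. sets S)}"
  then obtain E where A: "A = PiE I E" and E: "\<And>i. i \<in> I \<Longrightarrow> E i \<in> sets S" by (auto simp: Pi_iff)
  have "(\<lambda>\<omega>. emeasure (\<Pi>\<^sub>M i\<in>I. K \<omega>) A) \<in> borel_measurable M \<longleftrightarrow>
    (\<lambda>\<omega>. \<Prod>i\<in>I. emeasure (K \<omega>) (E i)) \<in> borel_measurable M"
    unfolding A using E KS I by (intro measurable_cong emeasure_PiM_power) auto
  also have "\<dots>"
    using E measurable_prob_algebraD[OF K]
    by (intro borel_measurable_prod_ennreal measurable_compose[OF _ measurable_emeasure_subprob_algebra])
  finally show "(\<lambda>\<omega>. emeasure (\<Pi>\<^sub>M i\<in>I. K \<omega>) A) \<in> borel_measurable M" .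
qed

lemma times_subset_Pow:
  assumes "A \<subseteq> Pow a" "B \<subseteq> Pow b"
  shows "{x \<times> y | x y. x \<in> A \<and> y \<in> B} \<subseteq> Pow (a \<times> b)"
  using assms by blast

lemma times_in_times_sets: "x \<in> A \<Longrightarrow> y \<in> B \<Longrightarrow> x \<times> y \<in> {x \<times> y | x y. x \<in> A \<and> y \<in> B}"
  by blast

text \<open>The events on which the conditional hypotheses can be evaluated directly: an event of
  the conditioning algebra and one box for each sample.\<close>

definition rectangles :: "'w measure \<Rightarrow> 'i set \<Rightarrow> 'j set \<Rightarrow> 'a measure \<Rightarrow> ('w \<times> ('i \<Rightarrow> 'a) \<times> ('j \<Rightarrow> 'a)) set set" where
  "rectangles G I J S = {B \<times> PiE I C \<times> PiE J D | B C D.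
     B \<in> sets G \<and> C \<in> (\<Pi> i\<in>I. sets S) \<and> D \<in> (\<Pi> j\<in>J. sets S)}"

lemma
  assumes I: "finite I" and J: "finite J"
  shows sets_rectangles: "sets (G \<Otimes>\<^sub>M (\<Pi>\<^sub>M i\<in>I. S) \<Otimes>\<^sub>M (\<Pi>\<^sub>M j\<in>J. S))
    = sigma_sets (space (G \<Otimes>\<^sub>M (\<Pi>\<^sub>M i\<in>I. S) \<Otimes>\<^sub>M (\<Pi>\<^sub>M j\<in>J. S))) (rectangles G I J S)"
    (is "?t1")
    and rectangles_subset: "rectangles G I J S \<subseteq> Pow (space (G \<Otimes>\<^sub>M (\<Pi>\<^sub>M i\<in>I. S) \<Otimes>\<^sub>M (\<Pi>\<^sub>M j\<in>J. S)))"
proof -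
  let ?R = "\<lambda>I. {PiE I E | E. E \<in> (\<Pi> i\<in>I. sets S)}"
  have R1: "?R I \<subseteq> Pow (space (\<Pi>\<^sub>M i\<in>I. S))" for I :: "'x set"
    using sets.sets_into_space by (fastforce simp: space_PiM PiE_iff Pi_iff)
  have R2: "{space (\<Pi>\<^sub>M i\<in>I. S)} \<subseteq> ?R I" for I :: "'x set"
    by (auto simp: space_PiM)
  let ?E = "{a \<times> b | a b. a \<in> ?R I \<and> b \<in> ?R J}"
  have E1: "?E \<subseteq> Pow (space (\<Pi>\<^sub>M i\<in>I. S) \<times> space (\<Pi>\<^sub>M j\<in>J. S))"
    by (rule times_subset_Pow[OF R1 R1])
  have "sets ((\<Pi>\<^sub>M i\<in>I. S) \<Otimes>\<^sub>M (\<Pi>\<^sub>M j\<in>J. S)) = sets (sigma (space (\<Pi>\<^sub>M i\<in>I. S) \<times> space (\<Pi>\<^sub>M j\<in>J. S)) ?E)"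
    by (rule sets_pair_eq[OF R1 sets_PiM_finite_rectangles[OF I] _ R2 _ R1 sets_PiM_finite_rectangles[OF J] _ R2]) auto
  also have "\<dots> = sigma_sets (space ((\<Pi>\<^sub>M i\<in>I. S) \<Otimes>\<^sub>M (\<Pi>\<^sub>M j\<in>J. S))) ?E"
    using E1 by (simp add: space_pair_measure)
  finally have s2: "sets ((\<Pi>\<^sub>M i\<in>I. S) \<Otimes>\<^sub>M (\<Pi>\<^sub>M j\<in>J. S))
    = sigma_sets (space ((\<Pi>\<^sub>M i\<in>I. S) \<Otimes>\<^sub>M (\<Pi>\<^sub>M j\<in>J. S))) ?E" .
  have rect: "{a \<times> b | a b. a \<in> sets G \<and> b \<in> ?E} = rectangles G I J S"
    unfolding rectangles_def by blast
  have sE: "{space ((\<Pi>\<^sub>M i\<in>I. S) \<Otimes>\<^sub>M (\<Pi>\<^sub>M j\<in>J. S))} \<subseteq> ?E"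
  proof -
    have "space (\<Pi>\<^sub>M i\<in>I. S) \<in> ?R I" "space (\<Pi>\<^sub>M j\<in>J. S) \<in> ?R J" using R2 by simp_all
    then have "space ((\<Pi>\<^sub>M i\<in>I. S) \<Otimes>\<^sub>M (\<Pi>\<^sub>M j\<in>J. S)) \<in> ?E"
      unfolding space_pair_measure by (rule times_in_times_sets)
    then show ?thesis by simp
  qed
  have E1': "?E \<subseteq> Pow (space ((\<Pi>\<^sub>M i\<in>I. S) \<Otimes>\<^sub>M (\<Pi>\<^sub>M j\<in>J. S)))"
    using E1 by (simp only: space_pair_measure)
  have "sets (G \<Otimes>\<^sub>M (\<Pi>\<^sub>M i\<in>I. S) \<Otimes>\<^sub>M (\<Pi>\<^sub>M j\<in>J. S))
    = sets (sigma (space G \<times> space ((\<Pi>\<^sub>M i\<in>I. S) \<Otimes>\<^sub>M (\<Pi>\<^sub>M j\<in>J. S))) {a \<times> b | a b. a \<in> sets G \<and> b \<in> ?E})"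
    by (rule sets_pair_eq[OF sets.space_closed sets.sigma_sets_eq[symmetric] _ _ _ E1' s2 _ sE, where Ca="{space G}"]) auto
  moreover show r: "rectangles G I J S \<subseteq> Pow (space (G \<Otimes>\<^sub>M (\<Pi>\<^sub>M i\<in>I. S) \<Otimes>\<^sub>M (\<Pi>\<^sub>M j\<in>J. S)))"
    unfolding rect[symmetric] space_pair_measure[of G] by (rule times_subset_Pow[OF sets.space_closed E1'])
  ultimately show ?t1 unfolding rect by (simp add: space_pair_measure)
qed

lemma Int_stable_rectangles: "Int_stable (rectangles G I J S)"
proof (rule Int_stableI)
  fix X Y assume "X \<in> rectangles G I J S" "Y \<in> rectangles G I J S"
  then obtain B C D B' C' D' where X: "X = B \<times> PiE I C \<times> PiE J D" "B \<in> sets G"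
      "C \<in> (\<Pi> i\<in>I. sets S)" "D \<in> (\<Pi> j\<in>J. sets S)"
    and Y: "Y = B' \<times> PiE I C' \<times> PiE J D'" "B' \<in> sets G" "C' \<in> (\<Pi> i\<in>I. sets S)" "D' \<in> (\<Pi> j\<in>J. sets S)"
    unfolding rectangles_def by blast
  have "X \<inter> Y = (B \<inter> B') \<times> PiE I (\<lambda>i. C i \<inter> C' i) \<times> PiE J (\<lambda>j. D j \<inter> D' j)"
    unfolding X Y by (auto simp: PiE_iff)
  moreover have "B \<inter> B' \<in> sets G" "(\<lambda>i. C i \<inter> C' i) \<in> (\<Pi> i\<in>I. sets S)" "(\<lambda>j. D j \<inter> D' j) \<in> (\<Pi> j\<in>J. sets S)"
    using X(2-) Y(2-) by (auto simp: Pi_iff)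
  ultimately show "X \<inter> Y \<in> rectangles G I J S"
    unfolding rectangles_def by blast
qed

text \<open>Integrate the conditional probability of the two boxes over \<open>B\<close>.
  Conditional independence splits it into factors, and the conditional distributions replace these
  by values of \<open>P k\<close> and \<open>P l\<close>. The exceptional null sets depend on the
  boxes, so the identity is integrated for fixed boxes before it is extended to general
  events.\<close>

lemma cond_samples_rectangle:
  fixes \<xi> :: "nat \<Rightarrow> nat \<Rightarrow> 'w \<Rightarrow> 'a"
  assumes "prob_space \<mu>" and G: "subalgebra \<mu> G" and kl: "k \<noteq> l"
    and sub: "{k} \<times> {1..N k} \<union> {l} \<times> {1..N l} \<subseteq> I" and N: "1 \<le> N k"
    and \<xi>: "\<And>k j. (k, j) \<in> I \<Longrightarrow> \<xi> k j \<in> \<mu> \<rightarrow>\<^sub>M S"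
    and indep: "cond_indep_vars \<mu> G S (\<lambda>(k, j). \<xi> k j) I"
    and distr: "\<And>k j. (k, j) \<in> I \<Longrightarrow> has_cond_distr \<mu> G S (\<xi> k j) (P k)"
    and P: "P k \<in> \<mu> \<rightarrow>\<^sub>M prob_algebra S" "P l \<in> \<mu> \<rightarrow>\<^sub>M prob_algebra S"
    and B: "B \<in> sets G" and C: "C \<in> (\<Pi> i\<in>{1..N k}. sets S)" and D: "D \<in> (\<Pi> i\<in>{1..N l}. sets S)"
  shows "emeasure \<mu> {\<omega> \<in> B. (\<forall>j\<in>{1..N k}. \<xi> k j \<omega> \<in> C j) \<and> (\<forall>j\<in>{1..N l}. \<xi> l j \<omega> \<in> D j)}
    = (\<integral>\<^sup>+\<omega>. indicator B \<omega> * ((\<Prod>j\<in>{1..N k}. emeasure (P k \<omega>) (C j)) * (\<Prod>j\<in>{1..N l}. emeasure (P l \<omega>) (D j))) \<partial>\<mu>)"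
proof -
  interpret prob_space \<mu> by fact
  interpret finite_measure_subalgebra \<mu> G by unfold_locales (rule G)
  have Bm: "B \<in> sets \<mu>" using B G by (auto simp: subalgebra_def)
  have Bsp: "B \<subseteq> space \<mu>" using sets.sets_into_space[OF Bm] .
  define J where "J = {k} \<times> {1..N k} \<union> {l} \<times> {1..N l}"
  \<comment> \<open>Because \<open>k \<noteq> l\<close>, the first component of an index tells which
    of the two boxes applies.\<close>
  define E where "E = (\<lambda>(i, j). if i = k then C j else D j)"
  have J: "J \<subseteq> I" "J \<noteq> {}" "finite J" using sub N by (auto simp: J_def)
  have E: "E \<in> J \<rightarrow> sets S" using C D kl by (auto simp: E_def J_def Pi_iff)
  let ?A = "{\<omega> \<in> space \<mu>. \<forall>i\<in>J. (case i of (k, j) \<Rightarrow> \<xi> k j) \<omega> \<in> E i}"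
  have Am: "?A \<in> sets \<mu>"
  proof (rule sets.sets_Collect_finite_All'[OF _ J(3,2)])
    fix i assume i: "i \<in> J"
    obtain a b where ab: "i = (a, b)" by (cases i)
    have "{\<omega> \<in> space \<mu>. \<xi> a b \<omega> \<in> E i} = \<xi> a b -` E i \<inter> space \<mu>" by blast
    then show "{\<omega> \<in> space \<mu>. (case i of (k, j) \<Rightarrow> \<xi> k j) \<omega> \<in> E i} \<in> sets \<mu>"
      using measurable_sets[OF \<xi>[of a b], of "E i"] J(1) i E ab by auto
  qed
  have c1: "AE \<omega> in \<mu>. cond_probability \<mu> G (\<lambda>\<omega>'. \<forall>i\<in>J. (case i of (k, j) \<Rightarrow> \<xi> k j) \<omega>' \<in> E i) \<omega> =
        (\<Prod>i\<in>J. cond_probability \<mu> G (\<lambda>\<omega>'. (case i of (k, j) \<Rightarrow> \<xi> k j) \<omega>' \<in> E i) \<omega>)"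
    using indep J E unfolding cond_indep_vars_def by blast
  have "AE \<omega> in \<mu>. cond_probability \<mu> G (\<lambda>\<omega>'. (case i of (k, j) \<Rightarrow> \<xi> k j) \<omega>' \<in> E i) \<omega> = measure (P (fst i) \<omega>) (E i)"
    if i: "i \<in> J" for i
  proof -
    obtain a b where ab: "i = (a, b)" by (cases i)
    show ?thesis using distr[of a b] J(1) i E ab unfolding has_cond_distr_def by auto
  qed
  then have c2: "AE \<omega> in \<mu>. \<forall>i\<in>J. cond_probability \<mu> G (\<lambda>\<omega>'. (case i of (k, j) \<Rightarrow> \<xi> k j) \<omega>' \<in> E i) \<omega>
      = measure (P (fst i) \<omega>) (E i)"
    using J(3) by (intro AE_finite_allI)
  let ?p = "\<lambda>\<omega>. (\<Prod>j\<in>{1..N k}. measure (P k \<omega>) (C j)) * (\<Prod>j\<in>{1..N l}. measure (P l \<omega>) (D j))"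
  have prodJ: "(\<Prod>i\<in>J. measure (P (fst i) \<omega>) (E i)) = ?p \<omega>" for \<omega>
  proof -
    have "(\<Prod>i\<in>J. measure (P (fst i) \<omega>) (E i))
      = (\<Prod>i\<in>{k} \<times> {1..N k}. measure (P (fst i) \<omega>) (E i)) * (\<Prod>i\<in>{l} \<times> {1..N l}. measure (P (fst i) \<omega>) (E i))"
      unfolding J_def using kl by (intro prod.union_disjoint) auto
    also have "\<dots> = ?p \<omega>"
      using kl by (simp add: prod.cartesian_product' E_def)
    finally show ?thesis .
  qed
  have c: "AE \<omega> in \<mu>. real_cond_exp \<mu> G (indicator ?A) \<omega> = ?p \<omega>"
    using c1 c2 by eventually_elim (simp add: cond_probability_def prodJ[symmetric])
  have Ks: "P k \<in> \<mu> \<rightarrow>\<^sub>M subprob_algebra S" "P l \<in> \<mu> \<rightarrow>\<^sub>M subprob_algebra S"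
    using P by (auto intro: measurable_prob_algebraD)
  have pm: "?p \<in> borel_measurable \<mu>"
    using C D by (intro borel_measurable_times borel_measurable_prod
      measurable_compose[OF Ks(1) measurable_measure_subprob_algebra] measurable_compose[OF Ks(2) measurable_measure_subprob_algebra]) auto
  have p0: "0 \<le> ?p \<omega>" for \<omega> by (intro mult_nonneg_nonneg prod_nonneg) auto
  have Pp: "prob_space (P k \<omega>)" "prob_space (P l \<omega>)" if "\<omega> \<in> space \<mu>" for \<omega>
    using measurable_space[OF P(1) that] measurable_space[OF P(2) that] by (auto simp: space_prob_algebra)
  have p1: "?p \<omega> \<le> 1" if "\<omega> \<in> space \<mu>" for \<omega>
  proof -
    have "?p \<omega> \<le> 1 * 1"
      using prob_space.prob_le_1[OF Pp(1)[OF that]] prob_space.prob_le_1[OF Pp(2)[OF that]]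
      by (intro mult_mono prod_le_1 prod_nonneg) auto
    then show ?thesis by simp
  qed
  have ball_J: "(\<forall>i\<in>J. \<phi> i) \<longleftrightarrow> (\<forall>j\<in>{1..N k}. \<phi> (k, j)) \<and> (\<forall>j\<in>{1..N l}. \<phi> (l, j))" for \<phi>
    unfolding J_def by blast
  have set_eq: "{\<omega> \<in> B. (\<forall>j\<in>{1..N k}. \<xi> k j \<omega> \<in> C j) \<and> (\<forall>j\<in>{1..N l}. \<xi> l j \<omega> \<in> D j)} = B \<inter> ?A"
    unfolding ball_J using Bsp kl by (auto simp: E_def)
  have "measure \<mu> (B \<inter> ?A) = (\<integral>\<omega>\<in>B. indicator ?A \<omega> \<partial>\<mu>)"
    using Am Bm by (simp add: set_lebesgue_integral_def indicator_inter_arith[symmetric])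
  also have "\<dots> = (\<integral>\<omega>\<in>B. real_cond_exp \<mu> G (indicator ?A) \<omega> \<partial>\<mu>)"
    using Am by (intro real_cond_exp_intA B integrable_const_bound[where B=1]) (auto simp: indicator_def)
  also have "\<dots> = (\<integral>\<omega>. indicator B \<omega> * ?p \<omega> \<partial>\<mu>)"
    unfolding set_lebesgue_integral_def using c Bm pm borel_measurable_cond_exp2[of "\<mu>" G "indicator ?A"]
    by (intro integral_cong_AE) (auto elim!: eventually_mono)
  finally have m: "measure \<mu> (B \<inter> ?A) = (\<integral>\<omega>. indicator B \<omega> * ?p \<omega> \<partial>\<mu>)" .
  have "emeasure \<mu> (B \<inter> ?A) = ennreal (\<integral>\<omega>. indicator B \<omega> * ?p \<omega> \<partial>\<mu>)"
    by (simp only: emeasure_eq_measure m)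
  also have "\<dots> = (\<integral>\<^sup>+\<omega>. ennreal (indicator B \<omega> * ?p \<omega>) \<partial>\<mu>)"
    using p0 p1 Bm
    by (intro nn_integral_eq_integral[symmetric] integrable_const_bound[where B=1] pm borel_measurable_times)
      (auto simp: indicator_def)
  also have "\<dots> = (\<integral>\<^sup>+\<omega>. indicator B \<omega> * ((\<Prod>j\<in>{1..N k}. emeasure (P k \<omega>) (C j)) * (\<Prod>j\<in>{1..N l}. emeasure (P l \<omega>) (D j))) \<partial>\<mu>)"
  proof (rule nn_integral_cong)
    fix \<omega> assume w: "\<omega> \<in> space \<mu>"
    interpret k: prob_space "P k \<omega>" by (rule Pp[OF w])
    interpret l: prob_space "P l \<omega>" by (rule Pp[OF w])
    show "ennreal (indicator B \<omega> * ?p \<omega>) = indicator B \<omega> * ((\<Prod>j\<in>{1..N k}. emeasure (P k \<omega>) (C j)) * (\<Prod>j\<in>{1..N l}. emeasure (P l \<omega>) (D j)))"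
      unfolding k.emeasure_eq_measure l.emeasure_eq_measure
      by (simp add: ennreal_mult prod_ennreal prod_nonneg indicator_def)
  qed
  finally show ?thesis unfolding set_eq .
qed

lemma cond_samples_law:
  fixes \<xi> :: "nat \<Rightarrow> nat \<Rightarrow> 'w \<Rightarrow> 'a"
  assumes ps: "prob_space \<mu>" and G: "subalgebra \<mu> G" and kl: "k \<noteq> l"
    and sub: "{k} \<times> {1..N k} \<union> {l} \<times> {1..N l} \<subseteq> I" and N: "1 \<le> N k"
    and \<xi>: "\<And>k j. (k, j) \<in> I \<Longrightarrow> \<xi> k j \<in> \<mu> \<rightarrow>\<^sub>M S"
    and indep: "cond_indep_vars \<mu> G S (\<lambda>(k, j). \<xi> k j) I"
    and distr: "\<And>k j. (k, j) \<in> I \<Longrightarrow> has_cond_distr \<mu> G S (\<xi> k j) (P k)"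
    and P: "P k \<in> \<mu> \<rightarrow>\<^sub>M prob_algebra S" "P l \<in> \<mu> \<rightarrow>\<^sub>M prob_algebra S"
    and A: "A \<in> sets (G \<Otimes>\<^sub>M (\<Pi>\<^sub>M j\<in>{1..N k}. S) \<Otimes>\<^sub>M (\<Pi>\<^sub>M j\<in>{1..N l}. S))"
  shows "emeasure \<mu> {\<omega> \<in> space \<mu>. (\<omega>, (\<lambda>j\<in>{1..N k}. \<xi> k j \<omega>), (\<lambda>j\<in>{1..N l}. \<xi> l j \<omega>)) \<in> A}
    = (\<integral>\<^sup>+\<omega>. emeasure ((\<Pi>\<^sub>M j\<in>{1..N k}. P k \<omega>) \<Otimes>\<^sub>M (\<Pi>\<^sub>M j\<in>{1..N l}. P l \<omega>)) (Pair \<omega> -` A) \<partial>\<mu>)"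
proof -
  interpret prob_space \<mu> by fact
  let ?Sk = "\<Pi>\<^sub>M j\<in>{1..N k}. S" and ?Sl = "\<Pi>\<^sub>M j\<in>{1..N l}. S"
  let ?X = "G \<Otimes>\<^sub>M ?Sk \<Otimes>\<^sub>M ?Sl"
  let ?T = "\<lambda>\<omega>. (\<omega>, (\<lambda>j\<in>{1..N k}. \<xi> k j \<omega>), (\<lambda>j\<in>{1..N l}. \<xi> l j \<omega>))"
  define K where "K \<omega> = (\<Pi>\<^sub>M j\<in>{1..N k}. P k \<omega>) \<Otimes>\<^sub>M (\<Pi>\<^sub>M j\<in>{1..N l}. P l \<omega>)" for \<omega>
  have spG: "space G = space \<mu>" using G by (simp add: subalgebra_def)
  have idG: "(\<lambda>\<omega>. \<omega>) \<in> \<mu> \<rightarrow>\<^sub>M G"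
    using G sets.sets_into_space[of _ \<mu>]
    by (intro measurableI) (auto simp: subalgebra_def Int_absorb2 vimage_def)
  have T: "?T \<in> \<mu> \<rightarrow>\<^sub>M ?X"
    using sub by (intro measurable_Pair idG measurable_restrict \<xi>) (blast intro: subsetD[OF sub])+
  have Kk: "(\<lambda>\<omega>. \<Pi>\<^sub>M j\<in>{1..N k}. P k \<omega>) \<in> \<mu> \<rightarrow>\<^sub>M prob_algebra ?Sk"
    and Kl: "(\<lambda>\<omega>. \<Pi>\<^sub>M j\<in>{1..N l}. P l \<omega>) \<in> \<mu> \<rightarrow>\<^sub>M prob_algebra ?Sl"
    by (intro measurable_PiM_power P finite_atLeastAtMost)+
  have Km: "K \<in> \<mu> \<rightarrow>\<^sub>M subprob_algebra (?Sk \<Otimes>\<^sub>M ?Sl)"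
    unfolding K_def[abs_def] by (intro measurable_pair_measure measurable_prob_algebraD Kk Kl)
  have K'm: "(\<lambda>\<omega>. return G \<omega> \<Otimes>\<^sub>M K \<omega>) \<in> \<mu> \<rightarrow>\<^sub>M subprob_algebra ?X"
    by (intro measurable_pair_measure Km measurable_compose[OF idG return_measurable])
  have Kp: "prob_space (\<Pi>\<^sub>M j\<in>{1..N k}. P k \<omega>)" "prob_space (\<Pi>\<^sub>M j\<in>{1..N l}. P l \<omega>)"
    "prob_space (P k \<omega>)" "prob_space (P l \<omega>)" "sets (P k \<omega>) = sets S" "sets (P l \<omega>) = sets S"
    if "\<omega> \<in> space \<mu>" for \<omega>
    using measurable_space[OF Kk that] measurable_space[OF Kl that]
      measurable_space[OF P(1) that] measurable_space[OF P(2) that] by (auto simp: space_prob_algebra)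
  have sK: "sets (K \<omega>) = sets (?Sk \<Otimes>\<^sub>M ?Sl)" "subprob_space (K \<omega>)" if "\<omega> \<in> space \<mu>" for \<omega>
    using measurable_space[OF Km that] by (auto simp: space_subprob_algebra)
  have sfK: "sigma_finite_measure (K \<omega>)" if "\<omega> \<in> space \<mu>" for \<omega>
  proof -
    interpret subprob_space "K \<omega>" by (rule sK(2)[OF that])
    show ?thesis by unfold_locales
  qed
  have K': "emeasure (return G \<omega> \<Otimes>\<^sub>M K \<omega>) A' = emeasure (K \<omega>) (Pair \<omega> -` A')"
    if w: "\<omega> \<in> space \<mu>" and A': "A' \<in> sets ?X" for \<omega> A'
  proof -
    interpret K: sigma_finite_measure "K \<omega>" by (rule sfK[OF w])
    have "sets (return G \<omega> \<Otimes>\<^sub>M K \<omega>) = sets ?X" "sets (G \<Otimes>\<^sub>M K \<omega>) = sets ?X"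
      by (auto intro!: sets_pair_measure_cong sK[OF w])
    then have A2: "A' \<in> sets (return G \<omega> \<Otimes>\<^sub>M K \<omega>)" "A' \<in> sets (G \<Otimes>\<^sub>M K \<omega>)" using A' by auto
    have "emeasure (return G \<omega> \<Otimes>\<^sub>M K \<omega>) A' = (\<integral>\<^sup>+x. emeasure (K \<omega>) (Pair x -` A') \<partial>return G \<omega>)"
      by (rule K.emeasure_pair_measure_alt[OF A2(1)])
    also have "\<dots> = emeasure (K \<omega>) (Pair \<omega> -` A')"
      using w K.measurable_emeasure_Pair[OF A2(2)] by (intro nn_integral_return) (simp_all add: spG)
    finally show ?thesis .
  qed
  have ne: "space \<mu> \<noteq> {}" by (rule not_empty)
  have "distr \<mu> ?X ?T = \<mu> \<bind> (\<lambda>\<omega>. return G \<omega> \<Otimes>\<^sub>M K \<omega>)"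
  proof (rule measure_eqI_generator_eq[OF Int_stable_rectangles rectangles_subset[OF finite_atLeastAtMost finite_atLeastAtMost]])
    show "sets (distr \<mu> ?X ?T) = sigma_sets (space ?X) (rectangles G {1..N k} {1..N l} S)"
      by (simp add: sets_rectangles)
    show "sets (\<mu> \<bind> (\<lambda>\<omega>. return G \<omega> \<Otimes>\<^sub>M K \<omega>)) = sigma_sets (space ?X) (rectangles G {1..N k} {1..N l} S)"
      unfolding sets_rectangles[OF finite_atLeastAtMost finite_atLeastAtMost, symmetric]
      by (rule sets_bind_measurable[OF K'm ne])
    show "range (\<lambda>_::nat. space ?X) \<subseteq> rectangles G {1..N k} {1..N l} S"
      by (auto simp: rectangles_def space_pair_measure space_PiM)
    show "(\<Union>i::nat. space ?X) = space ?X" by simp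
    have pT: "prob_space (distr \<mu> ?X ?T)" by (rule prob_space_distr[OF T])
    then show "emeasure (distr \<mu> ?X ?T) (space ?X) \<noteq> \<infinity>"
      using prob_space.emeasure_space_1[OF pT] by simp
    fix R assume R: "R \<in> rectangles G {1..N k} {1..N l} S"
    then obtain B C D where Req: "R = B \<times> PiE {1..N k} C \<times> PiE {1..N l} D" and B: "B \<in> sets G"
      and C: "C \<in> (\<Pi> j\<in>{1..N k}. sets S)" and D: "D \<in> (\<Pi> j\<in>{1..N l}. sets S)"
      unfolding rectangles_def by blast
    have Rs: "R \<in> sets ?X"
      unfolding sets_rectangles[OF finite_atLeastAtMost finite_atLeastAtMost] using R by (rule sigma_sets.Basic)
    have Bsp: "B \<subseteq> space \<mu>" using sets.sets_into_space[OF B] by (simp add: spG)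
    have "?T -` R \<inter> space \<mu>
      = {\<omega> \<in> B. (\<forall>j\<in>{1..N k}. \<xi> k j \<omega> \<in> C j) \<and> (\<forall>j\<in>{1..N l}. \<xi> l j \<omega> \<in> D j)}"
      using Bsp by (auto simp: Req PiE_iff)
    then have "emeasure (distr \<mu> ?X ?T) R
      = (\<integral>\<^sup>+\<omega>. indicator B \<omega> * ((\<Prod>j\<in>{1..N k}. emeasure (P k \<omega>) (C j)) * (\<Prod>j\<in>{1..N l}. emeasure (P l \<omega>) (D j))) \<partial>\<mu>)"
      using cond_samples_rectangle[OF ps G kl sub N \<xi> indep distr P B C D] T Rs
      by (simp add: emeasure_distr)
    also have "\<dots> = (\<integral>\<^sup>+\<omega>. emeasure (return G \<omega> \<Otimes>\<^sub>M K \<omega>) R \<partial>\<mu>)"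
    proof (rule nn_integral_cong)
      fix \<omega> assume w: "\<omega> \<in> space \<mu>"
      interpret L: prob_space "\<Pi>\<^sub>M j\<in>{1..N l}. P l \<omega>" by (rule Kp[OF w])
      have Ck: "PiE {1..N k} C \<in> sets (\<Pi>\<^sub>M j\<in>{1..N k}. P k \<omega>)" "PiE {1..N l} D \<in> sets (\<Pi>\<^sub>M j\<in>{1..N l}. P l \<omega>)"
        using C D Kp(5,6)[OF w] by (auto intro!: sets_PiM_I_finite)
      have "Pair \<omega> -` R = (if \<omega> \<in> B then PiE {1..N k} C \<times> PiE {1..N l} D else {})"
        by (auto simp: Req)
      then have "emeasure (return G \<omega> \<Otimes>\<^sub>M K \<omega>) R
        = indicator B \<omega> * emeasure (K \<omega>) (PiE {1..N k} C \<times> PiE {1..N l} D)"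
        unfolding K'[OF w Rs] by (auto simp: indicator_def)
      also have "emeasure (K \<omega>) (PiE {1..N k} C \<times> PiE {1..N l} D)
        = (\<Prod>j\<in>{1..N k}. emeasure (P k \<omega>) (C j)) * (\<Prod>j\<in>{1..N l}. emeasure (P l \<omega>) (D j))"
        unfolding K_def L.emeasure_pair_measure_Times[OF Ck]
        using C D Kp[OF w] by (subst (1 2) emeasure_PiM_power) (auto simp: Pi_iff)
      finally show "indicator B \<omega> * ((\<Prod>j\<in>{1..N k}. emeasure (P k \<omega>) (C j)) * (\<Prod>j\<in>{1..N l}. emeasure (P l \<omega>) (D j)))
        = emeasure (return G \<omega> \<Otimes>\<^sub>M K \<omega>) R" by simp
    qed
    also have "\<dots> = emeasure (\<mu> \<bind> (\<lambda>\<omega>. return G \<omega> \<Otimes>\<^sub>M K \<omega>)) R"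
      by (rule emeasure_bind[OF ne K'm Rs, symmetric])
    finally show "emeasure (distr \<mu> ?X ?T) R = emeasure (\<mu> \<bind> (\<lambda>\<omega>. return G \<omega> \<Otimes>\<^sub>M K \<omega>)) R" .
  qed
  then have "emeasure (distr \<mu> ?X ?T) A = emeasure (\<mu> \<bind> (\<lambda>\<omega>. return G \<omega> \<Otimes>\<^sub>M K \<omega>)) A" by simp
  moreover have "emeasure (distr \<mu> ?X ?T) A = emeasure \<mu> {\<omega> \<in> space \<mu>. ?T \<omega> \<in> A}"
    unfolding emeasure_distr[OF T A] by (rule arg_cong[where f="emeasure \<mu>"]) blast
  moreover have "emeasure (\<mu> \<bind> (\<lambda>\<omega>. return G \<omega> \<Otimes>\<^sub>M K \<omega>)) A
      = (\<integral>\<^sup>+\<omega>. emeasure (K \<omega>) (Pair \<omega> -` A) \<partial>\<mu>)"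
    unfolding emeasure_bind[OF ne K'm A] by (intro nn_integral_cong K' A)
  ultimately show ?thesis unfolding K_def by simp
qed

section \<open>The Stieltjes integral with respect to the law of the distance\<close>

lemma enn2ereal_le_ereal_iff:
  "enn2ereal d \<le> ereal t \<longleftrightarrow> d < \<infinity> \<and> enn2real d \<le> t"
  by (cases d) auto

lemma le_ennreal_iff_enn2real:
  assumes "0 \<le> t"
  shows "d \<le> ennreal t \<longleftrightarrow> d < \<infinity> \<and> enn2real d \<le> t"
  using assms by (cases d) (auto simp: top_unique)

text \<open>The law of \<open>D\<close> restricted to its finite values is a finite Borel measure
  whose cumulative distribution function is \<open>ennreal_cdf \<mu> D\<close>; by uniqueness it is
  the Stieltjes measure of that function. Its total mass can be less than 1.\<close>

lemma set_integral_ennreal_cdf: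
  fixes b :: "real \<Rightarrow> real"
  assumes "prob_space \<mu>" and D[measurable]: "D \<in> borel_measurable \<mu>"
    and b[measurable]: "b \<in> borel_measurable borel" and t: "0 \<le> t"
  shows "(LINT s:{0..t}|interval_measure (ennreal_cdf \<mu> D). b s)
    = (\<integral>\<omega>. indicator {\<omega>. D \<omega> \<le> ennreal t} \<omega> * b (enn2real (D \<omega>)) \<partial>\<mu>)"
proof -
  interpret prob_space \<mu> by fact
  let ?I = "indicator {\<omega> \<in> space \<mu>. D \<omega> < \<infinity>} :: _ \<Rightarrow> real"
  \<comment> \<open>\<open>enn2real\<close> sends infinity to 0; the density removes those points,
    which would otherwise create a spurious atom at 0.\<close>
  define \<nu> where "\<nu> = distr (density \<mu> (\<lambda>\<omega>. ennreal (?I \<omega>))) borel (\<lambda>\<omega>. enn2real (D \<omega>))"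
  have em: "emeasure \<nu> B = emeasure \<mu> {\<omega> \<in> space \<mu>. D \<omega> < \<infinity> \<and> enn2real (D \<omega>) \<in> B}"
    if B[measurable]: "B \<in> sets borel" for B
  proof -
    let ?B = "(\<lambda>\<omega>. enn2real (D \<omega>)) -` B \<inter> space \<mu>"
    have Bm[measurable]: "?B \<in> sets \<mu>" by measurable
    have "emeasure \<nu> B = emeasure (density \<mu> (\<lambda>\<omega>. ennreal (?I \<omega>))) ?B"
      unfolding \<nu>_def by (subst emeasure_distr) auto
    also have "\<dots> = (\<integral>\<^sup>+\<omega>. ennreal (?I \<omega>) * indicator ?B \<omega> \<partial>\<mu>)"
      by (rule emeasure_density) measurable
    also have "\<dots> = (\<integral>\<^sup>+\<omega>. indicator {\<omega> \<in> space \<mu>. D \<omega> < \<infinity> \<and> enn2real (D \<omega>) \<in> B} \<omega> \<partial>\<mu>)"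
      by (intro nn_integral_cong) (auto simp: indicator_def)
    also have "\<dots> = emeasure \<mu> {\<omega> \<in> space \<mu>. D \<omega> < \<infinity> \<and> enn2real (D \<omega>) \<in> B}"
      by (rule nn_integral_indicator) measurable
    finally show ?thesis .
  qed
  have fb: "finite_borel_measure \<nu>"
  proof (intro finite_borel_measure.intro finite_borel_measure_axioms.intro finite_measureI)
    show "emeasure \<nu> (space \<nu>) \<noteq> \<infinity>" using em[of UNIV] by (simp add: \<nu>_def)
  qed (simp add: \<nu>_def)
  interpret N: finite_borel_measure \<nu> by (rule fb)
  have cdf: "ennreal_cdf \<mu> D = cdf \<nu>"
  proof
    fix s
    have "cdf \<nu> s = measure \<mu> {\<omega> \<in> space \<mu>. D \<omega> < \<infinity> \<and> enn2real (D \<omega>) \<in> {..s}}"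
      unfolding cdf_def2 measure_def by (subst em) auto
    then show "ennreal_cdf \<mu> D s = cdf \<nu> s"
      by (simp only: ennreal_cdf_def enn2ereal_le_ereal_iff atMost_iff)
  qed
  have "interval_measure (cdf \<nu>) = \<nu>"
  proof (rule cdf_unique')
    show "finite_borel_measure (interval_measure (cdf \<nu>))"
      by (rule finite_borel_measure_interval_measure[OF N.cdf_nondecreasing N.cdf_is_right_cont
            N.cdf_lim_at_bot N.cdf_lim_at_top]) auto
    show "cdf (interval_measure (cdf \<nu>)) = cdf \<nu>"
      by (rule cdf_interval_measure[OF N.cdf_nondecreasing N.cdf_is_right_cont N.cdf_lim_at_bot])
  qed (rule fb)
  then have "(LINT s:{0..t}|interval_measure (ennreal_cdf \<mu> D). b s) = (\<integral>s. indicator {0..t} s * b s \<partial>\<nu>)"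
    by (simp add: cdf set_lebesgue_integral_def)
  also have "\<dots> = (\<integral>\<omega>. indicator {0..t} (enn2real (D \<omega>)) * b (enn2real (D \<omega>)) \<partial>density \<mu> (\<lambda>\<omega>. ennreal (?I \<omega>)))"
    unfolding \<nu>_def by (subst integral_distr) auto
  also have "\<dots> = (\<integral>\<omega>. ?I \<omega> *\<^sub>R (indicator {0..t} (enn2real (D \<omega>)) * b (enn2real (D \<omega>))) \<partial>\<mu>)"
    by (rule integral_density) auto
  also have "\<dots> = (\<integral>\<omega>. indicator {\<omega>. D \<omega> \<le> ennreal t} \<omega> * b (enn2real (D \<omega>)) \<partial>\<mu>)"
    by (intro Bochner_Integration.integral_cong refl) (auto simp: indicator_def le_ennreal_iff_enn2real[OF t])
  finally show ?thesis .
qed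

section \<open>The bound\<close>

lemma empirical_restrict: "empirical X n (\<lambda>j\<in>{1..n}. x j) = empirical X n x"
  unfolding empirical_def by (rule distr_cong) (auto simp: space_uniform_count_measure)

text \<open>The concentration inequality bounds an event from below. Turning it into a bound on the
  complement requires the event to be measurable, which is
  \<open>measurable_wasserstein_empirical\<close> for a constant distribution.\<close>

lemma concentration_tail:
  fixes X :: "(real^'d) set"
  assumes conc: "concentration X dst p a A c1 c2"
    and P: "P \<in> distributions X" and lt: "light_tailed a A P" and e: "0 \<le> e" and n: "1 \<le> n"
    and d: "(\<lambda>z. dst (fst z) (snd z)) \<in> borel_measurable (borel_on X \<Otimes>\<^sub>M borel_on X)"
  shows "emeasure (\<Pi>\<^sub>M j\<in>{1..n}. P) {x \<in> space (\<Pi>\<^sub>M j\<in>{1..n}. P). ennreal e < wasserstein X dst p P (empirical X n x)}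
    \<le> ennreal (conc_beta c1 c2 a p CARD('d) e n)"
proof -
  let ?M = "\<Pi>\<^sub>M j\<in>{1..n}. P"
  interpret prob_space ?M by (intro prob_space_PiM space_of_distributions(3)[OF P])
  note [measurable_cong] = space_of_distributions(2)[OF P]
  have Wm[measurable]: "(\<lambda>x. wasserstein X dst p P (empirical X n x)) \<in> borel_measurable ?M"
  proof -
    have "(\<lambda>x. x j) \<in> ?M \<rightarrow>\<^sub>M borel_on X" if "j \<in> {1..n}" for j
      using that by measurable
    then show ?thesis
      using measurable_wasserstein_empirical[of "\<lambda>_. P" ?M X n "\<lambda>j x. x j" dst p] P n d by simp
  qed
  let ?T = "{x \<in> space ?M. wasserstein X dst p P (empirical X n x) \<le> ennreal e}"
  have T: "?T \<in> sets ?M" by measurable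
  have "1 - conc_beta c1 c2 a p CARD('d) e n \<le> prob ?T"
    using conc P lt e n unfolding concentration_def by blast
  then have "prob (space ?M - ?T) \<le> conc_beta c1 c2 a p CARD('d) e n"
    using prob_compl[OF T] by simp
  moreover have "space ?M - ?T = {x \<in> space ?M. ennreal e < wasserstein X dst p P (empirical X n x)}"
    by auto
  ultimately show ?thesis by (simp add: emeasure_eq_measure ennreal_leI)
qed

lemma measurable_conc_beta: "(\<lambda>e. conc_beta c1 c2 a p d e n) \<in> borel_measurable borel"
  unfolding conc_beta_def by measurable

lemma conc_beta_nonneg: "0 \<le> c1 \<Longrightarrow> 0 \<le> conc_beta c1 c2 a p d e n"
  by (simp add: conc_beta_def)

lemma conc_beta_le: "0 \<le> c1 \<Longrightarrow> 0 \<le> c2 \<Longrightarrow> conc_beta c1 c2 a p d e n \<le> c1"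
  by (simp add: conc_beta_def mult_left_le)

text \<open>Measurability for the generated algebra, rather than for \<open>\<mu>\<close>, is what
  \<open>cond_samples_law\<close> demands of an event that involves the distributions.\<close>

lemma measurable_sigma_distributions:
  assumes P: "\<And>k. k \<in> {1..K} \<Longrightarrow> P k \<in> \<mu> \<rightarrow>\<^sub>M prob_algebra (borel_on X)" and k: "k \<in> {1..K}"
  shows "P k \<in> sigma_distributions \<mu> X K P \<rightarrow>\<^sub>M prob_algebra (borel_on X)"
proof -
  have "(\<lambda>\<omega>. \<lambda>k\<in>{1..K}. P k \<omega>) \<in> sigma_distributions \<mu> X K P \<rightarrow>\<^sub>M (\<Pi>\<^sub>M k\<in>{1..K}. prob_algebra (borel_on X))"
    unfolding sigma_distributions_def using P
    by (intro measurable_vimage_algebra1) (auto simp: space_PiM PiE_iff intro!: measurable_space[OF P])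
  from measurable_compose[OF this measurable_component_singleton[OF k]]
  show ?thesis using k by simp
qed

lemma subalgebra_sigma_distributions:
  assumes P: "\<And>k. k \<in> {1..K} \<Longrightarrow> P k \<in> \<mu> \<rightarrow>\<^sub>M prob_algebra (borel_on X)"
  shows "subalgebra \<mu> (sigma_distributions \<mu> X K P)"
proof -
  have "(\<lambda>\<omega>. \<lambda>k\<in>{1..K}. P k \<omega>) \<in> \<mu> \<rightarrow>\<^sub>M (\<Pi>\<^sub>M k\<in>{1..K}. prob_algebra (borel_on X))"
    using P by (intro measurable_restrict)
  then show ?thesis
    unfolding subalgebra_def sigma_distributions_def
    by (subst sets_vimage_algebra2) (auto dest: measurable_space measurable_sets)
qed

theorem proposition4:
  fixes \<mu> :: "'w measure"
    and \<Xi> :: "(real^'d) set"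
    and dst :: "real^'d \<Rightarrow> real^'d \<Rightarrow> real"
    and p a A c1 c2 \<epsilon> r :: real
    and K k :: nat
    and N :: "nat \<Rightarrow> nat"
    and P :: "nat \<Rightarrow> 'w \<Rightarrow> (real^'d) measure"
    and \<xi> :: "nat \<Rightarrow> nat \<Rightarrow> 'w \<Rightarrow> real^'d"
  defines "I \<equiv> (SIGMA k:{1..K}. {1..N k})"
    and "W \<equiv> wasserstein \<Xi> dst p"
    and "Phat \<equiv> \<lambda>k \<omega>. empirical \<Xi> (N k) (\<lambda>j. \<xi> k j \<omega>)"
    and "G \<equiv> sigma_distributions \<mu> \<Xi> K P"
    and "\<beta> \<equiv> conc_beta c1 c2 a p CARD('d)"
    and "F \<equiv> \<lambda>k. ennreal_cdf \<mu> (\<lambda>\<omega>. wasserstein \<Xi> dst p (P 1 \<omega>) (P k \<omega>))"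
  assumes "prob_space \<mu>"
    and "closed \<Xi>" and "convex \<Xi>"
    and "p \<ge> 1" and "p \<noteq> real CARD('d) / 2"
    and "Metric_space \<Xi> dst"
    and "(\<lambda>z. dst (fst z) (snd z)) \<in> borel_measurable (borel_on \<Xi> \<Otimes>\<^sub>M borel_on \<Xi>)"
    and "\<And>k. k \<in> {1..K} \<Longrightarrow> N k \<ge> 1"
    and "\<And>k. k \<in> {1..K} \<Longrightarrow> P k \<in> \<mu> \<rightarrow>\<^sub>M prob_algebra (borel_on \<Xi>)"
    and "\<And>k j. (k, j) \<in> I \<Longrightarrow> \<xi> k j \<in> \<mu> \<rightarrow>\<^sub>M borel_on \<Xi>"
    and "cond_indep_vars \<mu> G (borel_on \<Xi>) (\<lambda>(k, j). \<xi> k j) I"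
    and "\<And>k j. (k, j) \<in> I \<Longrightarrow> has_cond_distr \<mu> G (borel_on \<Xi>) (\<xi> k j) (P k)"
    and "\<And>k. k \<in> {1..K} \<Longrightarrow> (\<lambda>\<omega>. W (P 1 \<omega>) (P k \<omega>)) \<in> borel_measurable \<mu>"
    and "a > p" and "A > 0"
    and "AE \<omega> in \<mu>. \<forall>k\<in>{1..K}. light_tailed a A (P k \<omega>)"
    and "c1 > 0" and "c2 > 0"
    and "concentration \<Xi> dst p a A c1 c2"
    and "k \<in> {1..K}" and "k \<noteq> 1"
    and "0 \<le> r" and "r \<le> \<epsilon>"
    and "\<P>(\<omega> in \<mu>. W (Phat 1 \<omega>) (Phat k \<omega>) \<le> ennreal r) > 0"
  shows "\<P>(\<omega> in \<mu>. P 1 \<omega> \<in> wasserstein_ball \<Xi> dst p \<epsilon> (Phat k \<omega>)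
            \<bar> W (Phat 1 \<omega>) (Phat k \<omega>) \<le> ennreal r)
         \<ge> 1 - beta_F \<beta> (F k) (\<P>(\<omega> in \<mu>. W (Phat 1 \<omega>) (Phat k \<omega>) \<le> ennreal r))
                 \<epsilon> r (N 1) (N k)"
proof -
  note p = \<open>p \<ge> 1\<close> and dst = \<open>Metric_space \<Xi> dst\<close>
    and dm = \<open>(\<lambda>z. dst (fst z) (snd z)) \<in> borel_measurable (borel_on \<Xi> \<Otimes>\<^sub>M borel_on \<Xi>)\<close>
    and k = \<open>k \<in> {1..K}\<close> and k1 = \<open>k \<noteq> 1\<close> and r = \<open>0 \<le> r\<close> \<open>r \<le> \<epsilon>\<close>
    and conc = \<open>concentration \<Xi> dst p a A c1 c2\<close>
    and N1 = assms(14)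
    and Pm = assms(15)
    and xm = assms(16)
    and c12 = \<open>c1 > 0\<close> \<open>c2 > 0\<close>
  have one: "1 \<in> {1..K}" using k by auto
  interpret prob_space \<mu> by fact
  let ?S = "borel_on \<Xi>"
  let ?X = "G \<Otimes>\<^sub>M (\<Pi>\<^sub>M j\<in>{1..N 1}. ?S) \<Otimes>\<^sub>M (\<Pi>\<^sub>M j\<in>{1..N k}. ?S)"
  have G: "subalgebra \<mu> G" unfolding G_def using Pm by (rule subalgebra_sigma_distributions)
  have spG: "space G = space \<mu>" using G by (simp add: subalgebra_def)
  have PG: "P i \<in> G \<rightarrow>\<^sub>M prob_algebra ?S" if "i \<in> {1..K}" for i
    unfolding G_def using Pm that by (rule measurable_sigma_distributions)
  have Pd: "P i \<omega> \<in> distributions \<Xi>" if "i \<in> {1..K}" "\<omega> \<in> space \<mu>" for i \<omega>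
    by (rule measurable_space[OF Pm[OF that(1)] that(2)])
  have xX: "\<xi> i j \<omega> \<in> \<Xi>" if "i \<in> {1..K}" "j \<in> {1..N i}" "\<omega> \<in> space \<mu>" for i j \<omega>
    using measurable_space[OF xm[of i j] that(3)] that(1,2) by (simp add: I_def space_restrict_space)
  have Phd: "Phat i \<omega> \<in> distributions \<Xi>" if "i \<in> {1..K}" "\<omega> \<in> space \<mu>" for i \<omega>
    unfolding Phat_def using xX[OF that(1) _ that(2)] N1[OF that(1)] by (rule empirical_in_distributions)
  have tri: "W Q (empirical \<Xi> n z) \<le> W Q R + W R (empirical \<Xi> n z)"
    if "R \<in> distributions \<Xi>" "n \<ge> 1" "\<And>j. j \<in> {1..n} \<Longrightarrow> z j \<in> \<Xi>" for Q R n z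
    unfolding W_def by (intro wasserstein_triangle_empirical p dst that dm)
  define E where "E = {\<omega> \<in> space \<mu>. W (Phat 1 \<omega>) (Phat k \<omega>) \<le> ennreal r}"
  have Epos: "0 < prob E"
    using \<open>\<P>(\<omega> in \<mu>. W (Phat 1 \<omega>) (Phat k \<omega>) \<le> ennreal r) > 0\<close> by (simp add: E_def)
  \<comment> \<open>By convention a set that is not measurable has measure 0, so a positive value
    already yields measurability.\<close>
  then have Em: "E \<in> sets \<mu>" by (metis less_irrefl measure_notin_sets)
  define H where "H = {\<omega> \<in> space \<mu>. W (P 1 \<omega>) (Phat k \<omega>) \<le> ennreal \<epsilon>}"
  have Hm: "H \<in> sets \<mu>"
  proof -
    have [measurable]: "(\<lambda>\<omega>. W (P 1 \<omega>) (Phat k \<omega>)) \<in> borel_measurable \<mu>"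
      unfolding W_def Phat_def using k
      by (intro measurable_wasserstein_empirical Pm[OF one] N1 xm dm) (auto simp: I_def)
    show ?thesis unfolding H_def by measurable
  qed
  \<comment> \<open>The distribution is read from the coordinate in \<open>G\<close>, the samples
    from the other two. Each condition involves a single sample, so every section of
    \<open>B\<close> at a fixed outcome is a product set.\<close>
  define B where "B = {w \<in> space ?X. ennreal (\<epsilon> - r) < W (P 1 (fst w)) (empirical \<Xi> (N 1) (fst (snd w)))
      \<and> ennreal \<epsilon> < W (P 1 (fst w)) (empirical \<Xi> (N k) (snd (snd w)))}"
  have Bm: "B \<in> sets ?X"
  proof -
    have P1: "(\<lambda>w. P 1 (fst w)) \<in> ?X \<rightarrow>\<^sub>M prob_algebra ?S"
      by (rule measurable_compose[OF measurable_fst PG[OF one]])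
    have 1: "(\<lambda>w. fst (snd w) j) \<in> ?X \<rightarrow>\<^sub>M ?S" if "j \<in> {1..N 1}" for j
      using that by measurable
    have 2: "(\<lambda>w. snd (snd w) j) \<in> ?X \<rightarrow>\<^sub>M ?S" if "j \<in> {1..N k}" for j
      using that by measurable
    have [measurable]: "(\<lambda>w. W (P 1 (fst w)) (empirical \<Xi> (N 1) (fst (snd w)))) \<in> borel_measurable ?X"
      using measurable_wasserstein_empirical[where p=p and z="\<lambda>j w. fst (snd w) j", OF P1 N1[OF one] 1 dm] by (simp add: W_def)
    have [measurable]: "(\<lambda>w. W (P 1 (fst w)) (empirical \<Xi> (N k) (snd (snd w)))) \<in> borel_measurable ?X"
      using measurable_wasserstein_empirical[where p=p and z="\<lambda>j w. snd (snd w) j", OF P1 N1[OF k] 2 dm] by (simp add: W_def)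
    show ?thesis unfolding B_def by measurable
  qed
  let ?T = "\<lambda>\<omega>. (\<omega>, (\<lambda>j\<in>{1..N 1}. \<xi> 1 j \<omega>), (\<lambda>j\<in>{1..N k}. \<xi> k j \<omega>))"
  define bad where "bad = {\<omega> \<in> space \<mu>. ?T \<omega> \<in> B}"
  have sub: "{1} \<times> {1..N 1} \<union> {k} \<times> {1..N k} \<subseteq> I" using one k by (auto simp: I_def)
  \<comment> \<open>Here \<open>k \<noteq> 1\<close> is essential: the two samples are then disjoint
    and conditionally independent, whereas for equal indices both conditions would concern one and
    the same sample.\<close>
  have law: "emeasure \<mu> bad
    = (\<integral>\<^sup>+\<omega>. emeasure ((\<Pi>\<^sub>M j\<in>{1..N 1}. P 1 \<omega>) \<Otimes>\<^sub>M (\<Pi>\<^sub>M j\<in>{1..N k}. P k \<omega>)) (Pair \<omega> -` B) \<partial>\<mu>)"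
    unfolding bad_def
    by (rule cond_samples_law[OF prob_space_axioms G k1[symmetric] sub N1[OF one] xm assms(17,18) Pm[OF one] Pm[OF k] Bm])
  have badm: "bad \<in> sets \<mu>"
  proof -
    have "?T \<in> \<mu> \<rightarrow>\<^sub>M ?X"
    proof (intro measurable_Pair measurable_restrict)
      show "(\<lambda>\<omega>. \<omega>) \<in> \<mu> \<rightarrow>\<^sub>M G"
        using G sets.sets_into_space[of _ \<mu>]
        by (intro measurableI) (auto simp: subalgebra_def Int_absorb2 vimage_def)
    qed (use sub xm in blast)+
    from measurable_sets[OF this Bm] show ?thesis
      by (simp add: bad_def vimage_def Int_def conj_commute)
  qed
  have cover: "E - H \<subseteq> bad"
  proof
    fix \<omega> assume w: "\<omega> \<in> E - H"
    then have ws: "\<omega> \<in> space \<mu>" and We: "W (Phat 1 \<omega>) (Phat k \<omega>) \<le> ennreal r"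
      and Wh: "ennreal \<epsilon> < W (P 1 \<omega>) (Phat k \<omega>)"
      by (auto simp: E_def H_def not_le)
    have Phk: "Phat k \<omega> = empirical \<Xi> (N k) (\<lambda>j. \<xi> k j \<omega>)" by (simp add: Phat_def)
    have "W (P 1 \<omega>) (Phat k \<omega>) \<le> W (P 1 \<omega>) (Phat 1 \<omega>) + W (Phat 1 \<omega>) (Phat k \<omega>)"
      unfolding Phk using xX[OF k _ ws] by (intro tri Phd[OF one ws] N1[OF k])
    then have "ennreal \<epsilon> < W (P 1 \<omega>) (Phat 1 \<omega>) + ennreal r"
      using Wh We by (meson add_left_mono less_le_trans order_trans)
    then have "ennreal (\<epsilon> - r) < W (P 1 \<omega>) (Phat 1 \<omega>)"
    proof (rule contrapos_pp)
      assume "\<not> ennreal (\<epsilon> - r) < W (P 1 \<omega>) (Phat 1 \<omega>)"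
      then have "W (P 1 \<omega>) (Phat 1 \<omega>) + ennreal r \<le> ennreal (\<epsilon> - r) + ennreal r"
        by (intro add_right_mono) simp
      also have "\<dots> = ennreal \<epsilon>" using r by (subst ennreal_plus[symmetric]) auto
      finally show "\<not> ennreal \<epsilon> < W (P 1 \<omega>) (Phat 1 \<omega>) + ennreal r" by simp
    qed
    moreover have "?T \<omega> \<in> space ?X"
      using ws xX[OF one _ ws] xX[OF k _ ws]
      by (auto simp: space_pair_measure spG space_PiM space_restrict_space)
    ultimately show "\<omega> \<in> bad"
      using ws Wh by (simp add: bad_def B_def empirical_restrict Phat_def)
  qed
  define D where "D \<omega> = W (P 1 \<omega>) (P k \<omega>)" for \<omega>
  \<comment> \<open>Neither \<open>P 1\<close> nor \<open>P k\<close> need be an empirical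
    distribution, so the description by shares gives no access to \<open>D\<close>; its
    measurability is a hypothesis.\<close>
  have Dm[measurable]: "D \<in> borel_measurable \<mu>"
    unfolding D_def[abs_def] using assms(19)[OF k] .
  let ?b = "\<lambda>s. \<beta> (\<epsilon> - s) (N k)"
  have bm[measurable]: "?b \<in> borel_measurable borel"
    unfolding \<beta>_def by (intro measurable_compose[OF _ measurable_conc_beta]) measurable
  have b0: "0 \<le> \<beta> s n" and b1: "\<beta> s n \<le> c1" for s n
    using c12 by (auto simp: \<beta>_def intro!: conc_beta_nonneg conc_beta_le)
  let ?J = "indicator {\<omega>. D \<omega> \<le> ennreal \<epsilon>} :: _ \<Rightarrow> real"
  have Jm[measurable]: "?J \<in> borel_measurable \<mu>"
    by (rule borel_measurable_indicator_Collect) measurable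
  \<comment> \<open>This bounds the conditional probability of the second condition. Where
    \<open>D\<close> exceeds \<open>\<epsilon>\<close>, in particular where it is infinite, the
    indicator suppresses the value at \<open>enn2real (D \<omega>)\<close> and the trivial bound 1
    is left; these outcomes contribute \<open>1 - F k \<epsilon>\<close> to the integral.\<close>
  define \<psi> where "\<psi> \<omega> = ?J \<omega> * ?b (enn2real (D \<omega>)) + (1 - ?J \<omega>)" for \<omega>
  have psi0: "0 \<le> \<psi> \<omega>" for \<omega> using b0 by (auto simp: \<psi>_def indicator_def)
  have tail: "AE \<omega> in \<mu>. emeasure ((\<Pi>\<^sub>M j\<in>{1..N 1}. P 1 \<omega>) \<Otimes>\<^sub>M (\<Pi>\<^sub>M j\<in>{1..N k}. P k \<omega>)) (Pair \<omega> -` B)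
      \<le> ennreal (\<beta> (\<epsilon> - r) (N 1) * \<psi> \<omega>)"
    using \<open>AE \<omega> in \<mu>. \<forall>k\<in>{1..K}. light_tailed a A (P k \<omega>)\<close> AE_space
  proof eventually_elim
    fix \<omega> assume lt: "\<forall>k\<in>{1..K}. light_tailed a A (P k \<omega>)" and w: "\<omega> \<in> space \<mu>"
    let ?M1 = "\<Pi>\<^sub>M j\<in>{1..N 1}. P 1 \<omega>" and ?Mk = "\<Pi>\<^sub>M j\<in>{1..N k}. P k \<omega>"
    note Q1 = space_of_distributions[OF Pd[OF one w]] and Qk = space_of_distributions[OF Pd[OF k w]]
    have s1: "sets ?M1 = sets (\<Pi>\<^sub>M j\<in>{1..N 1}. ?S)" and sk: "sets ?Mk = sets (\<Pi>\<^sub>M j\<in>{1..N k}. ?S)"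
      by (auto intro!: sets_PiM_cong Q1 Qk)
    interpret Mk: prob_space ?Mk by (intro prob_space_PiM Qk)
    define U where "U = {x \<in> space ?M1. ennreal (\<epsilon> - r) < W (P 1 \<omega>) (empirical \<Xi> (N 1) x)}"
    define V where "V = {y \<in> space ?Mk. ennreal \<epsilon> < W (P 1 \<omega>) (empirical \<Xi> (N k) y)}"
    have meas: "(\<lambda>x. W Q (empirical \<Xi> (N i) x)) \<in> borel_measurable (\<Pi>\<^sub>M j\<in>{1..N i}. R)"
      if "i \<in> {1..K}" "Q \<in> distributions \<Xi>" "R \<in> distributions \<Xi>" for i Q R
    proof -
      note [measurable_cong] = space_of_distributions(2)[OF that(3)]
      have "(\<lambda>x. x j) \<in> (\<Pi>\<^sub>M j\<in>{1..N i}. R) \<rightarrow>\<^sub>M ?S" if "j \<in> {1..N i}" for j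
        using that by measurable
      then show ?thesis
        using measurable_wasserstein_empirical[of "\<lambda>_. Q" "\<Pi>\<^sub>M j\<in>{1..N i}. R" \<Xi> "N i" "\<lambda>j x. x j" dst p]
          that N1[OF that(1)] dm by (simp add: W_def)
    qed
    note [measurable] = meas[OF one Pd[OF one w] Pd[OF one w]] meas[OF k Pd[OF one w] Pd[OF k w]]
      meas[OF k Pd[OF k w] Pd[OF k w]]
    have Um: "U \<in> sets ?M1" unfolding U_def by measurable
    have Vm: "V \<in> sets ?Mk" unfolding V_def by measurable
    have "Pair \<omega> -` B = U \<times> V"
      using w by (auto simp: B_def U_def V_def space_pair_measure spG sets_eq_imp_space_eq[OF s1] sets_eq_imp_space_eq[OF sk])
    then have "emeasure (?M1 \<Otimes>\<^sub>M ?Mk) (Pair \<omega> -` B) = emeasure ?M1 U * emeasure ?Mk V"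
      using Mk.emeasure_pair_measure_Times[OF Um Vm] by simp
    also have "\<dots> \<le> ennreal (\<beta> (\<epsilon> - r) (N 1)) * ennreal (\<psi> \<omega>)"
    proof (rule mult_mono)
      show "emeasure ?M1 U \<le> ennreal (\<beta> (\<epsilon> - r) (N 1))"
        unfolding U_def \<beta>_def W_def using lt one r
        by (intro concentration_tail[OF conc Pd[OF one w]] N1 dm) auto
      show "emeasure ?Mk V \<le> ennreal (\<psi> \<omega>)"
      proof (cases "D \<omega> \<le> ennreal \<epsilon>")
        case True
        define s where "s = enn2real (D \<omega>)"
        have s: "D \<omega> = ennreal s" "0 \<le> s" "s \<le> \<epsilon>"
          using True r le_ennreal_iff_enn2real[of \<epsilon> "D \<omega>"] by (auto simp: s_def)
        have "V \<subseteq> {y \<in> space ?Mk. ennreal (\<epsilon> - s) < W (P k \<omega>) (empirical \<Xi> (N k) y)}"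
        proof
          fix y assume y: "y \<in> V"
          then have ys: "y \<in> space ?Mk" and yW: "ennreal \<epsilon> < W (P 1 \<omega>) (empirical \<Xi> (N k) y)"
            by (auto simp: V_def)
          have yX: "y j \<in> \<Xi>" if "j \<in> {1..N k}" for j
            using ys that by (auto simp: space_PiM PiE_iff Qk)
          have "ennreal \<epsilon> < ennreal s + W (P k \<omega>) (empirical \<Xi> (N k) y)"
            using less_le_trans[OF yW tri[OF Pd[OF k w] N1[OF k] yX]] by (simp add: D_def[symmetric] s(1))
          then have "ennreal (\<epsilon> - s) < W (P k \<omega>) (empirical \<Xi> (N k) y)"
          proof (rule contrapos_pp)
            assume "\<not> ennreal (\<epsilon> - s) < W (P k \<omega>) (empirical \<Xi> (N k) y)"
            then have "ennreal s + W (P k \<omega>) (empirical \<Xi> (N k) y) \<le> ennreal s + ennreal (\<epsilon> - s)"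
              by (intro add_left_mono) simp
            also have "\<dots> = ennreal \<epsilon>" using s by (subst ennreal_plus[symmetric]) auto
            finally show "\<not> ennreal \<epsilon> < ennreal s + W (P k \<omega>) (empirical \<Xi> (N k) y)" by simp
          qed
          then show "y \<in> {y \<in> space ?Mk. ennreal (\<epsilon> - s) < W (P k \<omega>) (empirical \<Xi> (N k) y)}"
            using ys by simp
        qed
        then have "emeasure ?Mk V \<le> emeasure ?Mk {y \<in> space ?Mk. ennreal (\<epsilon> - s) < W (P k \<omega>) (empirical \<Xi> (N k) y)}"
          by (rule emeasure_mono) measurable
        also have "\<dots> \<le> ennreal (\<beta> (\<epsilon> - s) (N k))"
          unfolding \<beta>_def W_def using lt k s
          by (intro concentration_tail[OF conc Pd[OF k w]] N1 dm) auto
        finally show ?thesis using True by (simp add: \<psi>_def s_def)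
      next
        case False
        then show ?thesis using Mk.emeasure_le_1[of V] by (simp add: \<psi>_def)
      qed
    qed auto
    also have "\<dots> = ennreal (\<beta> (\<epsilon> - r) (N 1) * \<psi> \<omega>)" using b0 psi0 by (simp add: ennreal_mult)
    finally show "emeasure (?M1 \<Otimes>\<^sub>M ?Mk) (Pair \<omega> -` B) \<le> ennreal (\<beta> (\<epsilon> - r) (N 1) * \<psi> \<omega>)" .
  qed
  have Jb: "integrable \<mu> (\<lambda>\<omega>. ?J \<omega> * ?b (enn2real (D \<omega>)))"
    using b0 b1 by (intro integrable_times_unit[where B=1 and C=c1] Jm measurable_compose[OF _ bm]) (auto simp: indicator_def)
  have Ji: "integrable \<mu> ?J" by (rule integrable_const_bound[where B=1]) (auto simp: indicator_def)
  have psii: "integrable \<mu> \<psi>"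
    unfolding \<psi>_def[abs_def] using Jb Ji by simp
  define L where "L = (LINT s:{0..\<epsilon>}|interval_measure (F k). ?b s) + 1 - F k \<epsilon>"
  have "(\<integral>\<omega>. \<psi> \<omega> \<partial>\<mu>) = L"
  proof -
    have Fk: "F k = ennreal_cdf \<mu> D" by (simp add: F_def D_def[abs_def] W_def)
    have "(\<integral>\<omega>. ?J \<omega> \<partial>\<mu>) = F k \<epsilon>"
    proof -
      have "(\<integral>\<omega>. ?J \<omega> \<partial>\<mu>) = (\<integral>\<omega>. indicator {\<omega> \<in> space \<mu>. D \<omega> \<le> ennreal \<epsilon>} \<omega> \<partial>\<mu>)"
        by (intro Bochner_Integration.integral_cong) (auto simp: indicator_def)
      also have "\<dots> = prob {\<omega> \<in> space \<mu>. D \<omega> \<le> ennreal \<epsilon>}"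
        by (subst Bochner_Integration.integral_indicator) (auto intro!: arg_cong[where f=prob])
      also have "\<dots> = F k \<epsilon>"
        using r unfolding Fk ennreal_cdf_def enn2ereal_le_ereal_iff
        by (subst le_ennreal_iff_enn2real) auto
      finally show ?thesis .
    qed
    moreover have "(LINT s:{0..\<epsilon>}|interval_measure (F k). ?b s) = (\<integral>\<omega>. ?J \<omega> * ?b (enn2real (D \<omega>)) \<partial>\<mu>)"
      unfolding Fk using r by (intro set_integral_ennreal_cdf prob_space_axioms Dm bm) auto
    moreover have "(\<integral>\<omega>. \<psi> \<omega> \<partial>\<mu>) = (\<integral>\<omega>. ?J \<omega> * ?b (enn2real (D \<omega>)) \<partial>\<mu>) + (1 - (\<integral>\<omega>. ?J \<omega> \<partial>\<mu>))"
      unfolding \<psi>_def using Jb Ji by (simp add: prob_space)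
    ultimately show ?thesis by (simp add: L_def)
  qed
  then have "emeasure \<mu> bad \<le> ennreal (\<beta> (\<epsilon> - r) (N 1) * L)"
  proof -
    assume L: "(\<integral>\<omega>. \<psi> \<omega> \<partial>\<mu>) = L"
    have "emeasure \<mu> bad \<le> (\<integral>\<^sup>+\<omega>. ennreal (\<beta> (\<epsilon> - r) (N 1) * \<psi> \<omega>) \<partial>\<mu>)"
      unfolding law by (rule nn_integral_mono_AE[OF tail])
    also have "\<dots> = ennreal (\<integral>\<omega>. \<beta> (\<epsilon> - r) (N 1) * \<psi> \<omega> \<partial>\<mu>)"
      using psii b0 psi0 by (intro nn_integral_eq_integral) auto
    finally show ?thesis using L by simp
  qed
  moreover have "0 \<le> L"
    using Bochner_Integration.integral_nonneg_AE[of \<psi> \<mu>] psi0 \<open>(\<integral>\<omega>. \<psi> \<omega> \<partial>\<mu>) = L\<close> by simp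
  ultimately have badL: "prob bad \<le> \<beta> (\<epsilon> - r) (N 1) * L"
    using b0 by (simp add: emeasure_eq_measure)
  have "prob E - prob (H \<inter> E) = prob (E - H)"
    using finite_measure_Diff'[OF Em Hm] by (simp add: Int_commute)
  also have "\<dots> \<le> prob bad" by (rule finite_measure_mono[OF cover badm])
  finally have main: "prob E - \<beta> (\<epsilon> - r) (N 1) * L \<le> prob (H \<inter> E)" using badL by simp
  have eq: "{\<omega> \<in> space \<mu>. P 1 \<omega> \<in> wasserstein_ball \<Xi> dst p \<epsilon> (Phat k \<omega>) \<and> W (Phat 1 \<omega>) (Phat k \<omega>) \<le> ennreal r}
    = H \<inter> E"
    using Pd[OF one] by (auto simp: H_def E_def wasserstein_ball_def W_def)
  have "1 - \<beta> (\<epsilon> - r) (N 1) * L / prob E = (prob E - \<beta> (\<epsilon> - r) (N 1) * L) / prob E"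
    using Epos by (simp add: diff_divide_distrib)
  also have "\<dots> \<le> prob (H \<inter> E) / prob E"
    using main Epos by (intro divide_right_mono) auto
  finally show ?thesis
    unfolding cond_prob_def eq E_def[symmetric] beta_F_def L_def .
qed

end
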